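(* Let $\mathcal{K}$ be a field, $\Gamma\leq\mathbb{R}$ an additive subgroup, $\Lambda=\Lambda^{\mathcal{K},\Gamma}$. Let $(C_*,\partial,\ell)$ be a Floer-type complex over $\Lambda$ and denote by $\tilde{\mathcal{B}}_{C,k}$ its degree-$k$ verbose barcode. Then there is a filtered chain isomorphism $$(C_*,\partial,\ell)\cong\bigoplus_{k\in\mathbb{Z}}\ \bigoplus_{([a],L)\in\tilde{\mathcal{B}}_{C,k}}\mathcal{E}(a,L,k)$$ (where for each $([a],L)\in\tilde{\mathcal{B}}_{C,k}$ we choose an arbitrary representative $a\in\mathbb{R}$ of the coset $[a]\in\mathbb{R}/\Gamma$).
   Context: **Novikov field.** $\Lambda=\Lambda^{\mathcal{K},\Gamma}$ is the field of formal sums $\sum_{g\in\Gamma}a_gT^g$ with $a_g\in\mathcal{K}$ such that for every $C\in\mathbb{R}$ only finitely many $g<C$ have $a_g\neq 0$, with power-series addition and multiplication. Its valuation is $\nu(\sum a_gT^g)=\min\{g\mid a_g\neq 0\}$, $\nu(0)=\infty$. **Orthogonalizable spaces.** A non-Archimedean normed vector space over $\Lambda$ is a pair $(C,\ell)$ with $C$ a $\Lambda$-vector space and $\ell\colon C\to\mathbb{R}\cup\{-\infty\}$ satisfying: $\ell(x)=-\infty$ iff $x=0$; $\ell(\lambda x)=\ell(x)-\nu(\lambda)$; $\ell(x+y)\leq\max\{\ell(x),\ell(y)\}$. A finite ordered collection $(w_1,\dots,w_r)$ in $C$ is orthogonal if $\ell(\sum_i\lambda_iw_i)=\max_i\ell(\lambda_iw_i)$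 for all $\lambda_i\in\Lambda$. An orthogonalizable $\Lambda$-space is a finite-dimensional non-Archimedean normed vector space admitting an orthogonal basis; subspaces (with restricted $\ell$) are again orthogonalizable. **Singular value decomposition.** Let $A\colon C\to D$ be a $\Lambda$-linear map of rank $r$ between orthogonalizable $\Lambda$-spaces. A singular value decomposition of $A$ is a choice of orthogonal ordered bases $(y_1,\dots,y_n)$ for $C$ and $(x_1,\dots,x_m)$ for $D$ such that: $(y_{r+1},\dots,y_n)$ is an orthogonal ordered basis for $\ker A$; $(x_1,\dots,x_r)$ is an orthogonal ordered basis for $\mathrm{Im}\,A$; $Ay_i=x_i$ for $i\leq r$; $\ell_C(y_1)-\ell_D(x_1)\geq\cdots\geq\ell_C(y_r)-\ell_D(x_r)$. **Floer-type complex.** $(C_*,\partial,\ell)$ is a chain complex $C_*=\bigoplus_{k\in\mathbb{Z}}C_k$ of $\Lambda$-vector spaces ($\partial C_k\subset C_{k-1}$, $\partial_k=\partial|_{C_k}$) with a function $\ell$ such that each $(C_k,\ell|_{C_k})$ is orthogonalizable and $\ell(\partial x)\leq\ell(x)$ for $x\in C_k$. A filtered chain isomorphism is a chain isomorphism $\Phi$ (over $\Lambda$, degree $0$) with $\ell(\Phi(x))=\ell(x)$ for all homogeneous $x$. **Verbose barcode.** From a singular value decomposition $((y_1,\dots,y_n),(x_1,\dots,x_m))$ of $\partial_{k+1}\colon C_{k+1}\to\ker\partial_k$, with $r=\mathrm{rank}\,\partial_{k+1}$, the degree-$k$ verbose barcode is the multiset of elements of $(\mathbb{R}/\Gamma)\times[0,\infty]$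 consisting of $(\ell(x_i)\bmod\Gamma,\ell(y_i)-\ell(x_i))$ for $i=1,\dots,r$ and $(\ell(x_i)\bmod\Gamma,\infty)$ for $i=r+1,\dots,m$. It does not depend on the choice of singular value decomposition. **Direct sums.** For Floer-type complexes $(C_{\alpha*},\partial_\alpha,\ell_\alpha)$ with, for each $k$, only finitely many $C_{\alpha k}$ nontrivial, $\bigoplus_\alpha$ denotes $(\bigoplus_\alpha C_{\alpha*},\bigoplus_\alpha\partial_\alpha,\tilde\ell)$ with $\tilde\ell((c_\alpha))=\max_\alpha\ell_\alpha(c_\alpha)$. **Elementary complexes.** For $a\in\mathbb{R}$, $L\in[0,\infty]$, $k\in\mathbb{Z}$, $\mathcal{E}(a,L,k)=(E_*,\partial_E,\ell_E)$ is: if $L=\infty$, $E_k=\Lambda$, $E_m=0$ for $m\neq k$, $\partial_E=0$, $\ell_E(\lambda)=a-\nu(\lambda)$; if $L<\infty$, $E_k$ is one-dimensional generated by $x$, $E_{k+1}$ is one-dimensional generated by $y$, $E_m=0$ for $m\notin\{k,k+1\}$, $\partial_E(\lambda x+\mu y)=\mu x$, $\ell_E(\lambda x+\mu y)=\max\{a-\nu(\lambda),(a+L)-\nu(\mu)\}$. *)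

theory Defs
  imports
    "HOL-Library.Extended_Real"
    "HOL-Library.Multiset"
    "HOL-Algebra.Coset"
    "Jordan_Normal_Form.Missing_VectorSpace"
begin

section \<open>The Novikov field\<close>

definition real_group :: "real monoid" where
  "real_group = \<lparr>carrier = UNIV, monoid.mult = (+), one = 0\<rparr>"

text \<open>
  A formal sum is represented by its coefficient function. The sum defining a product coefficient
  runs over a finite index set whenever both factors lie in the carrier.
\<close>

definition novikov_field :: "real set \<Rightarrow> (real \<Rightarrow> 'k::field) ring" where
  "novikov_field \<Gamma> =
    \<lparr>carrier = {f. (\<forall>g. f g \<noteq> 0 \<longrightarrow> g \<in> \<Gamma>) \<and> (\<forall>c. finite {g. g < c \<and> f g \<noteq> 0})},
     monoid.mult = (\<lambda>f h g. \<Sum>a | f a \<noteq> 0 \<and> h (g - a) \<noteq> 0. f a * h (g - a)),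
     one = (\<lambda>g. if g = 0 then 1 else 0),
     zero = (\<lambda>g. 0),
     add = (\<lambda>f h g. f g + h g)\<rparr>"

definition novikov_val :: "(real \<Rightarrow> 'k::field) \<Rightarrow> ereal" where
  "novikov_val f = (if f = (\<lambda>g. 0) then \<infinity> else ereal (LEAST g. f g \<noteq> 0))"


section \<open>Orthogonalizable spaces\<close>

text \<open>
  Only the values of the filtration function on the carrier matter, so a subspace
  \<open>V\<lparr>carrier := W\<rparr>\<close> carries the restricted filtration function without further notation.
\<close>

locale nonarch_normed_space =
  vectorspace "novikov_field \<Gamma>" V
  for \<Gamma> :: "real set" and V :: "(real \<Rightarrow> 'k::field, 'v) module" +
  fixes l :: "'v \<Rightarrow> ereal"
  assumes l_not_PInf: "x \<in> carrier V \<Longrightarrow> l x \<noteq> \<infinity>"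
    and l_eq_MInf: "x \<in> carrier V \<Longrightarrow> l x = -\<infinity> \<longleftrightarrow> x = \<zero>\<^bsub>V\<^esub>"
    and l_smult: "\<lbrakk>c \<in> carrier (novikov_field \<Gamma>); x \<in> carrier V\<rbrakk> \<Longrightarrow>
                    l (c \<odot>\<^bsub>V\<^esub> x) = l x - novikov_val c"
    and l_add: "\<lbrakk>x \<in> carrier V; y \<in> carrier V\<rbrakk> \<Longrightarrow> l (x \<oplus>\<^bsub>V\<^esub> y) \<le> max (l x) (l y)"

text \<open>A supremum over a finite index set is a maximum; over the empty one it is \<open>-\<infinity>\<close>.\<close>

definition orthogonal ::
    "real set \<Rightarrow> (real \<Rightarrow> 'k::field, 'v) module \<Rightarrow> ('v \<Rightarrow> ereal) \<Rightarrow> 'v list \<Rightarrow> bool" where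
  "orthogonal \<Gamma> V l ws \<longleftrightarrow> set ws \<subseteq> carrier V \<and>
     (\<forall>c. (\<forall>i<length ws. c i \<in> carrier (novikov_field \<Gamma>)) \<longrightarrow>
        l (\<Oplus>\<^bsub>V\<^esub>i\<in>{..<length ws}. c i \<odot>\<^bsub>V\<^esub> ws ! i) = (SUP i\<in>{..<length ws}. l (c i \<odot>\<^bsub>V\<^esub> ws ! i)))"

definition orthogonal_basis ::
    "real set \<Rightarrow> (real \<Rightarrow> 'k::field, 'v) module \<Rightarrow> ('v \<Rightarrow> ereal) \<Rightarrow> 'v list \<Rightarrow> bool" where
  "orthogonal_basis \<Gamma> V l ws \<longleftrightarrow>
     distinct ws \<and> vectorspace.basis (novikov_field \<Gamma>) V (set ws) \<and> orthogonal \<Gamma> V l ws"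

definition orthogonalizable ::
    "real set \<Rightarrow> (real \<Rightarrow> 'k::field, 'v) module \<Rightarrow> ('v \<Rightarrow> ereal) \<Rightarrow> bool" where
  "orthogonalizable \<Gamma> V l \<longleftrightarrow>
     nonarch_normed_space \<Gamma> V l \<and> vectorspace.fin_dim (novikov_field \<Gamma>) V \<and>
     (\<exists>ws. orthogonal_basis \<Gamma> V l ws)"


section \<open>Singular value decompositions\<close>

definition map_rank ::
    "real set \<Rightarrow> (real \<Rightarrow> 'k::field, 'v) module \<Rightarrow> (real \<Rightarrow> 'k, 'w) module \<Rightarrow> ('v \<Rightarrow> 'w) \<Rightarrow> nat" where
  "map_rank \<Gamma> V W A = vectorspace.dim (novikov_field \<Gamma>) (W\<lparr>carrier := mod_hom.im V A\<rparr>)"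

text \<open>Lists are indexed from 0, so the first \<open>r\<close> entries have indices \<open>i < r\<close>.\<close>

definition is_svd ::
    "real set \<Rightarrow> (real \<Rightarrow> 'k::field, 'v) module \<Rightarrow> ('v \<Rightarrow> ereal) \<Rightarrow>
     (real \<Rightarrow> 'k, 'w) module \<Rightarrow> ('w \<Rightarrow> ereal) \<Rightarrow> ('v \<Rightarrow> 'w) \<Rightarrow> 'v list \<Rightarrow> 'w list \<Rightarrow> bool" where
  "is_svd \<Gamma> V lV W lW A ys xs \<longleftrightarrow>
     (let r = map_rank \<Gamma> V W A in
        orthogonal_basis \<Gamma> V lV ys \<and>
        orthogonal_basis \<Gamma> W lW xs \<and>
        orthogonal_basis \<Gamma> (V\<lparr>carrier := mod_hom.ker V W A\<rparr>) lV (drop r ys) \<and>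
        orthogonal_basis \<Gamma> (W\<lparr>carrier := mod_hom.im V A\<rparr>) lW (take r xs) \<and>
        (\<forall>i<r. A (ys ! i) = xs ! i) \<and>
        (\<forall>i j. i \<le> j \<and> j < r \<longrightarrow> lV (ys ! j) - lW (xs ! j) \<le> lV (ys ! i) - lW (xs ! i)))"


section \<open>Floer-type complexes and their verbose barcodes\<close>

text \<open>
  A graded space is the family of its homogeneous parts: \<open>chains C k\<close> is the degree-\<open>k\<close> part,
  \<open>bd C k\<close> is the boundary map from degree \<open>k\<close> to degree \<open>k - 1\<close>, and \<open>lev C k\<close> is the filtration
  function on degree \<open>k\<close>.
\<close>

record ('r, 'v) filtered_complex =
  chains :: "int \<Rightarrow> ('r, 'v) module"
  bd :: "int \<Rightarrow> 'v \<Rightarrow> 'v"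
  lev :: "int \<Rightarrow> 'v \<Rightarrow> ereal"

definition floer_complex :: "real set \<Rightarrow> (real \<Rightarrow> 'k::field, 'v) filtered_complex \<Rightarrow> bool" where
  "floer_complex \<Gamma> C \<longleftrightarrow>
     (\<forall>k. orthogonalizable \<Gamma> (chains C k) (lev C k) \<and>
          linear_map (novikov_field \<Gamma>) (chains C k) (chains C (k - 1)) (bd C k) \<and>
          (\<forall>x\<in>carrier (chains C k).
             bd C (k - 1) (bd C k x) = \<zero>\<^bsub>chains C (k - 2)\<^esub> \<and>
             lev C (k - 1) (bd C k x) \<le> lev C k x))"

definition filtered_isomorphic ::
    "real set \<Rightarrow> (real \<Rightarrow> 'k::field, 'v) filtered_complex \<Rightarrow>
     (real \<Rightarrow> 'k, 'w) filtered_complex \<Rightarrow> bool" where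
  "filtered_isomorphic \<Gamma> C D \<longleftrightarrow>
     (\<exists>\<Phi> :: int \<Rightarrow> 'v \<Rightarrow> 'w. \<forall>k.
        linear_map (novikov_field \<Gamma>) (chains C k) (chains D k) (\<Phi> k) \<and>
        bij_betw (\<Phi> k) (carrier (chains C k)) (carrier (chains D k)) \<and>
        (\<forall>x\<in>carrier (chains C k).
           \<Phi> (k - 1) (bd C k x) = bd D k (\<Phi> k x) \<and> lev D k (\<Phi> k x) = lev C k x))"

definition cycles :: "('r, 'v) filtered_complex \<Rightarrow> int \<Rightarrow> ('r, 'v) module" where
  "cycles C k = (chains C k)\<lparr>carrier := mod_hom.ker (chains C k) (chains C (k - 1)) (bd C k)\<rparr>"

text \<open>
  Elements of \<open>\<real>/\<Gamma>\<close> are cosets, as sets of reals. Bar lengths lie in \<open>[0, \<infinity>]\<close> because the boundary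
  map does not increase the filtration level.
\<close>

definition svd_barcode ::
    "real set \<Rightarrow> ('v \<Rightarrow> ereal) \<Rightarrow> ('w \<Rightarrow> ereal) \<Rightarrow> nat \<Rightarrow> 'v list \<Rightarrow> 'w list \<Rightarrow>
     (real set \<times> ereal) multiset" where
  "svd_barcode \<Gamma> lV lW r ys xs =
     {# (\<Gamma> #>\<^bsub>real_group\<^esub> real_of_ereal (lW (xs ! i)), if i < r then lV (ys ! i) - lW (xs ! i) else \<infinity>).
        i \<in># mset_set {..<length xs} #}"

text \<open>
  The barcode does not depend on the singular value decomposition it is computed from, so
  \<open>SOME\<close> merely names the common value.
\<close>

definition verbose_barcode ::
    "real set \<Rightarrow> (real \<Rightarrow> 'k::field, 'v) filtered_complex \<Rightarrow> int \<Rightarrow> (real set \<times> ereal) multiset" where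
  "verbose_barcode \<Gamma> C k =
     (SOME B. \<exists>ys xs.
        is_svd \<Gamma> (chains C (k + 1)) (lev C (k + 1)) (cycles C k) (lev C k) (bd C (k + 1)) ys xs \<and>
        B = svd_barcode \<Gamma> (lev C (k + 1)) (lev C k)
              (map_rank \<Gamma> (chains C (k + 1)) (cycles C k) (bd C (k + 1))) ys xs)"


section \<open>Direct sums and elementary complexes\<close>

text \<open>
  The ring multiplication and unit of a \<^typ>\<open>('r, 'v) module\<close> record play no role for modules; they
  are filled in with constant zeros below.
\<close>

definition module_direct_sum :: "'i set \<Rightarrow> ('i \<Rightarrow> ('r, 'v) module) \<Rightarrow> ('r, 'i \<Rightarrow> 'v) module" where
  "module_direct_sum I M =
    \<lparr>carrier = {x \<in> \<Pi>\<^sub>E i\<in>I. carrier (M i). finite {i \<in> I. x i \<noteq> \<zero>\<^bsub>M i\<^esub>}},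
     monoid.mult = (\<lambda>x y. \<lambda>i\<in>I. \<zero>\<^bsub>M i\<^esub>),
     one = (\<lambda>i\<in>I. \<zero>\<^bsub>M i\<^esub>),
     zero = (\<lambda>i\<in>I. \<zero>\<^bsub>M i\<^esub>),
     add = (\<lambda>x y. \<lambda>i\<in>I. x i \<oplus>\<^bsub>M i\<^esub> y i),
     smult = (\<lambda>c x. \<lambda>i\<in>I. c \<odot>\<^bsub>M i\<^esub> x i)\<rparr>"

definition complex_direct_sum ::
    "'i set \<Rightarrow> ('i \<Rightarrow> ('r, 'v) filtered_complex) \<Rightarrow> ('r, 'i \<Rightarrow> 'v) filtered_complex" where
  "complex_direct_sum I C =
    \<lparr>chains = (\<lambda>k. module_direct_sum I (\<lambda>i. chains (C i) k)),
     bd = (\<lambda>k x. \<lambda>i\<in>I. bd (C i) k (x i)),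
     lev = (\<lambda>k x. SUP i\<in>I. lev (C i) k (x i))\<rparr>"

text \<open>
  The pair \<open>(c, d)\<close> stands for \<open>cx + dy\<close>, where \<open>x\<close> generates degree \<open>k\<close> and \<open>y\<close> generates degree
  \<open>k + 1\<close> (the latter only if \<open>L < \<infinity>\<close>); in each degree the coefficients of absent generators vanish.
\<close>

definition elementary_complex ::
    "real set \<Rightarrow> real \<Rightarrow> ereal \<Rightarrow> int \<Rightarrow>
     (real \<Rightarrow> 'k::field, (real \<Rightarrow> 'k) \<times> (real \<Rightarrow> 'k)) filtered_complex" where
  "elementary_complex \<Gamma> a L k =
    \<lparr>chains = (\<lambda>m.
       \<lparr>carrier = {(c, d). c \<in> carrier (novikov_field \<Gamma>) \<and> d \<in> carrier (novikov_field \<Gamma>) \<and>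
                    (m \<noteq> k \<longrightarrow> c = \<zero>\<^bsub>novikov_field \<Gamma>\<^esub>) \<and>
                    (m \<noteq> k + 1 \<or> L = \<infinity> \<longrightarrow> d = \<zero>\<^bsub>novikov_field \<Gamma>\<^esub>)},
        monoid.mult = (\<lambda>u v. (\<zero>\<^bsub>novikov_field \<Gamma>\<^esub>, \<zero>\<^bsub>novikov_field \<Gamma>\<^esub>)),
        one = (\<zero>\<^bsub>novikov_field \<Gamma>\<^esub>, \<zero>\<^bsub>novikov_field \<Gamma>\<^esub>),
        zero = (\<zero>\<^bsub>novikov_field \<Gamma>\<^esub>, \<zero>\<^bsub>novikov_field \<Gamma>\<^esub>),
        add = (\<lambda>(c, d) (c', d'). (c \<oplus>\<^bsub>novikov_field \<Gamma>\<^esub> c', d \<oplus>\<^bsub>novikov_field \<Gamma>\<^esub> d')),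
        smult = (\<lambda>b (c, d). (b \<otimes>\<^bsub>novikov_field \<Gamma>\<^esub> c, b \<otimes>\<^bsub>novikov_field \<Gamma>\<^esub> d))\<rparr>),
     bd = (\<lambda>m (c, d). (d, \<zero>\<^bsub>novikov_field \<Gamma>\<^esub>)),
     lev = (\<lambda>m (c, d). if L = \<infinity> then ereal a - novikov_val c
                        else max (ereal a - novikov_val c) ((ereal a + L) - novikov_val d))\<rparr>"

text \<open>One index for each element of a multiset, counted with multiplicity.\<close>

definition mset_index :: "'b multiset \<Rightarrow> ('b \<times> nat) set" where
  "mset_index B = {(b, j). j < count B b}"

end

theory Submission
  imports Defs
begin

text \<open>
  Gaussian elimination, pivoting on the entry along which the map raises the filtration level most,
  keeps the bases of domain and codomain orthogonal. So every linear map between orthogonalizable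
  spaces has a singular value decomposition, and its kernel is orthogonalizable. Take such a
  decomposition of \<open>\<partial>\<close> in every degree. The vectors \<open>x\<^sub>i\<close> from degree \<open>k + 1\<close> form an orthogonal basis
  of the cycles in \<open>C\<^sub>k\<close>, the vectors \<open>y\<^sub>j\<close> with \<open>j \<le> r\<close> from degree \<open>k\<close> span an orthogonal complement
  of these cycles, and \<open>\<partial>\<close> maps each \<open>y\<^sub>j\<close> to the corresponding \<open>x\<^sub>j\<close> in \<open>C\<^sub>k\<^sub>-\<^sub>1\<close>. Multiplying \<open>x\<^sub>i\<close> and \<open>y\<^sub>i\<close>
  by the same power of \<open>T\<close> moves the level of \<open>x\<^sub>i\<close> to the chosen representative of its coset.
\<close>

text \<open>Decompositions in different degrees are chosen independently, and this is the obstacle: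
  the one for \<open>\<partial>\<close> on degree \<open>k\<close> brings its own basis of the
  cycles in degree \<open>k\<close>, in general not the vectors \<open>x_i\<close> coming from
  degree \<open>k + 1\<close>. They are glued by exchanging the kernel part of the former for the
  latter. Orthogonality survives, because a complement orthogonal to the kernel does not depend on
  the orthogonal basis used for the kernel. The pivot rule answers two demands. Replacing a basis
  vector of the codomain by the image of the pivot column is harmless if the pivot term dominates
  its column; subtracting multiples of the pivot column is harmless if each multiple lies no higher
  than the vector it is subtracted from. Maximality over all remaining entries meets one demand by
  comparison within the column, the other within the row. As \<open>verbose_barcode\<close> is fixed
  by choice, existence of a decomposition guarantees that it comes from an actual one. The
  isomorphism is written down from the barcode complex to \<open>C\<close>, where it is a linear
  combination of generators, and inverted.\<close>

section \<open>Orthogonal families\<close>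

text \<open>
  Families indexed by an arbitrary finite set, so that bars can serve as indices. Of the equation
  defining orthogonality only one inequality is required; the ultrametric inequality gives the other.
\<close>

definition orth_frame ::
    "real set \<Rightarrow> (real \<Rightarrow> 'k::field, 'v) module \<Rightarrow> ('v \<Rightarrow> ereal) \<Rightarrow> 'i set \<Rightarrow> ('i \<Rightarrow> 'v) \<Rightarrow> bool" where
  "orth_frame \<Gamma> V l I w \<longleftrightarrow>
     finite I \<and> w \<in> I \<rightarrow> carrier V - {\<zero>\<^bsub>V\<^esub>} \<and>
     (\<forall>c\<in>I \<rightarrow> carrier (novikov_field \<Gamma>). \<forall>i\<in>I.
        l (c i \<odot>\<^bsub>V\<^esub> w i) \<le> l (\<Oplus>\<^bsub>V\<^esub>i\<in>I. c i \<odot>\<^bsub>V\<^esub> w i)) \<and>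
     (\<forall>v\<in>carrier V. \<exists>c\<in>I \<rightarrow> carrier (novikov_field \<Gamma>). v = (\<Oplus>\<^bsub>V\<^esub>i\<in>I. c i \<odot>\<^bsub>V\<^esub> w i))"

lemma novikov_val_not_MInf: "novikov_val c \<noteq> -\<infinity>"
  by (simp add: novikov_val_def)

lemma zero_novikov: "\<zero>\<^bsub>novikov_field \<Gamma>\<^esub> = (\<lambda>g. 0)"
  by (simp add: novikov_field_def)

lemma novikov_val_zero: "novikov_val \<zero>\<^bsub>novikov_field \<Gamma>\<^esub> = \<infinity>"
  by (simp add: novikov_val_def zero_novikov)

lemma novikov_val_finite:
  assumes "c \<noteq> \<zero>\<^bsub>novikov_field \<Gamma>\<^esub>"
  shows "\<bar>novikov_val c\<bar> \<noteq> \<infinity>"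
  using assms by (simp add: novikov_val_def zero_novikov)

section \<open>Linear combinations and levels in a normed space\<close>

context nonarch_normed_space
begin

abbreviation K :: "(real \<Rightarrow> 'k) ring" where "K \<equiv> novikov_field \<Gamma>"

abbreviation lc where "lc I c w \<equiv> (\<Oplus>\<^bsub>V\<^esub>i\<in>I. c i \<odot>\<^bsub>V\<^esub> w i)"

lemma lc_closed:
  assumes "c \<in> I \<rightarrow> carrier K" "w \<in> I \<rightarrow> carrier V"
  shows "lc I c w \<in> carrier V"
  using assms by (intro M.finsum_closed) auto

lemma lc_add:
  assumes "c \<in> I \<rightarrow> carrier K" "d \<in> I \<rightarrow> carrier K" "w \<in> I \<rightarrow> carrier V"
  shows "lc I (\<lambda>i. c i \<oplus>\<^bsub>K\<^esub> d i) w = lc I c w \<oplus>\<^bsub>V\<^esub> lc I d w"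
proof -
  have "lc I (\<lambda>i. c i \<oplus>\<^bsub>K\<^esub> d i) w = (\<Oplus>\<^bsub>V\<^esub>i\<in>I. c i \<odot>\<^bsub>V\<^esub> w i \<oplus>\<^bsub>V\<^esub> d i \<odot>\<^bsub>V\<^esub> w i)"
    using assms by (intro M.finsum_cong') (auto simp: Pi_iff smult_l_distr)
  then show ?thesis
    using assms by (simp add: M.finsum_addf Pi_iff)
qed

lemma lc_smult:
  assumes "finite I" "a \<in> carrier K" "c \<in> I \<rightarrow> carrier K" "w \<in> I \<rightarrow> carrier V"
  shows "lc I (\<lambda>i. a \<otimes>\<^bsub>K\<^esub> c i) w = a \<odot>\<^bsub>V\<^esub> lc I c w"
proof -
  have "a \<odot>\<^bsub>V\<^esub> lc I c w = (\<Oplus>\<^bsub>V\<^esub>i\<in>I. a \<odot>\<^bsub>V\<^esub> (c i \<odot>\<^bsub>V\<^esub> w i))"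
    using assms by (intro finsum_smult_ldistr) auto
  also have "\<dots> = lc I (\<lambda>i. a \<otimes>\<^bsub>K\<^esub> c i) w"
    using assms by (intro M.finsum_cong') (auto simp: Pi_iff smult_assoc1)
  finally show ?thesis ..
qed

lemma lc_cong:
  assumes "I = J" "\<And>i. i \<in> J \<Longrightarrow> c i = d i" "\<And>i. i \<in> J \<Longrightarrow> v i = w i"
    "d \<in> J \<rightarrow> carrier K" "w \<in> J \<rightarrow> carrier V"
  shows "lc I c v = lc J d w"
  using assms by (intro M.finsum_cong') auto

lemma lc_Un:
  assumes "finite I" "finite J" "I \<inter> J = {}" "c \<in> I \<union> J \<rightarrow> carrier K" "w \<in> I \<union> J \<rightarrow> carrier V"
  shows "lc (I \<union> J) c w = lc I c w \<oplus>\<^bsub>V\<^esub> lc J c w"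
  using assms by (intro M.finsum_Un_disjoint) auto

lemma lc_remove:
  assumes "finite I" "i \<in> I" "c \<in> I \<rightarrow> carrier K" "w \<in> I \<rightarrow> carrier V"
  shows "lc I c w = c i \<odot>\<^bsub>V\<^esub> w i \<oplus>\<^bsub>V\<^esub> lc (I - {i}) c w"
proof -
  have "lc (insert i (I - {i})) c w = c i \<odot>\<^bsub>V\<^esub> w i \<oplus>\<^bsub>V\<^esub> lc (I - {i}) c w"
    using assms by (intro M.finsum_insert) auto
  with assms(2) show ?thesis
    by (simp add: insert_absorb)
qed

lemma lc_zero:
  assumes "\<And>i. i \<in> I \<Longrightarrow> c i = \<zero>\<^bsub>K\<^esub>" "w \<in> I \<rightarrow> carrier V"
  shows "lc I c w = \<zero>\<^bsub>V\<^esub>"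
  using assms by (intro M.add.finprod_one_eqI) (auto simp: Pi_iff)

lemma lc_supset:
  assumes "finite J" "I \<subseteq> J" "c \<in> I \<rightarrow> carrier K" "w \<in> J \<rightarrow> carrier V"
  shows "lc J (\<lambda>i. if i \<in> I then c i else \<zero>\<^bsub>K\<^esub>) w = lc I c w"
proof -
  let ?c = "\<lambda>i. if i \<in> I then c i else \<zero>\<^bsub>K\<^esub>"
  have *: "?c \<in> J \<rightarrow> carrier K"
    using assms(3) by auto
  have J: "J = I \<union> (J - I)" and [simp]: "finite I" 
    using assms(1,2) by (auto intro: finite_subset)
  have "lc (I \<union> (J - I)) ?c w = lc I ?c w \<oplus>\<^bsub>V\<^esub> lc (J - I) ?c w"
    using assms * by (intro lc_Un) auto
  moreover have "lc (J - I) ?c w = \<zero>\<^bsub>V\<^esub>"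
    using assms by (intro lc_zero) auto
  moreover have "lc I ?c w = lc I c w"
    using assms by (intro lc_cong) auto
  moreover have "lc I c w \<in> carrier V"
    using assms by (intro lc_closed) auto
  ultimately show ?thesis
    using J by simp
qed

lemma lc_single:
  assumes "finite I" "i \<in> I" "w \<in> I \<rightarrow> carrier V"
  shows "lc I (\<lambda>j. if j = i then \<one>\<^bsub>K\<^esub> else \<zero>\<^bsub>K\<^esub>) w = w i"
proof -
  have "lc I (\<lambda>j. if j \<in> {i} then \<one>\<^bsub>K\<^esub> else \<zero>\<^bsub>K\<^esub>) w = lc {i} (\<lambda>j. \<one>\<^bsub>K\<^esub>) w"
    using assms by (intro lc_supset) auto
  also have "\<dots> = w i"
    using assms by (auto simp: Pi_iff)
  finally show ?thesis
    by simp
qed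

lemma l_zero: "l \<zero>\<^bsub>V\<^esub> = -\<infinity>"
  by (simp add: l_eq_MInf)

lemma l_finite: "\<lbrakk>x \<in> carrier V; x \<noteq> \<zero>\<^bsub>V\<^esub>\<rbrakk> \<Longrightarrow> \<bar>l x\<bar> \<noteq> \<infinity>"
  using l_not_PInf[of x] l_eq_MInf[of x] by auto

text \<open>Nonzero \<open>c\<close> and \<open>x\<close> have a finite valuation and a finite
  level, so their product has a finite level and cannot be zero.\<close>

lemma smult_eq_zeroD:
  assumes "c \<in> carrier K" "x \<in> carrier V" "x \<noteq> \<zero>\<^bsub>V\<^esub>" "c \<odot>\<^bsub>V\<^esub> x = \<zero>\<^bsub>V\<^esub>"
  shows "c = \<zero>\<^bsub>K\<^esub>"
proof (rule ccontr)
  assume "c \<noteq> \<zero>\<^bsub>K\<^esub>"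
  then have "\<bar>l x - novikov_val c\<bar> \<noteq> \<infinity>"
    using l_finite[of x] assms novikov_val_finite[of c \<Gamma>] by (cases "l x"; cases "novikov_val c") auto
  moreover have "l x - novikov_val c = -\<infinity>"
    using l_smult[of c x] assms by (simp add: l_zero)
  ultimately show False by simp
qed

text \<open>The valuation of -1 is found without computing it: negating twice gives
  \<open>l x = l x - 2 \<nu>(-1)\<close>. For nonzero \<open>x\<close> the level is finite, which
  forces \<nu>(-1) = 0.\<close>

lemma l_uminus:
  assumes "x \<in> carrier V"
  shows "l (\<ominus>\<^bsub>V\<^esub> x) = l x"
proof (cases "x = \<zero>\<^bsub>V\<^esub>")
  case False
  let ?c = "\<ominus>\<^bsub>K\<^esub> \<one>\<^bsub>K\<^esub>"
  have c: "?c \<in> carrier K" by simp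
  have *: "l (\<ominus>\<^bsub>V\<^esub> y) = l y - novikov_val ?c" if "y \<in> carrier V" for y
    using that l_smult[OF c that] smult_minus_1[OF that] by simp
  have "l x = l x - novikov_val ?c - novikov_val ?c"
    using *[of x] *[of "\<ominus>\<^bsub>V\<^esub> x"] assms by simp
  then have "novikov_val ?c = 0"
    using l_finite[OF assms False] novikov_val_not_MInf[of ?c]
    by (cases "l x"; cases "novikov_val ?c") auto
  then show ?thesis
    using *[OF assms] by simp
next
  case True
  have "\<ominus>\<^bsub>V\<^esub> \<zero>\<^bsub>V\<^esub> = \<zero>\<^bsub>V\<^esub>"
    by (rule M.minus_equality) simp_all
  with True show ?thesis
    by (simp only:)
qed

lemma l_minus:
  assumes "x \<in> carrier V" "y \<in> carrier V"
  shows "l (x \<ominus>\<^bsub>V\<^esub> y) \<le> max (l x) (l y)"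
  using l_add[of x "\<ominus>\<^bsub>V\<^esub> y"] assms by (simp add: a_minus_def l_uminus)

lemma l_sum_le:
  assumes "f \<in> I \<rightarrow> carrier V" "\<And>i. i \<in> I \<Longrightarrow> l (f i) \<le> B"
  shows "l (\<Oplus>\<^bsub>V\<^esub>i\<in>I. f i) \<le> B"
  using assms
proof (induction I rule: infinite_finite_induct)
  case (insert x F)
  then have "l (f x \<oplus>\<^bsub>V\<^esub> (\<Oplus>\<^bsub>V\<^esub>i\<in>F. f i)) \<le> max (l (f x)) (l (\<Oplus>\<^bsub>V\<^esub>i\<in>F. f i))"
    by (intro l_add M.finsum_closed) auto
  also have "\<dots> \<le> B"
    using insert by auto
  finally show ?case
    using insert by (subst M.finsum_insert) auto
qed (auto simp: l_zero)

lemma l_smult_mono: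
  assumes "c \<in> carrier K" "x \<in> carrier V" "y \<in> carrier V" "l x \<le> l y"
  shows "l (c \<odot>\<^bsub>V\<^esub> x) \<le> l (c \<odot>\<^bsub>V\<^esub> y)"
  using assms by (simp add: l_smult ereal_minus_mono)

lemma orth_frameI:
  assumes "finite I" "\<And>i. i \<in> I \<Longrightarrow> w i \<in> carrier V" "\<And>i. i \<in> I \<Longrightarrow> w i \<noteq> \<zero>\<^bsub>V\<^esub>"
    and "\<And>c i. c \<in> I \<rightarrow> carrier K \<Longrightarrow> i \<in> I \<Longrightarrow> l (c i \<odot>\<^bsub>V\<^esub> w i) \<le> l (lc I c w)"
    and "\<And>v. v \<in> carrier V \<Longrightarrow> \<exists>c\<in>I \<rightarrow> carrier K. v = lc I c w"
  shows "orth_frame \<Gamma> V l I w"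
  using assms unfolding orth_frame_def by blast

section \<open>Consequences of orthogonality and operations on frames\<close>

context
  fixes I and w :: "'i \<Rightarrow> 'v"
  assumes fr: "orth_frame \<Gamma> V l I w"
begin

lemma frame_finite: "finite I"
  and frame_carrier: "w \<in> I \<rightarrow> carrier V"
  and frame_nonzero: "i \<in> I \<Longrightarrow> w i \<noteq> \<zero>\<^bsub>V\<^esub>"
  and frame_le: "c \<in> I \<rightarrow> carrier K \<Longrightarrow> i \<in> I \<Longrightarrow> l (c i \<odot>\<^bsub>V\<^esub> w i) \<le> l (lc I c w)"
  using fr unfolding orth_frame_def by auto

lemma frame_span: 
  assumes "v \<in> carrier V"
  obtains c where "c \<in> I \<rightarrow> carrier K" "v = lc I c w"
  using fr assms unfolding orth_frame_def by auto

lemma frame_level: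
  assumes "c \<in> I \<rightarrow> carrier K"
  shows "l (lc I c w) = (SUP i\<in>I. l (c i \<odot>\<^bsub>V\<^esub> w i))"
proof (rule antisym)
  show "l (lc I c w) \<le> (SUP i\<in>I. l (c i \<odot>\<^bsub>V\<^esub> w i))"
    using assms frame_carrier by (intro l_sum_le SUP_upper) auto
  show "(SUP i\<in>I. l (c i \<odot>\<^bsub>V\<^esub> w i)) \<le> l (lc I c w)"
    using assms by (intro SUP_least frame_le)
qed

text \<open>Orthogonality contains independence: a vanishing combination has level -\<infinity>,
  this bounds the level of each of its terms, and a multiple of a nonzero vector has level
  -\<infinity> only for the zero scalar.\<close>

lemma frame_independent:
  assumes "c \<in> I \<rightarrow> carrier K" "lc I c w = \<zero>\<^bsub>V\<^esub>" "i \<in> I"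
  shows "c i = \<zero>\<^bsub>K\<^esub>"
proof (rule smult_eq_zeroD)
  have "l (c i \<odot>\<^bsub>V\<^esub> w i) \<le> -\<infinity>"
    using frame_le[OF assms(1,3)] assms(2) by (simp add: l_zero)
  then show "c i \<odot>\<^bsub>V\<^esub> w i = \<zero>\<^bsub>V\<^esub>"
    using assms frame_carrier by (subst l_eq_MInf[symmetric]) auto
qed (use assms frame_carrier frame_nonzero in auto)

text \<open>Equal vectors at different indices would give a relation with coefficients 1 and
  -1.\<close>

lemma frame_inj_on: "inj_on w I"
proof (rule inj_onI, rule ccontr)
  fix i j assume ij: "i \<in> I" "j \<in> I" "w i = w j" "i \<noteq> j"
  let ?c = "\<lambda>k. (if k = i then \<one>\<^bsub>K\<^esub> else if k = j then \<ominus>\<^bsub>K\<^esub> \<one>\<^bsub>K\<^esub> else \<zero>\<^bsub>K\<^esub>)"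
  have c: "?c \<in> I \<rightarrow> carrier K" by auto
  have "lc I ?c w = ?c i \<odot>\<^bsub>V\<^esub> w i \<oplus>\<^bsub>V\<^esub> lc (I - {i}) ?c w"
    using ij c frame_carrier frame_finite by (intro lc_remove) auto
  also have "lc (I - {i}) ?c w = ?c j \<odot>\<^bsub>V\<^esub> w j \<oplus>\<^bsub>V\<^esub> lc (I - {i} - {j}) ?c w"
    using ij c frame_carrier frame_finite by (intro lc_remove) auto
  also have "lc (I - {i} - {j}) ?c w = \<zero>\<^bsub>V\<^esub>"
    using ij frame_carrier by (intro lc_zero) auto
  also have "?c i \<odot>\<^bsub>V\<^esub> w i \<oplus>\<^bsub>V\<^esub> (?c j \<odot>\<^bsub>V\<^esub> w j \<oplus>\<^bsub>V\<^esub> \<zero>\<^bsub>V\<^esub>) = \<zero>\<^bsub>V\<^esub>"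
  proof -
    have "w j \<in> carrier V"
      using ij frame_carrier by auto
    then show ?thesis
      using ij by (simp add: smult_minus_1 M.r_neg)
  qed
  finally have "?c i = \<zero>\<^bsub>K\<^esub>"
    using frame_independent[OF c _ ij(1)] by blast
  then show False by simp
qed

text \<open>Carries a frame indexed by list positions over to bars. Coefficients on \<open>J\<close>
  are transported to \<open>I\<close> along the inverse of \<open>f\<close>.\<close>

lemma frame_reindex:
  assumes "bij_betw f J I"
  shows "orth_frame \<Gamma> V l J (\<lambda>j. w (f j))"
proof (rule orth_frameI)
  have fI: "I = f ` J" and inj: "inj_on f J"
    using assms by (auto simp: bij_betw_def)
  show "finite J"
    using assms bij_betw_finite frame_finite by blast
  show "w (f j) \<in> carrier V" "w (f j) \<noteq> \<zero>\<^bsub>V\<^esub>" if "j \<in> J" for j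
    using that frame_carrier frame_nonzero fI by auto
  have lc: "lc I c w = lc J (\<lambda>j. c (f j)) (\<lambda>j. w (f j))" if "c \<in> I \<rightarrow> carrier K" for c
    unfolding fI using that frame_carrier
    by (intro M.finsum_reindex inj) (auto simp: fI)
  show "l (c j \<odot>\<^bsub>V\<^esub> w (f j)) \<le> l (lc J c (\<lambda>j. w (f j)))" if c: "c \<in> J \<rightarrow> carrier K" and j: "j \<in> J" for c j
  proof -
    let ?d = "\<lambda>i. c (the_inv_into J f i)"
    have df: "?d (f j) = c j" if "j \<in> J" for j
      using that by (simp add: the_inv_into_f_f inj)
    have d: "?d \<in> I \<rightarrow> carrier K"
      using c df fI by auto
    have "lc I ?d w = lc J c (\<lambda>j. w (f j))"
      using c frame_carrier unfolding lc[OF d] by (intro lc_cong) (auto simp: df fI)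
    then show ?thesis
      using frame_le[OF d, of "f j"] j by (simp add: df fI)
  qed
  show "\<exists>c\<in>J \<rightarrow> carrier K. v = lc J c (\<lambda>j. w (f j))" if v: "v \<in> carrier V" for v
  proof -
    obtain c where c: "c \<in> I \<rightarrow> carrier K" "v = lc I c w"
      using frame_span[OF v] .
    show ?thesis
      by (rule bexI[of _ "\<lambda>j. c (f j)"]) (use c lc fI in auto)
  qed
qed

text \<open>A nonzero scalar can be absorbed into the coefficient in front of it; for spanning, the
  coefficients are divided by \<open>s i\<close>. The scalars used later are powers of
  \<open>T\<close>.\<close>

lemma frame_scale:
  assumes s: "s \<in> I \<rightarrow> carrier K - {\<zero>\<^bsub>K\<^esub>}"
  shows "orth_frame \<Gamma> V l I (\<lambda>i. s i \<odot>\<^bsub>V\<^esub> w i)"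
proof (rule orth_frameI)
  have lc: "lc I c (\<lambda>i. s i \<odot>\<^bsub>V\<^esub> w i) = lc I (\<lambda>i. c i \<otimes>\<^bsub>K\<^esub> s i) w" if "c \<in> I \<rightarrow> carrier K" for c
    using that s frame_carrier by (intro M.finsum_cong') (auto simp: Pi_iff smult_assoc1)
  show "s i \<odot>\<^bsub>V\<^esub> w i \<in> carrier V" "s i \<odot>\<^bsub>V\<^esub> w i \<noteq> \<zero>\<^bsub>V\<^esub>" if "i \<in> I" for i
    using that s frame_carrier frame_nonzero[OF that] smult_eq_zeroD[of "s i" "w i"] by auto
  show "l (c i \<odot>\<^bsub>V\<^esub> (s i \<odot>\<^bsub>V\<^esub> w i)) \<le> l (lc I c (\<lambda>i. s i \<odot>\<^bsub>V\<^esub> w i))"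
    if c: "c \<in> I \<rightarrow> carrier K" and i: "i \<in> I" for c i
  proof -
    have "l ((c i \<otimes>\<^bsub>K\<^esub> s i) \<odot>\<^bsub>V\<^esub> w i) \<le> l (lc I (\<lambda>i. c i \<otimes>\<^bsub>K\<^esub> s i) w)"
      using c s i by (intro frame_le) auto
    moreover have "(c i \<otimes>\<^bsub>K\<^esub> s i) \<odot>\<^bsub>V\<^esub> w i = c i \<odot>\<^bsub>V\<^esub> (s i \<odot>\<^bsub>V\<^esub> w i)"
      using c s i frame_carrier by (intro smult_assoc1) auto
    ultimately show ?thesis
      using lc[OF c] by simp
  qed
  show "\<exists>c\<in>I \<rightarrow> carrier K. v = lc I c (\<lambda>i. s i \<odot>\<^bsub>V\<^esub> w i)" if v: "v \<in> carrier V" for v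
  proof -
    obtain c where c: "c \<in> I \<rightarrow> carrier K" "v = lc I c w"
      using frame_span[OF v] .
    let ?d = "\<lambda>i. c i \<otimes>\<^bsub>K\<^esub> inv\<^bsub>K\<^esub> (s i)"
    have d: "?d \<in> I \<rightarrow> carrier K"
      using c s by auto
    have "lc I ?d (\<lambda>i. s i \<odot>\<^bsub>V\<^esub> w i) = lc I (\<lambda>i. ?d i \<otimes>\<^bsub>K\<^esub> s i) w"
      by (rule lc[OF d])
    also have "\<dots> = lc I c w"
    proof (rule lc_cong)
      fix i assume i: "i \<in> I"
      then have "s i \<in> Units K"
        using s field_Units by auto
      then show "?d i \<otimes>\<^bsub>K\<^esub> s i = c i"
        using c i s by (auto simp: Pi_iff R.m_assoc)
    qed (use c frame_carrier in auto)
    finally show ?thesis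
      using c(2) d by (intro bexI[of _ ?d]) simp_all
  qed
qed (rule frame_finite)

text \<open>
  The term \<open>a w i\<close> dominates the rest of the new vector, so in any linear combination the correction
  that the replacement makes to the other coefficients is bounded by the level of the whole.
\<close>

lemma frame_replace:
  assumes i: "i \<in> I" and a: "a \<in> carrier K" "a \<noteq> \<zero>\<^bsub>K\<^esub>"
    and e: "e \<in> I - {i} \<rightarrow> carrier K" "l (lc (I - {i}) e w) \<le> l (a \<odot>\<^bsub>V\<^esub> w i)"
  shows "orth_frame \<Gamma> V l I (w(i := a \<odot>\<^bsub>V\<^esub> w i \<oplus>\<^bsub>V\<^esub> lc (I - {i}) e w))"
proof -
  define x where "x = a \<odot>\<^bsub>V\<^esub> w i \<oplus>\<^bsub>V\<^esub> lc (I - {i}) e w"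
  define J where "J = I - {i}"
  have wc[simp]: "w j \<in> carrier V" if "j \<in> I" for j
    using that frame_carrier by auto
  have [simp]: "finite J" "finite I" and JI: "J \<subseteq> I" "i \<notin> J"
    using frame_finite i by (auto simp: J_def)
  have wJ: "w \<in> J \<rightarrow> carrier V"
    using JI by auto
  have eK: "e j \<in> carrier K" if "j \<in> I" "j \<noteq> i" for j
    using e(1) that by auto
  have ec: "lc J e w \<in> carrier V"
    using e(1) wJ by (intro lc_closed) (auto simp: J_def)
  have xc: "x \<in> carrier V"
    using ec a i by (simp add: x_def J_def)
  \<comment> \<open>\<open>E\<close> lists the coordinates of the new vector \<open>x\<close> in the
    old frame, whose orthogonality therefore bounds \<open>a w i\<close> and every
    \<open>e j w j\<close> by the level of \<open>x\<close>.\<close>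
  define E where "E = (\<lambda>j. if j = i then a else e j)"
  have E: "E \<in> I \<rightarrow> carrier K"
    using e(1) a by (auto simp: E_def)
  have xE: "x = lc I E w"
  proof -
    have "lc I E w = E i \<odot>\<^bsub>V\<^esub> w i \<oplus>\<^bsub>V\<^esub> lc (I - {i}) E w"
      using E i by (intro lc_remove) auto
    moreover have "lc (I - {i}) E w = lc (I - {i}) e w"
      using e(1) by (intro lc_cong) (auto simp: E_def)
    ultimately show ?thesis
      by (simp add: x_def E_def)
  qed
  have lx: "l x = l (a \<odot>\<^bsub>V\<^esub> w i)"
  proof (rule antisym)
    show "l x \<le> l (a \<odot>\<^bsub>V\<^esub> w i)"
      using l_add[of "a \<odot>\<^bsub>V\<^esub> w i" "lc J e w"] ec a i e(2) by (simp add: x_def J_def)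
    show "l (a \<odot>\<^bsub>V\<^esub> w i) \<le> l x"
      using frame_le[OF E i] by (simp add: xE E_def)
  qed
  have x0: "x \<noteq> \<zero>\<^bsub>V\<^esub>"
    using frame_independent[OF E _ i] a(2) by (auto simp: xE E_def)
  define w' where "w' = w(i := x)"
  have w'c: "w' \<in> I \<rightarrow> carrier V"
    using xc by (auto simp: w'_def)
  \<comment> \<open>Coordinates change by a triangular rule: a coefficient \<open>c i\<close> of
    \<open>x\<close> contributes \<open>c i a\<close> at \<open>i\<close> and is felt as
    \<open>c i e j\<close> at every other \<open>j\<close>.\<close>
  have lc': "lc I c w' = lc I (\<lambda>j. if j = i then c i \<otimes>\<^bsub>K\<^esub> a else c j \<oplus>\<^bsub>K\<^esub> c i \<otimes>\<^bsub>K\<^esub> e j) w" 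
    if c: "c \<in> I \<rightarrow> carrier K" for c
  proof -
    have ci: "c i \<in> carrier K"
      using c i by auto
    have "lc I c w' = c i \<odot>\<^bsub>V\<^esub> x \<oplus>\<^bsub>V\<^esub> lc (I - {i}) c w'"
      using lc_remove[OF _ i c w'c] by (simp add: w'_def)
    also have "lc (I - {i}) c w' = lc J c w"
      using c by (intro lc_cong) (auto simp: w'_def J_def)
    also have "c i \<odot>\<^bsub>V\<^esub> x = (c i \<otimes>\<^bsub>K\<^esub> a) \<odot>\<^bsub>V\<^esub> w i \<oplus>\<^bsub>V\<^esub> lc J (\<lambda>j. c i \<otimes>\<^bsub>K\<^esub> e j) w"
      using ci a i ec e(1) wJ 
      by (subst lc_smult) (auto simp: x_def J_def[symmetric] smult_r_distr smult_assoc1)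
    also have "\<dots> \<oplus>\<^bsub>V\<^esub> lc J c w = (c i \<otimes>\<^bsub>K\<^esub> a) \<odot>\<^bsub>V\<^esub> w i \<oplus>\<^bsub>V\<^esub> (lc J c w \<oplus>\<^bsub>V\<^esub> lc J (\<lambda>j. c i \<otimes>\<^bsub>K\<^esub> e j) w)"
    proof -
      have "lc J c w \<in> carrier V" "lc J (\<lambda>j. c i \<otimes>\<^bsub>K\<^esub> e j) w \<in> carrier V"
        using c ci e(1) wJ JI by (auto intro!: lc_closed simp: J_def[symmetric])
      moreover have "(c i \<otimes>\<^bsub>K\<^esub> a) \<odot>\<^bsub>V\<^esub> w i \<in> carrier V"
        using a ci i by simp
      ultimately show ?thesis
        by (simp add: M.a_ac)
    qed
    also have "lc J c w \<oplus>\<^bsub>V\<^esub> lc J (\<lambda>j. c i \<otimes>\<^bsub>K\<^esub> e j) w = lc J (\<lambda>j. c j \<oplus>\<^bsub>K\<^esub> c i \<otimes>\<^bsub>K\<^esub> e j) w"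
      using c ci e(1) wJ JI by (intro lc_add[symmetric]) (auto simp: J_def[symmetric])
    also have "(c i \<otimes>\<^bsub>K\<^esub> a) \<odot>\<^bsub>V\<^esub> w i \<oplus>\<^bsub>V\<^esub> lc J (\<lambda>j. c j \<oplus>\<^bsub>K\<^esub> c i \<otimes>\<^bsub>K\<^esub> e j) w = 
        lc I (\<lambda>j. if j = i then c i \<otimes>\<^bsub>K\<^esub> a else c j \<oplus>\<^bsub>K\<^esub> c i \<otimes>\<^bsub>K\<^esub> e j) w" (is "_ = lc I ?c w")
    proof -
      have "lc I ?c w = ?c i \<odot>\<^bsub>V\<^esub> w i \<oplus>\<^bsub>V\<^esub> lc (I - {i}) ?c w"
        using i c ci a eK by (intro lc_remove) (auto simp: Pi_iff)
      moreover have "lc (I - {i}) ?c w = lc J (\<lambda>j. c j \<oplus>\<^bsub>K\<^esub> c i \<otimes>\<^bsub>K\<^esub> e j) w"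
        using c ci e(1) wJ JI by (intro lc_cong) (auto simp: J_def)
      ultimately show ?thesis by simp
    qed
    finally show ?thesis .
  qed
  have "orth_frame \<Gamma> V l I w'"
  proof (rule orth_frameI)
    show "w' j \<in> carrier V" "w' j \<noteq> \<zero>\<^bsub>V\<^esub>" if "j \<in> I" for j
      using that xc x0 frame_nonzero[OF that] by (auto simp: w'_def)
    show "l (c j \<odot>\<^bsub>V\<^esub> w' j) \<le> l (lc I c w')" if c: "c \<in> I \<rightarrow> carrier K" and j: "j \<in> I" for c j
    proof -
      let ?c = "\<lambda>j. if j = i then c i \<otimes>\<^bsub>K\<^esub> a else c j \<oplus>\<^bsub>K\<^esub> c i \<otimes>\<^bsub>K\<^esub> e j"
      have ci: "c i \<in> carrier K"
        using c i by auto
      have c': "?c \<in> I \<rightarrow> carrier K"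
        using c ci a eK by (auto simp: Pi_iff)
      have "l (c i \<odot>\<^bsub>V\<^esub> x) = l ((c i \<otimes>\<^bsub>K\<^esub> a) \<odot>\<^bsub>V\<^esub> w i)"
        using ci a i xc lx by (simp add: smult_assoc1 l_smult)
      also have "\<dots> \<le> l (lc I ?c w)"
        using frame_le[OF c' i] by simp
      finally have le: "l (c i \<odot>\<^bsub>V\<^esub> x) \<le> l (lc I ?c w)" .
      show ?thesis
      proof (cases "j = i")
        case True
        then show ?thesis
          using le unfolding lc'[OF c] by (simp add: w'_def)
      next
        case False
        then have jJ: "j \<in> J" and cj: "c j \<in> carrier K" and ej: "e j \<in> carrier K"
          using j e(1) c by (auto simp: J_def)
        \<comment> \<open>The term is recovered as the term of the old frame minus the correction
          caused by \<open>x\<close>; each of the two is bounded by the level of the whole.\<close>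
        have "c j \<odot>\<^bsub>V\<^esub> w j = ?c j \<odot>\<^bsub>V\<^esub> w j \<ominus>\<^bsub>V\<^esub> (c i \<otimes>\<^bsub>K\<^esub> e j) \<odot>\<^bsub>V\<^esub> w j"
        proof -
          have "c j \<odot>\<^bsub>V\<^esub> w j \<in> carrier V" "(c i \<otimes>\<^bsub>K\<^esub> e j) \<odot>\<^bsub>V\<^esub> w j \<in> carrier V"
            using cj ci ej j by auto
          then show ?thesis
            using False cj ci ej j by (simp add: smult_l_distr a_minus_def M.add.m_assoc M.r_neg)
        qed
        then have "l (c j \<odot>\<^bsub>V\<^esub> w j) \<le> max (l (?c j \<odot>\<^bsub>V\<^esub> w j)) (l ((c i \<otimes>\<^bsub>K\<^esub> e j) \<odot>\<^bsub>V\<^esub> w j))"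
          using l_minus[of "?c j \<odot>\<^bsub>V\<^esub> w j" "(c i \<otimes>\<^bsub>K\<^esub> e j) \<odot>\<^bsub>V\<^esub> w j"] c' j ci ej cj False by auto
        moreover have "l (?c j \<odot>\<^bsub>V\<^esub> w j) \<le> l (lc I ?c w)"
          using frame_le[OF c' j] .
        moreover have "l ((c i \<otimes>\<^bsub>K\<^esub> e j) \<odot>\<^bsub>V\<^esub> w j) \<le> l (lc I ?c w)"
        proof -
          have "l (e j \<odot>\<^bsub>V\<^esub> w j) \<le> l x"
            using frame_le[OF E j] False by (simp add: xE E_def)
          then have "l (c i \<odot>\<^bsub>V\<^esub> (e j \<odot>\<^bsub>V\<^esub> w j)) \<le> l (c i \<odot>\<^bsub>V\<^esub> x)"
            using ci ej j xc by (intro l_smult_mono) auto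
          with le show ?thesis
            using ci ej j by (simp add: smult_assoc1)
        qed
        ultimately have "l (c j \<odot>\<^bsub>V\<^esub> w j) \<le> l (lc I ?c w)"
          by (meson max.boundedI order_trans)
        then show ?thesis
          using False unfolding lc'[OF c] by (simp add: w'_def)
      qed
    qed
    show "\<exists>c\<in>I \<rightarrow> carrier K. v = lc I c w'" if v: "v \<in> carrier V" for v
    proof -
      obtain d where d: "d \<in> I \<rightarrow> carrier K" "v = lc I d w"
        using frame_span[OF v] .
      \<comment> \<open>The triangular rule is solved backwards: the coefficient at \<open>i\<close>
        is divided by \<open>a\<close>, the others are corrected by \<open>b e j\<close>.\<close>
      define b where "b = d i \<otimes>\<^bsub>K\<^esub> inv\<^bsub>K\<^esub> a"
      have di: "d i \<in> carrier K" and ia: "inv\<^bsub>K\<^esub> a \<in> carrier K" and aU: "a \<in> Units K"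
        using d i a by (auto simp: field_Units)
      have b: "b \<in> carrier K" "b \<otimes>\<^bsub>K\<^esub> a = d i"
        using di ia aU a by (auto simp: b_def R.m_assoc)
      define c where "c = (\<lambda>j. if j = i then b else d j \<ominus>\<^bsub>K\<^esub> b \<otimes>\<^bsub>K\<^esub> e j)"
      have c: "c \<in> I \<rightarrow> carrier K"
        using b d eK by (auto simp: c_def a_minus_def Pi_iff)
      have "lc I c w' = lc I d w"
        unfolding lc'[OF c]
      proof (rule lc_cong)
        fix j assume j: "j \<in> I"
        show "(if j = i then c i \<otimes>\<^bsub>K\<^esub> a else c j \<oplus>\<^bsub>K\<^esub> c i \<otimes>\<^bsub>K\<^esub> e j) = d j"
        proof (cases "j = i")
          case False
          then have "e j \<in> carrier K" "d j \<in> carrier K" 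
            using e(1) d j by auto
          then show ?thesis
            using False b by (simp add: c_def a_minus_def R.add.m_assoc R.l_neg)
        qed (use b in \<open>simp add: c_def\<close>)
      qed (use d in auto)
      then show ?thesis
        using c d(2) by (intro bexI[of _ c]) simp_all
    qed
  qed simp
  then show ?thesis
    by (simp add: w'_def x_def)
qed

end

end

section \<open>Restriction to subspaces, lists of basis vectors, and shears\<close>

context nonarch_normed_space
begin

text \<open>\<open>finsum\<close> takes the whole record as an argument, so a sum formed in a
  subspace is formally another object than the same sum in \<open>V\<close>. They agree because the
  two records share their operations.\<close>

lemma finsum_submodule:
  assumes "submodule K N V" "f \<in> I \<rightarrow> N"
  shows "finsum (V\<lparr>carrier := N\<rparr>) f I = finsum V f I"
proof -
  interpret N: module K "V\<lparr>carrier := N\<rparr>"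
    by (rule submodule_is_module) (rule assms)
  have "N \<subseteq> carrier V"
    using assms(1) by (simp add: submodule_def)
  with assms(2) show ?thesis
  proof (induction I rule: infinite_finite_induct)
    case (insert x F)
    then have "finsum (V\<lparr>carrier := N\<rparr>) f (insert x F) = f x \<oplus>\<^bsub>V\<^esub> finsum (V\<lparr>carrier := N\<rparr>) f F"
      by (subst N.M.finsum_insert) auto
    moreover have "finsum V f (insert x F) = f x \<oplus>\<^bsub>V\<^esub> finsum V f F"
      using insert by (subst M.finsum_insert) auto
    ultimately show ?case
      using insert by simp
  qed simp_all
qed

lemma nonarch_submodule:
  assumes "submodule K N V"
  shows "nonarch_normed_space \<Gamma> (V\<lparr>carrier := N\<rparr>) l"
proof -
  have sub: "x \<in> carrier V" if "x \<in> N" for x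
    using assms that by (auto simp: submodule_def)
  have "vectorspace K (V\<lparr>carrier := N\<rparr>)"
    using subspace_is_vs[of N] assms vectorspace_axioms by (simp add: subspace_def)
  then show ?thesis
    by (intro nonarch_normed_space.intro nonarch_normed_space_axioms.intro)
       (use l_not_PInf l_eq_MInf l_smult l_add sub in auto)
qed

text \<open>Coefficients on \<open>J\<close> are padded by zero to coefficients on \<open>I\<close>,
  so the inequality in \<open>V\<close> passes to the subfamily. Meant for kernels and
  images.\<close>

lemma frame_subset:
  assumes "orth_frame \<Gamma> V l I w" "J \<subseteq> I" "submodule K N V"
    and N: "N = {lc J c w |c. c \<in> J \<rightarrow> carrier K}"
  shows "orth_frame \<Gamma> (V\<lparr>carrier := N\<rparr>) l J w"
proof -
  interpret N: nonarch_normed_space \<Gamma> "V\<lparr>carrier := N\<rparr>" l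
    by (rule nonarch_submodule) (rule assms)
  note wI = frame_carrier[OF assms(1)]
  have finJ: "finite J"
    using frame_finite[OF assms(1)] assms(2) by (rule finite_subset[rotated])
  have wN: "w j \<in> N" if "j \<in> J" for j
  proof -
    let ?c = "\<lambda>i. if i = j then \<one>\<^bsub>K\<^esub> else \<zero>\<^bsub>K\<^esub>"
    have "?c \<in> J \<rightarrow> carrier K" 
      by simp
    moreover have "lc J ?c w = w j"
      using that finJ wI assms(2) by (intro lc_single) auto
    ultimately have "w j = lc J ?c w \<and> ?c \<in> J \<rightarrow> carrier K"
      by (rule_tac conjI) (rule sym)
    then show ?thesis
      by (subst N, intro CollectI exI[of _ ?c])
  qed
  have lc: "N.lc J c w = lc J c w" if "c \<in> J \<rightarrow> carrier K" for c
    using finsum_submodule[OF assms(3), of "\<lambda>j. c j \<odot>\<^bsub>V\<^esub> w j" J] that wN N.smult_closed by auto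
  show ?thesis
  proof (rule N.orth_frameI)
    show "finite J" by fact
    show "w j \<in> carrier (V\<lparr>carrier := N\<rparr>)" "w j \<noteq> \<zero>\<^bsub>V\<lparr>carrier := N\<rparr>\<^esub>" if "j \<in> J" for j
      using that wN frame_nonzero[OF assms(1)] assms(2) by auto
    show "\<exists>c\<in>J \<rightarrow> carrier K. v = N.lc J c w" if "v \<in> carrier (V\<lparr>carrier := N\<rparr>)" for v
      using that N lc by force
    show "l (c j \<odot>\<^bsub>V\<lparr>carrier := N\<rparr>\<^esub> w j) \<le> l (N.lc J c w)" if c: "c \<in> J \<rightarrow> carrier K" and j: "j \<in> J" for c j
    proof -
      let ?c = "\<lambda>i. if i \<in> J then c i else \<zero>\<^bsub>K\<^esub>"
      have "?c \<in> I \<rightarrow> carrier K"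
        using c by auto
      from frame_le[OF assms(1) this, of j] j assms(2) 
      have "l (c j \<odot>\<^bsub>V\<^esub> w j) \<le> l (lc I ?c w)"
        by auto
      also have "lc I ?c w = lc J c w"
        using c wI assms(2) frame_finite[OF assms(1)] by (intro lc_supset) auto
      finally show ?thesis
        using lc[OF c] by simp
    qed
  qed
qed

text \<open>Bridge between frames and the list-based notions of the theorem. Independence and the
  maximum formula follow from the inequality in \<open>orth_frame\<close>; conversely, a supremum
  bounds each of its members, and independent vectors are nonzero.\<close>

lemma orthogonal_basis_iff_orth_frame:
  "orthogonal_basis \<Gamma> V l ws \<longleftrightarrow> orth_frame \<Gamma> V l {..<length ws} ((!) ws)"
proof
  assume fr: "orth_frame \<Gamma> V l {..<length ws} ((!) ws)"
  note c = frame_carrier[OF fr]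
  have inj: "inj_on ((!) ws) {..<length ws}"
    by (rule frame_inj_on[OF fr])
  have set: "(!) ws ` {..<length ws} = set ws"
    by (auto simp: set_conv_nth)
  have lincomb: "lincomb a (set ws) = lc {..<length ws} (\<lambda>i. a (ws ! i)) ((!) ws)"
    if "a \<in> set ws \<rightarrow> carrier K" for a
    unfolding lincomb_def set[symmetric]
    using that c by (intro M.finsum_reindex inj) (auto simp: set_conv_nth)
  have sub: "set ws \<subseteq> carrier V"
    using c unfolding set[symmetric] by auto
  have "distinct ws"
    using inj by (auto simp: distinct_conv_nth inj_on_def)
  moreover have "lin_indpt (set ws)"
  proof (rule finite_lin_indpt2)
    fix a assume a: "a \<in> set ws \<rightarrow> carrier K" "lincomb a (set ws) = \<zero>\<^bsub>V\<^esub>"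
    then have "(\<lambda>i. a (ws ! i)) \<in> {..<length ws} \<rightarrow> carrier K"
      by auto
    then have "a (ws ! i) = \<zero>\<^bsub>K\<^esub>" if "i < length ws" for i
      using frame_independent[OF fr, of "\<lambda>i. a (ws ! i)" i] that lincomb[OF a(1)] a(2) by simp
    then show "\<forall>v\<in>set ws. a v = \<zero>\<^bsub>K\<^esub>"
      by (auto simp: set_conv_nth)
  qed (use sub in auto)
  moreover have "span (set ws) = carrier V"
  proof
    show "span (set ws) \<subseteq> carrier V"
      by (rule span_is_subset2[OF sub])
    show "carrier V \<subseteq> span (set ws)"
    proof
      fix v assume "v \<in> carrier V"
      then obtain d where d: "d \<in> {..<length ws} \<rightarrow> carrier K" "v = lc {..<length ws} d ((!) ws)"
        using frame_span[OF fr] by blast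
      let ?a = "\<lambda>v. d (the_inv_into {..<length ws} ((!) ws) v)"
      have eq: "?a (ws ! i) = d i" if "i < length ws" for i
        using that by (subst the_inv_into_f_f[OF inj]) auto
      have a: "?a \<in> set ws \<rightarrow> carrier K"
        using d eq by (auto simp: set_conv_nth)
      have "lincomb ?a (set ws) = v"
        unfolding lincomb[OF a] d(2) using d c by (intro lc_cong) (auto simp: eq)
      with a show "v \<in> span (set ws)"
        unfolding span_def by blast
    qed
  qed
  moreover have "orthogonal \<Gamma> V l ws"
    using sub frame_level[OF fr] by (auto simp: orthogonal_def Pi_iff)
  ultimately show "orthogonal_basis \<Gamma> V l ws"
    using sub by (simp add: orthogonal_basis_def basis_def)
next
  assume ob: "orthogonal_basis \<Gamma> V l ws"
  then have dist: "distinct ws" and li: "lin_indpt (set ws)" and gen: "span (set ws) = carrier V"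
    and sub: "set ws \<subseteq> carrier V" and orth: "orthogonal \<Gamma> V l ws"
    by (auto simp: orthogonal_basis_def basis_def)
  have inj: "inj_on ((!) ws) {..<length ws}"
    using dist by (auto simp: distinct_conv_nth inj_on_def)
  have set: "(!) ws ` {..<length ws} = set ws"
    by (auto simp: set_conv_nth)
  have c: "(!) ws \<in> {..<length ws} \<rightarrow> carrier V"
    using sub by auto
  show "orth_frame \<Gamma> V l {..<length ws} ((!) ws)"
  proof (rule orth_frameI)
    show "ws ! i \<noteq> \<zero>\<^bsub>V\<^esub>" if "i \<in> {..<length ws}" for i
      using vs_zero_lin_dep[OF sub li] that by (metis lessThan_iff nth_mem)
    show "l (d i \<odot>\<^bsub>V\<^esub> ws ! i) \<le> l (lc {..<length ws} d ((!) ws))"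
      if "d \<in> {..<length ws} \<rightarrow> carrier K" "i \<in> {..<length ws}" for d i
    proof -
      have eq: "l (lc {..<length ws} d ((!) ws)) = (SUP i\<in>{..<length ws}. l (d i \<odot>\<^bsub>V\<^esub> ws ! i))"
        using orth that by (auto simp: orthogonal_def Pi_iff)
      show ?thesis
        unfolding eq by (rule SUP_upper) (rule that)
    qed
    show "\<exists>d\<in>{..<length ws} \<rightarrow> carrier K. v = lc {..<length ws} d ((!) ws)" if v: "v \<in> carrier V" for v
    proof -
      obtain a where a: "a \<in> set ws \<rightarrow> carrier K" "lincomb a (set ws) = v"
        using finite_in_span[of "set ws" v] sub gen v by auto
      have "lincomb a (set ws) = lc {..<length ws} (\<lambda>i. a (ws ! i)) ((!) ws)"
        unfolding lincomb_def set[symmetric]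
        using a c by (intro M.finsum_reindex inj) (auto simp: set_conv_nth)
      then show ?thesis
        using a by (intro bexI[of _ "\<lambda>i. a (ws ! i)"]) auto
    qed
  qed (use c in auto)
qed

lemma frame_cong:
  assumes "orth_frame \<Gamma> V l I w" "\<And>i. i \<in> I \<Longrightarrow> v i = w i"
  shows "orth_frame \<Gamma> V l I v"
proof (rule orth_frameI)
  have lc: "lc I c v = lc I c w" if "c \<in> I \<rightarrow> carrier K" for c
    using that frame_carrier[OF assms(1)] assms(2) by (intro lc_cong) auto
  show "l (c i \<odot>\<^bsub>V\<^esub> v i) \<le> l (lc I c v)" if "c \<in> I \<rightarrow> carrier K" "i \<in> I" for c i
    using frame_le[OF assms(1) that] that assms(2) by (simp add: lc)
  show "\<exists>c\<in>I \<rightarrow> carrier K. x = lc I c v" if x: "x \<in> carrier V" for x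
  proof -
    obtain c where "c \<in> I \<rightarrow> carrier K" "x = lc I c w"
      using frame_span[OF assms(1) x] .
    with lc[of c] show ?thesis
      by (intro bexI[of _ c]) simp_all
  qed
qed (use assms frame_finite[OF assms(1)] frame_carrier[OF assms(1)] frame_nonzero[OF assms(1)] in auto)

lemma orthogonal_basis_map:
  assumes "orth_frame \<Gamma> V l I w" "distinct is" "set is = I"
  shows "orthogonal_basis \<Gamma> V l (map w is)"
proof -
  have "bij_betw ((!) is) {..<length is} I"
    using bij_betw_nth[OF assms(2) refl] assms(3) by simp
  from frame_reindex[OF assms(1) this] 
  have "orth_frame \<Gamma> V l {..<length is} (\<lambda>i. w (is ! i))" .
  then have "orth_frame \<Gamma> V l {..<length is} ((!) (map w is))"
    by (rule frame_cong) simp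
  then show ?thesis
    by (simp add: orthogonal_basis_iff_orth_frame)
qed

text \<open>A column operation. One vector is changed at a time, each change being
  \<open>frame_replace\<close> at \<open>j\<close> with leading coefficient 1. Since
  \<open>i \<notin> S\<close>, the vector \<open>w i\<close> stays fixed and the same vector is
  subtracted throughout.\<close>

lemma frame_shear:
  assumes fr: "orth_frame \<Gamma> V l I w" and i: "i \<in> I" and S: "S \<subseteq> I - {i}"
    and b: "b \<in> S \<rightarrow> carrier K" "\<And>j. j \<in> S \<Longrightarrow> l (b j \<odot>\<^bsub>V\<^esub> w i) \<le> l (w j)"
  shows "orth_frame \<Gamma> V l I (\<lambda>j. if j \<in> S then w j \<ominus>\<^bsub>V\<^esub> b j \<odot>\<^bsub>V\<^esub> w i else w j)"
proof -
  have "finite S"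
    using S frame_finite[OF fr] finite_subset by blast
  then show ?thesis
    using S b
  proof (induction S rule: finite_induct)
    case empty
    then show ?case using fr by simp
  next
    case (insert j S)
    let ?w = "\<lambda>k. if k \<in> S then w k \<ominus>\<^bsub>V\<^esub> b k \<odot>\<^bsub>V\<^esub> w i else w k"
    \<comment> \<open>The rest of the new vector is the single term \<open>- b j w i\<close>, whose
      level is at most that of \<open>w j\<close> by assumption.\<close>
    let ?e = "\<lambda>k. if k = i then \<ominus>\<^bsub>K\<^esub> b j else \<zero>\<^bsub>K\<^esub>"
    have fr': "orth_frame \<Gamma> V l I ?w"
      using insert by auto
    have j: "j \<in> I" "j \<noteq> i" "b j \<in> carrier K" "i \<notin> S" "?w j = w j"
      using insert by auto
    have w[simp]: "w i \<in> carrier V" "w j \<in> carrier V"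
      using frame_carrier[OF fr] i j by auto
    have wc: "?w \<in> I - {j} \<rightarrow> carrier V"
      using frame_carrier[OF fr'] by auto
    have e: "lc (I - {j}) ?e ?w = \<ominus>\<^bsub>V\<^esub> (b j \<odot>\<^bsub>V\<^esub> w i)"
    proof -
      have "lc (I - {j}) (\<lambda>k. if k \<in> {i} then \<ominus>\<^bsub>K\<^esub> b j else \<zero>\<^bsub>K\<^esub>) ?w = lc {i} (\<lambda>k. \<ominus>\<^bsub>K\<^esub> b j) ?w"
        using i j wc frame_finite[OF fr] by (intro lc_supset) auto
      also have "\<dots> = \<ominus>\<^bsub>V\<^esub> (b j \<odot>\<^bsub>V\<^esub> w i)"
        using j by (simp add: smult_l_minus)
      finally show ?thesis by simp
    qed
    have "orth_frame \<Gamma> V l I (?w(j := \<one>\<^bsub>K\<^esub> \<odot>\<^bsub>V\<^esub> ?w j \<oplus>\<^bsub>V\<^esub> lc (I - {j}) ?e ?w))"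
    proof (rule frame_replace[OF fr'])
      show "l (lc (I - {j}) ?e ?w) \<le> l (\<one>\<^bsub>K\<^esub> \<odot>\<^bsub>V\<^esub> ?w j)"
        unfolding e using insert.prems(3)[of j] j by (simp add: l_uminus)
    qed (use j in auto)
    also have "?w(j := \<one>\<^bsub>K\<^esub> \<odot>\<^bsub>V\<^esub> ?w j \<oplus>\<^bsub>V\<^esub> lc (I - {j}) ?e ?w) = 
        (\<lambda>k. if k \<in> insert j S then w k \<ominus>\<^bsub>V\<^esub> b k \<odot>\<^bsub>V\<^esub> w i else w k)"
      unfolding e using insert.hyps by (auto simp: a_minus_def)
    finally show ?case .
  qed
qed

end

section \<open>Singular value decompositions exist\<close>

text \<open>Turns a comparison of two entries in the pivot row into a comparison of levels in the
  domain. In use, \<open>x\<close> is the level of the pivot term, \<open>y\<close> and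
  \<open>z\<close> are the levels of the pivot column vector and of another column vector, and
  \<open>n\<close> is the valuation of the multiplier.\<close>

lemma ereal_diff_exchange:
  fixes x y z n :: ereal
  assumes "\<bar>x\<bar> \<noteq> \<infinity>" "\<bar>y\<bar> \<noteq> \<infinity>" "\<bar>z\<bar> \<noteq> \<infinity>" "n \<noteq> -\<infinity>" "x - n - z \<le> x - y"
  shows "y - n \<le> z"
  using assms by (cases x; cases y; cases z; cases n) auto

locale nonarch_linear_map =
  V: nonarch_normed_space \<Gamma> V lV + W: nonarch_normed_space \<Gamma> W lW +
  linear_map "novikov_field \<Gamma>" V W A
  for \<Gamma> and V :: "(real \<Rightarrow> 'k::field, 'v) module" and lV
    and W :: "(real \<Rightarrow> 'k, 'w) module" and lW and A
begin

lemma map_finsum: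
  assumes "f \<in> I \<rightarrow> carrier V"
  shows "A (finsum V f I) = finsum W (\<lambda>i. A (f i)) I"
  using assms
proof (induction I rule: infinite_finite_induct)
  case (insert x F)
  then have "finsum V f (insert x F) = f x \<oplus>\<^bsub>V\<^esub> finsum V f F"
    by (subst V.M.finsum_insert) auto
  moreover have "finsum W (\<lambda>i. A (f i)) (insert x F) = A (f x) \<oplus>\<^bsub>W\<^esub> finsum W (\<lambda>i. A (f i)) F"
    using insert by (subst W.M.finsum_insert) auto
  ultimately show ?case
    using insert by simp
qed simp_all

lemma map_lc:
  assumes "c \<in> I \<rightarrow> carrier V.K" "w \<in> I \<rightarrow> carrier V"
  shows "A (V.lc I c w) = W.lc I c (\<lambda>i. A (w i))"
proof -
  have "A (V.lc I c w) = (\<Oplus>\<^bsub>W\<^esub>i\<in>I. A (c i \<odot>\<^bsub>V\<^esub> w i))"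
    using assms by (intro map_finsum) auto
  also have "\<dots> = W.lc I c (\<lambda>i. A (w i))"
    using assms by (intro W.M.finsum_cong') (auto simp: Pi_iff)
  finally show ?thesis .
qed

text \<open>
  \<open>P\<close> is the set of columns that already contain a pivot, and \<open>\<sigma>\<close> gives the rows of these pivots.
\<close>

lemma elimination:
  assumes "orth_frame \<Gamma> V lV J w" "orth_frame \<Gamma> W lW I u"
    and "P \<subseteq> J" "inj_on \<sigma> P" "\<sigma> ` P \<subseteq> I" "\<forall>j\<in>P. A (w j) = u (\<sigma> j)"
    and "\<forall>j\<in>J - P. \<exists>c\<in>I \<rightarrow> carrier V.K. (\<forall>i\<in>\<sigma> ` P. c i = \<zero>\<^bsub>V.K\<^esub>) \<and> A (w j) = W.lc I c u"
  shows "\<exists>w u P \<sigma>. orth_frame \<Gamma> V lV J w \<and> orth_frame \<Gamma> W lW I u \<and>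
    P \<subseteq> J \<and> inj_on \<sigma> P \<and> \<sigma> ` P \<subseteq> I \<and> (\<forall>j\<in>P. A (w j) = u (\<sigma> j)) \<and> (\<forall>j\<in>J - P. A (w j) = \<zero>\<^bsub>W\<^esub>)"
  using assms
proof (induction "card (J - P)" arbitrary: w u P \<sigma> rule: less_induct)
  case less
  note frV = less.prems(1) and frW = less.prems(2)
  have finJ: "finite J" and finI: "finite I"
    using V.frame_finite[OF frV] W.frame_finite[OF frW] by auto
  have w[simp]: "w j \<in> carrier V" if "j \<in> J" for j
    using V.frame_carrier[OF frV] that by auto
  have u[simp]: "u i \<in> carrier W" if "i \<in> I" for i
    using W.frame_carrier[OF frW] that by auto
  have lw: "\<bar>lV (w j)\<bar> \<noteq> \<infinity>" if "j \<in> J" for j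
    using V.l_finite[of "w j"] V.frame_nonzero[OF frV that] that by simp
  have "\<exists>M. \<forall>j\<in>J - P. M j \<in> I \<rightarrow> carrier V.K \<and> (\<forall>i\<in>\<sigma> ` P. M j i = \<zero>\<^bsub>V.K\<^esub>) \<and> A (w j) = W.lc I (M j) u"
    using less.prems(7) by (intro bchoice) blast
  then obtain M where M: "\<And>j. j \<in> J - P \<Longrightarrow> M j \<in> I \<rightarrow> carrier V.K"
    and M0: "\<And>j i. j \<in> J - P \<Longrightarrow> i \<in> \<sigma> ` P \<Longrightarrow> M j i = \<zero>\<^bsub>V.K\<^esub>"
    and AM: "\<And>j. j \<in> J - P \<Longrightarrow> A (w j) = W.lc I (M j) u"
    by blast
  have MK[simp]: "M j i \<in> carrier V.K" if "j \<in> J - P" "i \<in> I" for i j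
    using M[OF that(1)] that(2) by auto
  \<comment> \<open>Nonzero entries left in the columns without a pivot. They also avoid the rows of
    earlier pivots, where the invariant makes these columns vanish.\<close>
  define S where "S = {(i, j). i \<in> I \<and> j \<in> J - P \<and> M j i \<noteq> \<zero>\<^bsub>V.K\<^esub>}"
  have "finite S"
    by (rule finite_subset[of _ "I \<times> J"]) (auto simp: S_def finI finJ)
  show ?case
  proof (cases "S = {}")
    case True
    have "A (w j) = \<zero>\<^bsub>W\<^esub>" if "j \<in> J - P" for j
    proof -
      have "M j i = \<zero>\<^bsub>V.K\<^esub>" if "i \<in> I" for i
        using True that \<open>j \<in> J - P\<close> by (auto simp: S_def)
      then show ?thesis
        using W.lc_zero[of I "M j" u] that u by (simp add: AM Pi_iff)
    qed
    then show ?thesis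
      using less.prems by blast
  next
    case False
    \<comment> \<open>The amount by which the entry raises the level of \<open>w j\<close>.
      Comparing these differences instead of the bare levels makes one choice serve both the row and
      the column of the pivot.\<close>
    define q where "q = (\<lambda>(i, j). lW (M j i \<odot>\<^bsub>W\<^esub> u i) - lV (w j))"
    have "Max (q ` S) \<in> q ` S"
      using False \<open>finite S\<close> by (intro Max_in) auto
    then obtain i0 j0 where p: "(i0, j0) \<in> S" and "q (i0, j0) = Max (q ` S)"
      by force
    then have qmax: "q (i, j) \<le> q (i0, j0)" if "(i, j) \<in> S" for i j
      using that \<open>finite S\<close> by simp
    have i0: "i0 \<in> I" and j0: "j0 \<in> J - P" "j0 \<in> J" and a0: "M j0 i0 \<noteq> \<zero>\<^bsub>V.K\<^esub>"
      using p by (auto simp: S_def)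
    have i0P: "i0 \<notin> \<sigma> ` P"
      using M0[OF j0(1)] a0 by auto
    define a where "a = M j0 i0"
    have a: "a \<in> carrier V.K" "a \<noteq> \<zero>\<^bsub>V.K\<^esub>" "inv\<^bsub>V.K\<^esub> a \<in> carrier V.K" "a \<in> Units V.K"
      using a0 i0 j0 V.field_Units by (auto simp: a_def)
    define X where "X = lW (a \<odot>\<^bsub>W\<^esub> u i0)"
    have X: "\<bar>X\<bar> \<noteq> \<infinity>"
    proof -
      have "a \<odot>\<^bsub>W\<^esub> u i0 \<noteq> \<zero>\<^bsub>W\<^esub>"
        using W.smult_eq_zeroD[OF a(1) u[OF i0] W.frame_nonzero[OF frW i0]] a(2) by auto
      then show ?thesis
        using W.l_finite[of "a \<odot>\<^bsub>W\<^esub> u i0"] a i0 by (simp add: X_def)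
    qed
    \<comment> \<open>Now the pivot column maps exactly to a basis vector. The vectors
      \<open>u (\<sigma> j)\<close> of earlier pivots are untouched, because \<open>i0\<close> is
      not one of their rows.\<close>
    define u' where "u' = u(i0 := A (w j0))"
    have frW': "orth_frame \<Gamma> W lW I u'"
    proof -
      have "A (w j0) = a \<odot>\<^bsub>W\<^esub> u i0 \<oplus>\<^bsub>W\<^esub> W.lc (I - {i0}) (M j0) u"
        using M[OF j0(1)] finI i0 by (simp add: AM[OF j0(1)] a_def W.lc_remove Pi_iff)
      moreover have "orth_frame \<Gamma> W lW I (u(i0 := a \<odot>\<^bsub>W\<^esub> u i0 \<oplus>\<^bsub>W\<^esub> W.lc (I - {i0}) (M j0) u))"
      proof (rule W.frame_replace[OF frW i0 a(1,2)])
        show "M j0 \<in> I - {i0} \<rightarrow> carrier W.K"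
          using M[OF j0(1)] by auto
        show "lW (W.lc (I - {i0}) (M j0) u) \<le> lW (a \<odot>\<^bsub>W\<^esub> u i0)"
        proof (rule W.l_sum_le)
          show "(\<lambda>i. M j0 i \<odot>\<^bsub>W\<^esub> u i) \<in> I - {i0} \<rightarrow> carrier W"
            using M[OF j0(1)] by auto
          fix i assume i: "i \<in> I - {i0}"
          show "lW (M j0 i \<odot>\<^bsub>W\<^esub> u i) \<le> lW (a \<odot>\<^bsub>W\<^esub> u i0)"
          proof (cases "M j0 i = \<zero>\<^bsub>V.K\<^esub>")
            case True
            then show ?thesis
              using i by (simp add: W.l_zero)
          next
            case False
            \<comment> \<open>Within column \<open>j0\<close> the subtracted level
              \<open>lV (w j0)\<close> is common and finite, so maximality of \<open>q\<close>
              compares the terms themselves.\<close>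
            then have "q (i, j0) \<le> q (i0, j0)"
              using i j0 by (intro qmax) (auto simp: S_def)
            then show ?thesis
              using lw[OF j0(2)] by (cases "lV (w j0)"; cases "lW (M j0 i \<odot>\<^bsub>W\<^esub> u i)"; 
                cases "lW (a \<odot>\<^bsub>W\<^esub> u i0)") (auto simp: q_def a_def)
          qed
        qed
      qed
      ultimately show ?thesis
        by (simp add: u'_def)
    qed
    \<comment> \<open>The multiplier that clears the entry of column \<open>j\<close> in row
      \<open>i0\<close>.\<close>
    define b where "b = (\<lambda>j. M j i0 \<otimes>\<^bsub>V.K\<^esub> inv\<^bsub>V.K\<^esub> a)"
    have b[simp]: "b j \<in> carrier V.K" if "j \<in> J - P" for j
      using that i0 a by (simp add: b_def)
    have ba: "b j \<otimes>\<^bsub>V.K\<^esub> a = M j i0" if "j \<in> J - P" for j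
      using that i0 a by (simp add: b_def V.R.m_assoc)
    define P' where "P' = insert j0 P"
    define \<sigma>' where "\<sigma>' = \<sigma>(j0 := i0)"
    have Q: "J - P' = J - P - {j0}" "J - P' \<subseteq> J - {j0}"
      by (auto simp: P'_def)
    have \<sigma>': "\<sigma>' ` P' = insert i0 (\<sigma> ` P)"
      using j0 by (auto simp: \<sigma>'_def P'_def)
    define w' where "w' = (\<lambda>j. if j \<in> J - P' then w j \<ominus>\<^bsub>V\<^esub> b j \<odot>\<^bsub>V\<^esub> w j0 else w j)"
    have frV': "orth_frame \<Gamma> V lV J w'"
      unfolding w'_def
    proof (rule V.frame_shear[OF frV j0(2) Q(2)])
      show "b \<in> J - P' \<rightarrow> carrier V.K"
        by (auto simp: Q)
      fix j assume j: "j \<in> J - P'"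
      then have j': "j \<in> J - P" "j \<in> J"
        by (auto simp: Q)
      show "lV (b j \<odot>\<^bsub>V\<^esub> w j0) \<le> lV (w j)"
      proof (cases "M j i0 = \<zero>\<^bsub>V.K\<^esub>")
        case True
        then show ?thesis
          using j0 a by (simp add: b_def V.l_zero)
      next
        case False
        then have "q (i0, j) \<le> q (i0, j0)"
          using i0 j' by (intro qmax) (auto simp: S_def)
        then have *: "lW (M j i0 \<odot>\<^bsub>W\<^esub> u i0) - lV (w j) \<le> X - lV (w j0)"
          by (simp add: q_def X_def a_def)
        \<comment> \<open>Written as \<open>b j\<close> times the pivot term, the entry has level
          \<open>X\<close> minus the valuation of \<open>b j\<close>, which is the form that
          \<open>ereal_diff_exchange\<close> expects.\<close>
        have "lW (M j i0 \<odot>\<^bsub>W\<^esub> u i0) = lW (b j \<odot>\<^bsub>W\<^esub> (a \<odot>\<^bsub>W\<^esub> u i0))"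
          using ba[OF j'(1)] b[OF j'(1)] a i0 by (simp add: W.smult_assoc1[symmetric])
        also have "\<dots> = X - novikov_val (b j)"
          using b[OF j'(1)] a i0 by (simp add: X_def W.l_smult)
        finally have "X - novikov_val (b j) - lV (w j) \<le> X - lV (w j0)"
          using * by simp
        from ereal_diff_exchange[OF X lw[OF j0(2)] lw[OF j'(2)] novikov_val_not_MInf this]
        have "lV (w j0) - novikov_val (b j) \<le> lV (w j)" .
        then show ?thesis
          using b[OF j'(1)] j0 by (simp add: V.l_smult)
      qed
    qed
    show ?thesis
    proof (rule less.hyps[OF _ frV' frW'])
      show "card (J - P') < card (J - P)"
        unfolding Q by (rule psubset_card_mono) (use finJ j0 in auto)
      show "P' \<subseteq> J" "\<sigma>' ` P' \<subseteq> I"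
        using less.prems(3,5) j0 i0 unfolding \<sigma>' by (auto simp: P'_def)
      show "inj_on \<sigma>' P'"
        using less.prems(4) i0P j0(1) by (auto simp: \<sigma>'_def P'_def inj_on_def)
      show "\<forall>j\<in>P'. A (w' j) = u' (\<sigma>' j)"
      proof
        fix j assume j: "j \<in> P'"
        then have "w' j = w j"
          by (simp add: w'_def)
        then show "A (w' j) = u' (\<sigma>' j)"
          using j j0(1) i0P less.prems(6) by (auto simp: u'_def \<sigma>'_def P'_def)
      qed
      show "\<forall>j\<in>J - P'. \<exists>c\<in>I \<rightarrow> carrier V.K. (\<forall>i\<in>\<sigma>' ` P'. c i = \<zero>\<^bsub>V.K\<^esub>) \<and> A (w' j) = W.lc I c u'"
      proof
        fix j assume j: "j \<in> J - P'"
        then have j': "j \<in> J - P" "j \<in> J"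
          by (auto simp: Q)
        \<comment> \<open>Coordinates of the new column in the old frame \<open>u\<close>. Row
          \<open>i0\<close> is cleared by the choice of \<open>b j\<close>; in the rows of earlier
          pivots both columns vanish already.\<close>
        let ?c = "\<lambda>i. M j i \<oplus>\<^bsub>V.K\<^esub> (\<ominus>\<^bsub>V.K\<^esub> b j) \<otimes>\<^bsub>V.K\<^esub> M j0 i"
        have c: "?c \<in> I \<rightarrow> carrier V.K"
          using j' j0 by auto
        have c0: "?c i = \<zero>\<^bsub>V.K\<^esub>" if iP: "i \<in> \<sigma>' ` P'" for i
        proof -
          consider "i = i0" | "i \<in> \<sigma> ` P"
            using iP unfolding \<sigma>' by auto
          then show ?thesis
          proof cases
            case 1
            have "M j i0 \<oplus>\<^bsub>V.K\<^esub> (\<ominus>\<^bsub>V.K\<^esub> b j) \<otimes>\<^bsub>V.K\<^esub> a = M j i0 \<oplus>\<^bsub>V.K\<^esub> (\<ominus>\<^bsub>V.K\<^esub> M j i0)"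
              using ba[OF j'(1)] b[OF j'(1)] a by (simp add: V.R.l_minus)
            also have "\<dots> = \<zero>\<^bsub>V.K\<^esub>"
              using j' i0 by (simp add: V.R.r_neg)
            finally show ?thesis
              using 1 by (simp add: a_def)
          next
            case 2
            then show ?thesis
              using M0[OF j'(1) 2] M0[OF j0(1) 2] b[OF j'(1)] by simp
          qed
        qed
        have "A (w' j) = A (w j) \<oplus>\<^bsub>W\<^esub> (\<ominus>\<^bsub>V.K\<^esub> b j) \<odot>\<^bsub>W\<^esub> A (w j0)"
          using j j'  j0 b[OF j'(1)] by (simp add: w'_def a_minus_def W.smult_l_minus)
        also have "(\<ominus>\<^bsub>V.K\<^esub> b j) \<odot>\<^bsub>W\<^esub> A (w j0) = W.lc I (\<lambda>i. (\<ominus>\<^bsub>V.K\<^esub> b j) \<otimes>\<^bsub>V.K\<^esub> M j0 i) u"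
          using b[OF j'(1)] M[OF j0(1)] finI by (subst W.lc_smult) (auto simp: AM[OF j0(1)])
        also have "A (w j) \<oplus>\<^bsub>W\<^esub> \<dots> = W.lc I ?c u"
          unfolding AM[OF j'(1)] using b[OF j'(1)] M[OF j0(1)] M[OF j'(1)]
          by (intro W.lc_add[symmetric]) auto
        \<comment> \<open>Passing from \<open>u\<close> to \<open>u'\<close> costs nothing: the
          frames differ only at \<open>i0\<close>, where the coefficient is zero.\<close>
        also have "\<dots> = W.lc I ?c u'"
        proof (rule W.M.finsum_cong')
          show "(\<lambda>i. ?c i \<odot>\<^bsub>W\<^esub> u' i) \<in> I \<rightarrow> carrier W"
            using c W.frame_carrier[OF frW'] by (auto simp: Pi_iff)
          show "?c i \<odot>\<^bsub>W\<^esub> u i = ?c i \<odot>\<^bsub>W\<^esub> u' i" if "i \<in> I" for i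
          proof (cases "i = i0")
            case True
            then have z: "?c i = \<zero>\<^bsub>V.K\<^esub>"
              by (intro c0) (simp add: \<sigma>')
            have "u' i \<in> carrier W"
              using that W.frame_carrier[OF frW'] by auto
            then show ?thesis
              unfolding z using u[OF that] by simp
          qed (simp add: u'_def)
        qed simp
        finally show "\<exists>c\<in>I \<rightarrow> carrier V.K. (\<forall>i\<in>\<sigma>' ` P'. c i = \<zero>\<^bsub>V.K\<^esub>) \<and> A (w' j) = W.lc I c u'"
          using c c0 by (intro bexI[of _ ?c]) auto
      qed
    qed
  qed
qed

end

section \<open>Splitting linear combinations along sums of index sets and along lists\<close>

context nonarch_normed_space
begin

lemma lc_Plus:
  assumes "finite I" "finite J" "c \<in> I <+> J \<rightarrow> carrier K" "f \<in> I \<rightarrow> carrier V" "g \<in> J \<rightarrow> carrier V"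
  shows "lc (I <+> J) c (case_sum f g) = lc I (\<lambda>i. c (Inl i)) f \<oplus>\<^bsub>V\<^esub> lc J (\<lambda>j. c (Inr j)) g"
proof -
  have c: "i \<in> I \<Longrightarrow> c (Inl i) \<in> carrier K" "j \<in> J \<Longrightarrow> c (Inr j) \<in> carrier K" for i j
    using assms(3) by auto
  have "lc (Inl ` I \<union> Inr ` J) c (case_sum f g) =
      lc (Inl ` I) c (case_sum f g) \<oplus>\<^bsub>V\<^esub> lc (Inr ` J) c (case_sum f g)"
    using assms c by (intro lc_Un) auto
  moreover have "lc (Inl ` I) c (case_sum f g) = lc I (\<lambda>i. c (Inl i)) f"
    using assms c by (subst M.finsum_reindex) (auto simp: Pi_iff)
  moreover have "lc (Inr ` J) c (case_sum f g) = lc J (\<lambda>i. c (Inr i)) g"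
    using assms c by (subst M.finsum_reindex) (auto simp: Pi_iff)
  ultimately show ?thesis
    by (simp add: Plus_def)
qed

lemma lc_take_drop:
  fixes r n :: nat
  assumes "r \<le> n" "c \<in> {..<n} \<rightarrow> carrier K" "w \<in> {..<n} \<rightarrow> carrier V"
  shows "lc {..<n} c w = lc {..<r} c w \<oplus>\<^bsub>V\<^esub> lc {..<n - r} (\<lambda>i. c (r + i)) (\<lambda>i. w (r + i))"
proof -
  have eq: "{..<n} = {..<r} \<union> (+) r ` {..<n - r}"
  proof -
    have "i \<in> (+) r ` {..<n - r}" if "i < n" "\<not> i < r" for i
      using that by (intro image_eqI[of _ _ "i - r"]) auto
    then show ?thesis
      using assms(1) by auto
  qed
  have "lc ({..<r} \<union> (+) r ` {..<n - r}) c w = lc {..<r} c w \<oplus>\<^bsub>V\<^esub> lc ((+) r ` {..<n - r}) c w"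
    using assms by (intro lc_Un) auto
  moreover have "lc ((+) r ` {..<n - r}) c w = lc {..<n - r} (\<lambda>i. c (r + i)) (\<lambda>i. w (r + i))"
    using assms by (subst M.finsum_reindex) (auto simp: Pi_iff)
  ultimately show ?thesis
    by (simp add: eq[symmetric])
qed

end

section \<open>From the eliminated form to singular value decompositions\<close>

context nonarch_linear_map
begin

text \<open>After elimination the pivot columns map to distinct members of the frame
  \<open>u\<close>, the others to zero. So the image is spanned by those members, and independence
  of \<open>u\<close> leaves only the other columns for the kernel. The second conclusion is
  recorded because spaces of cycles serve as codomains and need an orthogonal basis
  themselves.\<close>

lemma svd_exists:
  assumes "orth_frame \<Gamma> V lV J w0" "orth_frame \<Gamma> W lW I u0"
  shows "\<exists>ys xs. is_svd \<Gamma> V lV W lW A ys xs"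
    and "\<exists>zs. orthogonal_basis \<Gamma> (V\<lparr>carrier := ker\<rparr>) lV zs"
proof -
  have base: "\<exists>c\<in>I \<rightarrow> carrier V.K. A (w0 j) = W.lc I c u0" if "j \<in> J" for j
  proof -
    have "A (w0 j) \<in> carrier W"
      using V.frame_carrier[OF assms(1)] that by auto
    then obtain c where "c \<in> I \<rightarrow> carrier V.K" "A (w0 j) = W.lc I c u0"
      using W.frame_span[OF assms(2)] by blast
    then show ?thesis
      by (intro bexI[of _ c])
  qed
  have "\<exists>w u P \<sigma>. orth_frame \<Gamma> V lV J w \<and> orth_frame \<Gamma> W lW I u \<and>
    P \<subseteq> J \<and> inj_on \<sigma> P \<and> \<sigma> ` P \<subseteq> I \<and> (\<forall>j\<in>P. A (w j) = u (\<sigma> j)) \<and> (\<forall>j\<in>J - P. A (w j) = \<zero>\<^bsub>W\<^esub>)"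
    \<comment> \<open>The start has no pivots: with \<open>P\<close> empty, any
      \<open>\<sigma>\<close> is allowed and the condition on pivot rows is vacuous.\<close>
    by (rule elimination[OF assms, of "{}" undefined]) (simp_all add: base)
  then obtain w u P \<sigma> where frV: "orth_frame \<Gamma> V lV J w" and frW: "orth_frame \<Gamma> W lW I u"
    and PJ: "P \<subseteq> J" and inj: "inj_on \<sigma> P" and PI: "\<sigma> ` P \<subseteq> I"
    and AP: "\<And>j. j \<in> P \<Longrightarrow> A (w j) = u (\<sigma> j)" and A0: "\<And>j. j \<in> J - P \<Longrightarrow> A (w j) = \<zero>\<^bsub>W\<^esub>"
    by (elim exE conjE) simp
  have finJ: "finite J" and finI: "finite I"
    using V.frame_finite[OF frV] W.frame_finite[OF frW] by auto
  then have finP: "finite P"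
    using PJ finite_subset by blast
  have w: "w \<in> J \<rightarrow> carrier V" and u: "u \<in> I \<rightarrow> carrier W"
    using V.frame_carrier[OF frV] W.frame_carrier[OF frW] by auto
  have wJ[simp]: "j \<in> J \<Longrightarrow> w j \<in> carrier V" and uI[simp]: "i \<in> I \<Longrightarrow> u i \<in> carrier W" 
    and \<sigma>I[simp]: "j \<in> P \<Longrightarrow> \<sigma> j \<in> I" and PJ'[simp]: "j \<in> P \<Longrightarrow> j \<in> J" for i j
    using w u PI PJ by auto
  have reidx: "W.lc (\<sigma> ` P) c u = W.lc P (\<lambda>j. c (\<sigma> j)) (\<lambda>j. A (w j))" if c: "c \<in> \<sigma> ` P \<rightarrow> carrier V.K" for c
  proof -
    have "W.lc (\<sigma> ` P) c u = W.lc P (\<lambda>j. c (\<sigma> j)) (\<lambda>j. u (\<sigma> j))"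
      using c by (intro W.M.finsum_reindex inj) (simp add: Pi_iff \<sigma>I)
    also have "\<dots> = W.lc P (\<lambda>j. c (\<sigma> j)) (\<lambda>j. A (w j))"
      using c by (intro W.lc_cong) (simp_all add: AP[symmetric] Pi_iff)
    finally show ?thesis .
  qed
  have split: "V.lc J c w = V.lc P c w \<oplus>\<^bsub>V\<^esub> V.lc (J - P) c w" if "c \<in> J \<rightarrow> carrier V.K" for c
    using V.lc_Un[of P "J - P" c w] that w PJ finJ finP by (simp add: Un_absorb1 Pi_iff)
  have Azero: "A (V.lc (J - P) c w) = \<zero>\<^bsub>W\<^esub>" if "c \<in> J - P \<rightarrow> carrier V.K" for c
  proof -
    have "A (V.lc (J - P) c w) = W.lc (J - P) c (\<lambda>j. A (w j))"
      using that by (intro map_lc) (simp_all add: Pi_iff)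
    also have "\<dots> = \<zero>\<^bsub>W\<^esub>"
      using that by (intro W.M.add.finprod_one_eqI) (auto simp: A0 Pi_iff)
    finally show ?thesis .
  qed
  \<comment> \<open>The map forgets the coefficients of columns without a pivot and moves the others
    along \<open>\<sigma>\<close>.\<close>
  have A_lc: "A (V.lc J c w) = W.lc (\<sigma> ` P) (\<lambda>i. c (the_inv_into P \<sigma> i)) u" if c: "c \<in> J \<rightarrow> carrier V.K" for c
  proof -
    have c': "(\<lambda>i. c (the_inv_into P \<sigma> i)) \<in> \<sigma> ` P \<rightarrow> carrier V.K"
      using c by (simp add: Pi_iff the_inv_into_f_f[OF inj])
    have "V.lc P c w \<in> carrier V" "V.lc (J - P) c w \<in> carrier V"
      using c by (simp_all add: Pi_iff V.lc_closed)
    then have "A (V.lc J c w) = A (V.lc P c w)"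
      using Azero[of c] c by (auto simp: split)
    also have "\<dots> = W.lc P c (\<lambda>j. A (w j))"
      using c by (intro map_lc) (simp_all add: Pi_iff)
    also have "\<dots> = W.lc (\<sigma> ` P) (\<lambda>i. c (the_inv_into P \<sigma> i)) u"
      unfolding reidx[OF c'] using c
      by (intro W.lc_cong) (simp_all add: Pi_iff the_inv_into_f_f[OF inj])
    finally show ?thesis .
  qed
  have im_eq: "im = {W.lc (\<sigma> ` P) c u |c. c \<in> \<sigma> ` P \<rightarrow> carrier V.K}" (is "_ = ?R")
  proof
    show "im \<subseteq> ?R"
    proof
      fix x assume "x \<in> im"
      then obtain v where v: "v \<in> carrier V" "x = A v"
        unfolding im_def by (rule imageE)
      obtain c where c: "c \<in> J \<rightarrow> carrier V.K" "v = V.lc J c w"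
        using V.frame_span[OF frV v(1)] .
      have "(\<lambda>i. c (the_inv_into P \<sigma> i)) \<in> \<sigma> ` P \<rightarrow> carrier V.K"
        using c by (simp add: Pi_iff the_inv_into_f_f[OF inj])
      then show "x \<in> ?R"
        unfolding v(2) c(2) A_lc[OF c(1)] by (intro CollectI exI conjI) (rule refl)
    qed
    show "?R \<subseteq> im"
    proof
      fix x assume "x \<in> ?R"
      then obtain c where c: "c \<in> \<sigma> ` P \<rightarrow> carrier V.K" and x: "x = W.lc (\<sigma> ` P) c u"
        by (elim CollectE exE conjE) simp
      have "x = W.lc P (\<lambda>j. c (\<sigma> j)) (\<lambda>j. A (w j))"
        unfolding x by (rule reidx[OF c])
      also have "\<dots> = A (V.lc P (\<lambda>j. c (\<sigma> j)) w)"
        using c by (intro map_lc[symmetric]) (simp_all add: Pi_iff)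
      finally show "x \<in> im"
        unfolding im_def using c by (simp add: Pi_iff V.lc_closed)
    qed
  qed
  have ker_eq: "ker = {V.lc (J - P) c w |c. c \<in> J - P \<rightarrow> carrier V.K}" (is "_ = ?R")
  proof
    show "?R \<subseteq> ker"
    proof
      fix v assume "v \<in> ?R"
      then obtain c where "c \<in> J - P \<rightarrow> carrier V.K" "v = V.lc (J - P) c w"
        by (elim CollectE exE conjE) simp
      then show "v \<in> ker"
        by (simp add: ker_def Azero V.lc_closed Pi_iff)
    qed
    show "ker \<subseteq> ?R"
    proof
      fix v assume "v \<in> ker"
      then have v: "v \<in> carrier V" "A v = \<zero>\<^bsub>W\<^esub>"
        by (auto simp: ker_def)
      obtain c where c: "c \<in> J \<rightarrow> carrier V.K" "v = V.lc J c w"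
        using V.frame_span[OF frV v(1)] .
      let ?d = "\<lambda>i. c (the_inv_into P \<sigma> i)"
      let ?e = "\<lambda>i. if i \<in> \<sigma> ` P then ?d i else \<zero>\<^bsub>V.K\<^esub>"
      have d: "?d \<in> \<sigma> ` P \<rightarrow> carrier V.K"
        using c by (simp add: Pi_iff the_inv_into_f_f[OF inj])
      have e: "?e \<in> I \<rightarrow> carrier V.K"
        using d by (auto simp: Pi_iff)
      have "W.lc I ?e u = W.lc (\<sigma> ` P) ?d u"
        by (intro W.lc_supset d u finI PI)
      also have "\<dots> = \<zero>\<^bsub>W\<^esub>"
        using v(2) A_lc[OF c(1)] c(2) by simp
      finally have eq: "W.lc I ?e u = \<zero>\<^bsub>W\<^esub>" .
      \<comment> \<open>Padded by zero, the pivot coefficients form a vanishing combination of the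
        whole frame \<open>u\<close>, so they are zero.\<close>
      have "c j = \<zero>\<^bsub>V.K\<^esub>" if "j \<in> P" for j
        using W.frame_independent[OF frW e eq, of "\<sigma> j"] that
        by (simp add: the_inv_into_f_f[OF inj])
      then have "V.lc P c w = \<zero>\<^bsub>V\<^esub>"
        by (intro V.lc_zero) (simp_all add: Pi_iff)
      moreover have "V.lc (J - P) c w \<in> carrier V"
        using c(1) by (simp add: Pi_iff V.lc_closed)
      ultimately have "v = V.lc (J - P) c w"
        using split[OF c(1)] c(2) by simp
      moreover have "c \<in> J - P \<rightarrow> carrier V.K"
        using c(1) by auto
      ultimately show "v \<in> ?R"
        by (intro CollectI exI conjI)
    qed
  qed
  interpret kerV: nonarch_normed_space \<Gamma> "V\<lparr>carrier := ker\<rparr>" lV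
    by (rule V.nonarch_submodule) (rule ker_is_submodule)
  interpret imW: nonarch_normed_space \<Gamma> "W\<lparr>carrier := im\<rparr>" lW
    by (rule W.nonarch_submodule) (rule im_is_submodule)
  have frK: "orth_frame \<Gamma> (V\<lparr>carrier := ker\<rparr>) lV (J - P) w"
    by (rule V.frame_subset[OF frV _ ker_is_submodule ker_eq]) auto
  have frI: "orth_frame \<Gamma> (W\<lparr>carrier := im\<rparr>) lW (\<sigma> ` P) u"
    by (rule W.frame_subset[OF frW PI im_is_submodule im_eq])
  obtain ks where ks: "set ks = J - P" "distinct ks"
    using finite_distinct_list[of "J - P"] finJ by auto
  obtain us where us: "set us = I - \<sigma> ` P" "distinct us"
    using finite_distinct_list[of "I - \<sigma> ` P"] finI by auto
  obtain ps where ps: "set ps = P" "distinct ps"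
    using finite_distinct_list[OF finP] by auto
  define key where "key = (\<lambda>j. lV (w j) - lW (u (\<sigma> j)))"
  \<comment> \<open>Sorting by \<open>key\<close> is increasing; the list is reversed because a
    decomposition lists the drops in level in decreasing order.\<close>
  define js where "js = rev (sort_key key ps)"
  have js: "set js = P" "distinct js"
    using ps by (auto simp: js_def)
  have "sorted (rev (map key js))"
    by (simp add: js_def rev_map)
  then have key: "key (js ! j) \<le> key (js ! i)" if "i \<le> j" "j < length js" for i j
    using sorted_rev_nth_mono[of "map key js" i j] that by simp
  have dist: "distinct (map \<sigma> js)"
    using js inj by (simp add: distinct_map)
  have obK: "orthogonal_basis \<Gamma> (V\<lparr>carrier := ker\<rparr>) lV (map w ks)"
    by (rule kerV.orthogonal_basis_map[OF frK ks(2,1)])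
  then show "\<exists>zs. orthogonal_basis \<Gamma> (V\<lparr>carrier := ker\<rparr>) lV zs" ..
  have obI: "orthogonal_basis \<Gamma> (W\<lparr>carrier := im\<rparr>) lW (map u (map \<sigma> js))"
    by (rule imW.orthogonal_basis_map[OF frI dist]) (simp add: js)
  have rank: "map_rank \<Gamma> V W A = length js"
  proof -
    have "vectorspace.dim V.K (W\<lparr>carrier := im\<rparr>) = card (set (map u (map \<sigma> js)))"
      by (rule imW.dim_basis) (use obI in \<open>auto simp: orthogonal_basis_def\<close>)
    also have "\<dots> = length js"
      using obI distinct_card[of "map u (map \<sigma> js)"] unfolding orthogonal_basis_def by simp
    finally show ?thesis
      by (simp add: map_rank_def)
  qed
  have "is_svd \<Gamma> V lV W lW A (map w (js @ ks)) (map u (map \<sigma> js @ us))"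
    unfolding is_svd_def Let_def rank
  proof (intro conjI allI impI)
    show "orthogonal_basis \<Gamma> V lV (map w (js @ ks))"
      by (rule V.orthogonal_basis_map[OF frV]) (use js ks PJ in auto)
    show "orthogonal_basis \<Gamma> W lW (map u (map \<sigma> js @ us))"
      by (rule W.orthogonal_basis_map[OF frW]) (use js us PI dist in auto)
    show "orthogonal_basis \<Gamma> (V\<lparr>carrier := ker\<rparr>) lV (drop (length js) (map w (js @ ks)))"
      using obK by simp
    show "orthogonal_basis \<Gamma> (W\<lparr>carrier := im\<rparr>) lW (take (length js) (map u (map \<sigma> js @ us)))"
      using obI by simp
    show "A (map w (js @ ks) ! i) = map u (map \<sigma> js @ us) ! i" if "i < length js" for i
    proof -
      have "js ! i \<in> P"
        using that js(1) by auto
      then show ?thesis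
        using that by (simp add: nth_append AP)
    qed
    show "lV (map w (js @ ks) ! j) - lW (map u (map \<sigma> js @ us) ! j)
        \<le> lV (map w (js @ ks) ! i) - lW (map u (map \<sigma> js @ us) ! i)"
      if "i \<le> j \<and> j < length js" for i j
      using key[of i j] that by (simp add: nth_append key_def)
  qed
  then show "\<exists>ys xs. is_svd \<Gamma> V lV W lW A ys xs"
    by blast
qed

text \<open>
  Any orthogonal basis \<open>z\<close> of the kernel may be exchanged for the one that comes with the singular
  value decomposition.
\<close>

lemma svd_frame:
  assumes svd: "is_svd \<Gamma> V lV W lW A ys xs"
    and frZ: "orth_frame \<Gamma> (V\<lparr>carrier := ker\<rparr>) lV M z"
  defines "r \<equiv> map_rank \<Gamma> V W A"
  shows "orth_frame \<Gamma> V lV ({..<r} <+> M) (case_sum ((!) ys) z)"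
    and "r \<le> length ys" "r \<le> length xs"
proof -
  have ker: "submodule V.K ker V" and im: "submodule V.K im W"
    by (rule ker_is_submodule im_is_submodule)+
  interpret N: nonarch_normed_space \<Gamma> "V\<lparr>carrier := ker\<rparr>" lV
    by (rule V.nonarch_submodule) (rule ker)
  interpret imW: nonarch_normed_space \<Gamma> "W\<lparr>carrier := im\<rparr>" lW
    by (rule W.nonarch_submodule) (rule im)
  have obs: "orthogonal_basis \<Gamma> V lV ys" "orthogonal_basis \<Gamma> (V\<lparr>carrier := ker\<rparr>) lV (drop r ys)"
      "orthogonal_basis \<Gamma> (W\<lparr>carrier := im\<rparr>) lW (take r xs)"
    using svd by (auto simp: is_svd_def Let_def r_def)
  have fin: "V.fin_dim"
    using obs(1) by (auto simp: V.fin_dim_def orthogonal_basis_def V.basis_def intro!: exI[of _ "set ys"])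
  have "V.dim = length ys"
    using obs(1) V.dim_basis[of "set ys"] by (simp add: orthogonal_basis_def distinct_card)
  moreover have "vectorspace.dim V.K (W\<lparr>carrier := im\<rparr>) \<le> V.dim"
    using rank_nullity[OF fin] by linarith
  ultimately show r: "r \<le> length ys"
    by (simp add: r_def map_rank_def)
  have "r = vectorspace.dim V.K (W\<lparr>carrier := im\<rparr>)"
    by (simp add: r_def map_rank_def)
  also have "\<dots> = card (set (take r xs))"
    by (rule imW.dim_basis) (use obs(3) in \<open>simp_all add: orthogonal_basis_def\<close>)
  also have "\<dots> = length (take r xs)"
    by (rule distinct_card) (use obs(3) in \<open>simp add: orthogonal_basis_def\<close>)
  finally have "r = length (take r xs)" .
  then show "r \<le> length xs"
    by simp
  let ?n = "length ys"
  define ds where "ds = (\<lambda>i. ys ! (r + i))"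
  have frY: "orth_frame \<Gamma> V lV {..<?n} ((!) ys)"
    using obs(1) V.orthogonal_basis_iff_orth_frame by blast
  have [simp]: "finite M"
    by (rule N.frame_finite[OF frZ])
  have "orth_frame \<Gamma> (V\<lparr>carrier := ker\<rparr>) lV {..<?n - r} ((!) (drop r ys))"
    using obs(2) N.orthogonal_basis_iff_orth_frame[of "drop r ys"] by simp
  then have frD: "orth_frame \<Gamma> (V\<lparr>carrier := ker\<rparr>) lV {..<?n - r} ds"
    by (rule N.frame_cong) (use r in \<open>simp add: ds_def\<close>)
  have kerV: "x \<in> carrier V" if "x \<in> ker" for x
    using ker that by (auto simp: submodule_def)
  have y: "(!) ys \<in> {..<?n} \<rightarrow> carrier V" and z: "z \<in> M \<rightarrow> ker" and d: "ds \<in> {..<?n - r} \<rightarrow> ker"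
    using V.frame_carrier[OF frY] N.frame_carrier[OF frZ] N.frame_carrier[OF frD] by auto
  then have zV: "z \<in> M \<rightarrow> carrier V" and yr: "(!) ys \<in> {..<r} \<rightarrow> carrier V"
      and dV: "ds \<in> {..<?n - r} \<rightarrow> carrier V"
    using kerV r by auto
  have lcZ: "N.lc M c z = V.lc M c z" if "c \<in> M \<rightarrow> carrier V.K" for c
    using V.finsum_submodule[OF ker, of "\<lambda>j. c j \<odot>\<^bsub>V\<^esub> z j" "M"] that z N.smult_closed by auto
  have lcD: "N.lc {..<?n - r} c ds = V.lc {..<?n - r} c ds" if "c \<in> {..<?n - r} \<rightarrow> carrier V.K" for c
    using V.finsum_submodule[OF ker, of "\<lambda>j. c j \<odot>\<^bsub>V\<^esub> ds j" "{..<?n - r}"] that d N.smult_closed by auto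
  show "orth_frame \<Gamma> V lV ({..<r} <+> M) (case_sum ((!) ys) z)"
  proof (rule V.orth_frameI)
    fix s assume "s \<in> {..<r} <+> M"
    then show "case_sum ((!) ys) z s \<in> carrier V" "case_sum ((!) ys) z s \<noteq> \<zero>\<^bsub>V\<^esub>"
      using y zV r V.frame_nonzero[OF frY] N.frame_nonzero[OF frZ] by auto
  next
    fix c s assume c: "c \<in> {..<r} <+> M \<rightarrow> carrier V.K" and s: "s \<in> {..<r} <+> M"
    \<comment> \<open>The part lying in the kernel. Re-expanded in \<open>ds\<close>, it completes
      the coefficients on the first \<open>r\<close> vectors to coefficients \<open>a\<close> on all
      of \<open>ys\<close>, where orthogonality is known.\<close>
    define x where "x = N.lc M (\<lambda>i. c (Inr i)) z"
    have cr: "(\<lambda>i. c (Inr i)) \<in> M \<rightarrow> carrier V.K" "(\<lambda>i. c (Inl i)) \<in> {..<r} \<rightarrow> carrier V.K"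
      using c by auto
    have "x \<in> carrier (V\<lparr>carrier := ker\<rparr>)"
      unfolding x_def using cr z by (intro N.lc_closed) auto
    then obtain e where e: "e \<in> {..<?n - r} \<rightarrow> carrier V.K" "x = N.lc {..<?n - r} e ds"
      using N.frame_span[OF frD] by blast
    define a where "a = (\<lambda>i. if i < r then c (Inl i) else e (i - r))"
    have a: "a \<in> {..<?n} \<rightarrow> carrier V.K"
      using c e r by (auto simp: a_def Pi_iff)
    have "V.lc ({..<r} <+> M) c (case_sum ((!) ys) z) = 
        V.lc {..<r} (\<lambda>i. c (Inl i)) ((!) ys) \<oplus>\<^bsub>V\<^esub> V.lc M (\<lambda>i. c (Inr i)) z"
      using c yr zV by (intro V.lc_Plus) auto
    also have "V.lc M (\<lambda>i. c (Inr i)) z = x"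
      using lcZ[OF cr(1)] by (simp add: x_def)
    also have "x = V.lc {..<?n - r} (\<lambda>i. a (r + i)) (\<lambda>i. ys ! (r + i))"
      using e lcD[OF e(1)] by (simp add: a_def ds_def)
    also have "V.lc {..<r} (\<lambda>i. c (Inl i)) ((!) ys) = V.lc {..<r} a ((!) ys)"
      using yr r a cr by (intro V.lc_cong) (auto simp: a_def)
    also have "V.lc {..<r} a ((!) ys) \<oplus>\<^bsub>V\<^esub> V.lc {..<?n - r} (\<lambda>i. a (r + i)) (\<lambda>i. ys ! (r + i)) = V.lc {..<?n} a ((!) ys)"
      using a y r by (intro V.lc_take_drop[symmetric]) auto
    finally have eq: "V.lc ({..<r} <+> M) c (case_sum ((!) ys) z) = V.lc {..<?n} a ((!) ys)" .
    show "lV (c s \<odot>\<^bsub>V\<^esub> case_sum ((!) ys) z s) \<le> lV (V.lc ({..<r} <+> M) c (case_sum ((!) ys) z))"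
      unfolding eq
    proof (cases s)
      case (Inl i)
      then have "i < r"
        using s by auto
      then show "lV (c s \<odot>\<^bsub>V\<^esub> case_sum ((!) ys) z s) \<le> lV (V.lc {..<?n} a ((!) ys))"
        using V.frame_le[OF frY a, of i] r Inl by (simp add: a_def)
    next
      case (Inr j)
      \<comment> \<open>Orthogonality of \<open>z\<close> bounds the term by the kernel part
        \<open>x\<close>; orthogonality of \<open>ys\<close> bounds each \<open>ds\<close>-term of
        \<open>x\<close>, and hence \<open>x\<close>, by the whole.\<close>
      then have "lV (c s \<odot>\<^bsub>V\<^esub> case_sum ((!) ys) z s) \<le> lV x"
        using N.frame_le[OF frZ cr(1), of j] s by (auto simp: x_def)
      also have "\<dots> \<le> lV (V.lc {..<?n} a ((!) ys))"
        unfolding e(2) lcD[OF e(1)]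
      proof (rule V.l_sum_le)
        show "(\<lambda>i. e i \<odot>\<^bsub>V\<^esub> ds i) \<in> {..<?n - r} \<rightarrow> carrier V"
          using e(1) dV by auto
        show "lV (e i \<odot>\<^bsub>V\<^esub> ds i) \<le> lV (V.lc {..<?n} a ((!) ys))" if "i \<in> {..<?n - r}" for i
          using V.frame_le[OF frY a, of "r + i"] that by (simp add: a_def ds_def)
      qed
      finally show "lV (c s \<odot>\<^bsub>V\<^esub> case_sum ((!) ys) z s) \<le> lV (V.lc {..<?n} a ((!) ys))" .
    qed
  next
    fix v assume "v \<in> carrier V"
    then obtain a where a: "a \<in> {..<?n} \<rightarrow> carrier V.K" "v = V.lc {..<?n} a ((!) ys)"
      using V.frame_span[OF frY] by blast
    \<comment> \<open>For spanning, the exchange runs the other way, from \<open>ds\<close> to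
      \<open>z\<close>.\<close>
    define x where "x = N.lc {..<?n - r} (\<lambda>i. a (r + i)) ds"
    have ar: "(\<lambda>i. a (r + i)) \<in> {..<?n - r} \<rightarrow> carrier V.K"
      using a(1) by auto
    have "x \<in> carrier (V\<lparr>carrier := ker\<rparr>)"
      unfolding x_def using ar d by (intro N.lc_closed) auto
    then obtain f where f: "f \<in> M \<rightarrow> carrier V.K" "x = N.lc M f z"
      using N.frame_span[OF frZ] by blast
    have c: "case_sum a f \<in> {..<r} <+> M \<rightarrow> carrier V.K"
      using a(1) f(1) r by auto
    have "v = V.lc {..<r} a ((!) ys) \<oplus>\<^bsub>V\<^esub> V.lc {..<?n - r} (\<lambda>i. a (r + i)) (\<lambda>i. ys ! (r + i))"
      unfolding a(2) using a(1) y r by (intro V.lc_take_drop) auto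
    also have "V.lc {..<?n - r} (\<lambda>i. a (r + i)) (\<lambda>i. ys ! (r + i)) = x"
      using lcD[OF ar] by (simp add: x_def ds_def)
    also have "x = V.lc M f z"
      using lcZ[OF f(1)] f(2) by simp
    also have "V.lc {..<r} a ((!) ys) \<oplus>\<^bsub>V\<^esub> V.lc M f z = 
        V.lc ({..<r} <+> M) (case_sum a f) (case_sum ((!) ys) z)"
      using c yr zV by (subst V.lc_Plus) auto
    finally show "\<exists>c\<in>{..<r} <+> M \<rightarrow> carrier V.K. v = V.lc ({..<r} <+> M) c (case_sum ((!) ys) z)"
      using c by (intro bexI[of _ "case_sum a f"])
  qed simp
qed

end

section \<open>Generators from the verbose barcode\<close>

text \<open>\<open>svd_frame\<close> lists the vectors \<open>y\<close> before those of the cycles,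
  whereas the generators of a degree are listed with the cycles in front; this matches the two
  orders.\<close>

lemma bij_betw_case_sum_swap:
  fixes f :: "'a \<Rightarrow> 'b" and g :: "'c \<Rightarrow> 'd"
  assumes "bij_betw f A A'" "bij_betw g B B'"
  shows "bij_betw (case_sum (\<lambda>a. Inr (f a)) (\<lambda>b. Inl (g b))) (A <+> B) (B' <+> A')"
proof (rule bij_betw_imageI)
  show "inj_on (case_sum (\<lambda>a. Inr (f a)) (\<lambda>b. Inl (g b))) (A <+> B)"
  proof (rule inj_onI)
    fix u v assume "u \<in> A <+> B" "v \<in> A <+> B"
      "case_sum (\<lambda>a. Inr (f a)) (\<lambda>b. Inl (g b)) u = (case_sum (\<lambda>a. Inr (f a)) (\<lambda>b. Inl (g b)) v :: 'd + 'b)"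
    then show "u = v"
      using assms[THEN bij_betw_imp_inj_on] by (elim PlusE) (simp_all add: inj_on_eq_iff)
  qed
  have "case_sum (\<lambda>a. Inr (f a)) (\<lambda>b. Inl (g b)) ` (A <+> B) = Inr ` f ` A \<union> Inl ` g ` B"
    by (simp add: Plus_def image_Un image_image)
  then show "case_sum (\<lambda>a. Inr (f a)) (\<lambda>b. Inl (g b)) ` (A <+> B) = B' <+> A'"
    using assms[THEN bij_betw_imp_surj_on] by (simp add: Plus_def Un_commute)
qed

lemma mset_index_add_mset:
  "mset_index (add_mset b B) = insert (b, count B b) (mset_index B)"
  by (auto simp: mset_index_def less_Suc_eq split: if_splits)

lemma finite_mset_index: "finite (mset_index B)"
  by (induction B) (auto simp: mset_index_add_mset, simp add: mset_index_def)

text \<open>Labels list positions by bars. In the induction a new element is numbered by the count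
  of its value so far, which is the next free number for that value.\<close>

lemma mset_index_image_bij:
  assumes "finite A"
  shows "\<exists>\<sigma>. bij_betw \<sigma> A (mset_index (image_mset f (mset_set A))) \<and> (\<forall>a\<in>A. fst (\<sigma> a) = f a)"
  using assms
proof (induction A rule: finite_induct)
  case empty
  then show ?case by (simp add: mset_index_def bij_betw_def)
next
  case (insert x A)
  let ?B = "image_mset f (mset_set A)"
  obtain \<sigma> where \<sigma>: "bij_betw \<sigma> A (mset_index ?B)" "\<forall>a\<in>A. fst (\<sigma> a) = f a"
    using insert.IH by blast
  define \<tau> where "\<tau> = \<sigma>(x := (f x, count ?B (f x)))"
  have "bij_betw \<tau> A (mset_index ?B)"
    using \<sigma>(1) insert.hyps by (subst bij_betw_cong[of A _ \<sigma>]) (auto simp: \<tau>_def)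
  then have "bij_betw \<tau> (A \<union> {x}) (mset_index ?B \<union> {\<tau> x})"
    using insert.hyps by (intro notIn_Un_bij_betw) (auto simp: \<tau>_def mset_index_def)
  then have "bij_betw \<tau> (insert x A) (mset_index (image_mset f (mset_set (insert x A))))"
    using insert.hyps by (simp add: mset_index_add_mset \<tau>_def)
  moreover have "\<forall>a\<in>insert x A. fst (\<tau> a) = f a"
    using \<sigma>(2) by (simp add: \<tau>_def)
  ultimately show ?case
    by blast
qed

definition novikov_monom :: "real \<Rightarrow> real \<Rightarrow> 'k::field" where
  "novikov_monom g = (\<lambda>h. if h = g then 1 else 0)"

lemma novikov_monom_carrier: "g \<in> \<Gamma> \<Longrightarrow> novikov_monom g \<in> carrier (novikov_field \<Gamma>)"
  by (auto simp: novikov_field_def novikov_monom_def intro: finite_subset[of _ "{g}"])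

lemma novikov_monom_nonzero: "novikov_monom g \<noteq> \<zero>\<^bsub>novikov_field \<Gamma>\<^esub>"
  by (auto simp: novikov_field_def novikov_monom_def fun_eq_iff)

text \<open>Scaling by the power \<open>T^g\<close> lowers a level by exactly \<open>g\<close>. For
  \<open>g \<in> \<Gamma>\<close> this is an admissible nonzero scalar, so a level can be moved to
  any representative of its coset.\<close>

lemma novikov_val_monom: "novikov_val (novikov_monom g :: real \<Rightarrow> 'k::field) = ereal g"
proof -
  have "(LEAST h. (novikov_monom g h :: 'k) \<noteq> 0) = g"
    by (rule Least_equality) (auto simp: novikov_monom_def split: if_splits)
  moreover have "(novikov_monom g :: real \<Rightarrow> 'k) \<noteq> (\<lambda>g. 0)"
    by (auto simp: novikov_monom_def fun_eq_iff)
  ultimately show ?thesis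
    by (simp add: novikov_val_def)
qed

section \<open>Boundary maps of a Floer-type complex and its cycles\<close>

locale floer =
  fixes \<Gamma> :: "real set" and C :: "(real \<Rightarrow> 'k::field, 'v) filtered_complex"
  assumes floer: "floer_complex \<Gamma> C"
begin

lemma orthogonalizable_chains: "orthogonalizable \<Gamma> (chains C k) (lev C k)"
  and linear_map_bd: "linear_map (novikov_field \<Gamma>) (chains C k) (chains C (k - 1)) (bd C k)"
  and bd_bd: "x \<in> carrier (chains C k) \<Longrightarrow> bd C (k - 1) (bd C k x) = \<zero>\<^bsub>chains C (k - 2)\<^esub>"
  using floer by (auto simp: floer_complex_def)

lemma nonarch_chains: "nonarch_normed_space \<Gamma> (chains C k) (lev C k)"
  using orthogonalizable_chains by (auto simp: orthogonalizable_def)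

lemma map_chains: "nonarch_linear_map \<Gamma> (chains C k) (lev C k) (chains C (k - 1)) (lev C (k - 1)) (bd C k)"
  by (intro nonarch_linear_map.intro nonarch_chains linear_map_bd)

lemma chains_frame: "\<exists>ws :: 'v list. orth_frame \<Gamma> (chains C k) (lev C k) {..<length ws} ((!) ws)"
  using orthogonalizable_chains[of k] nonarch_normed_space.orthogonal_basis_iff_orth_frame[OF nonarch_chains[of k]]
  by (auto simp: orthogonalizable_def)

lemma carrier_cycles:
  "carrier (cycles C k) = {x \<in> carrier (chains C k). bd C k x = \<zero>\<^bsub>chains C (k - 1)\<^esub>}"
proof -
  interpret nonarch_linear_map \<Gamma> "chains C k" "lev C k" "chains C (k - 1)" "lev C (k - 1)" "bd C k"
    by (rule map_chains)
  show ?thesis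
    by (auto simp: cycles_def ker_def)
qed

text \<open>The cycles are a kernel, so their orthogonal basis comes from eliminating the boundary
  map into all chains of degree \<open>k - 1\<close>.\<close>

lemma cycles_frame: "\<exists>zs :: 'v list. orth_frame \<Gamma> (cycles C k) (lev C k) {..<length zs} ((!) zs)"
  and nonarch_cycles: "nonarch_normed_space \<Gamma> (cycles C k) (lev C k)"
proof -
  interpret nonarch_linear_map \<Gamma> "chains C k" "lev C k" "chains C (k - 1)" "lev C (k - 1)" "bd C k"
    by (rule map_chains)
  show *: "nonarch_normed_space \<Gamma> (cycles C k) (lev C k)"
    unfolding cycles_def by (rule V.nonarch_submodule) (rule ker_is_submodule)
  obtain vs ws :: "'v list" where "orth_frame \<Gamma> (chains C k) (lev C k) {..<length vs} ((!) vs)"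
    "orth_frame \<Gamma> (chains C (k - 1)) (lev C (k - 1)) {..<length ws} ((!) ws)"
    using chains_frame by blast
  then obtain zs where "orthogonal_basis \<Gamma> (cycles C k) (lev C k) zs"
    using svd_exists(2) unfolding cycles_def by blast
  then show "\<exists>zs :: 'v list. orth_frame \<Gamma> (cycles C k) (lev C k) {..<length zs} ((!) zs)"
    using nonarch_normed_space.orthogonal_basis_iff_orth_frame[OF *] by blast
qed

text \<open>Because boundaries are cycles, the codomain can be cut down from the chains to the
  cycles. The restricted map is the one whose decomposition defines the barcode.\<close>

lemma map_cycles:
  "nonarch_linear_map \<Gamma> (chains C (k + 1)) (lev C (k + 1)) (cycles C k) (lev C k) (bd C (k + 1))"
proof (intro nonarch_linear_map.intro nonarch_chains nonarch_cycles)
  have "linear_map (novikov_field \<Gamma>) (chains C (k + 1)) (chains C k) (bd C (k + 1))"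
    using linear_map_bd[of "k + 1"] by simp
  then have V: "vectorspace (novikov_field \<Gamma>) (chains C (k + 1))"
    and hom: "bd C (k + 1) \<in> module_hom (novikov_field \<Gamma>) (chains C (k + 1)) (chains C k)"
    by (auto simp: linear_map_def mod_hom_def mod_hom_axioms_def)
  have W: "vectorspace (novikov_field \<Gamma>) (cycles C k)"
    using nonarch_cycles by (simp add: nonarch_normed_space_def)
  have "bd C (k + 1) x \<in> carrier (cycles C k)" if "x \<in> carrier (chains C (k + 1))" for x
    using bd_bd[OF that] module_hom_closed[OF hom] that by (auto simp: carrier_cycles)
  then have "bd C (k + 1) \<in> module_hom (novikov_field \<Gamma>) (chains C (k + 1)) (cycles C k)"
    using hom by (auto simp: module_hom_def cycles_def)
  then show "linear_map (novikov_field \<Gamma>) (chains C (k + 1)) (cycles C k) (bd C (k + 1))"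
    using V W by (simp add: linear_map_def mod_hom_def mod_hom_axioms_def vectorspace_def)
qed

text \<open>Cutting down the codomain leaves the kernel unchanged. So the kernel of one boundary map
  is, as a record, the codomain of the restricted map one degree higher; this lets decompositions in
  adjacent degrees be joined.\<close>

lemma ker_bd_eq_cycles:
  "(chains C (k + 1))\<lparr>carrier := mod_hom.ker (chains C (k + 1)) (cycles C k) (bd C (k + 1))\<rparr> = cycles C (k + 1)"
proof -
  interpret c: nonarch_linear_map \<Gamma> "chains C (k + 1)" "lev C (k + 1)" "cycles C k" "lev C k" "bd C (k + 1)"
    by (rule map_cycles)
  have "c.ker = carrier (cycles C (k + 1))"
    by (auto simp: c.ker_def carrier_cycles) (auto simp: cycles_def)
  then show ?thesis
    by (simp add: cycles_def)
qed

abbreviation bars where "bars k \<equiv> mset_index (verbose_barcode \<Gamma> C k)"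

abbreviation finite_bars where "finite_bars k \<equiv> {b \<in> bars k. snd (fst b) \<noteq> \<infinity>}"

text \<open>\<open>SOME\<close> has its defining property once a witness exists, and
  \<open>svd_exists\<close> supplies one. This gives a decomposition whose barcode is exactly the
  chosen multiset.\<close>

lemma barcode_svd:
  obtains ys xs where
    "is_svd \<Gamma> (chains C (k + 1)) (lev C (k + 1)) (cycles C k) (lev C k) (bd C (k + 1)) ys xs"
    "verbose_barcode \<Gamma> C k = svd_barcode \<Gamma> (lev C (k + 1)) (lev C k)
       (map_rank \<Gamma> (chains C (k + 1)) (cycles C k) (bd C (k + 1))) ys xs"
proof -
  interpret nonarch_linear_map \<Gamma> "chains C (k + 1)" "lev C (k + 1)" "cycles C k" "lev C k" "bd C (k + 1)"
    by (rule map_cycles)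
  obtain vs ws :: "'v list" where "orth_frame \<Gamma> (chains C (k + 1)) (lev C (k + 1)) {..<length vs} ((!) vs)"
    "orth_frame \<Gamma> (cycles C k) (lev C k) {..<length ws} ((!) ws)"
    using chains_frame cycles_frame by blast
  from svd_exists(1)[OF this]
  have "\<exists>B ys xs. is_svd \<Gamma> (chains C (k + 1)) (lev C (k + 1)) (cycles C k) (lev C k) (bd C (k + 1)) ys xs \<and>
        B = svd_barcode \<Gamma> (lev C (k + 1)) (lev C k)
              (map_rank \<Gamma> (chains C (k + 1)) (cycles C k) (bd C (k + 1))) ys xs"
    by blast
  from someI_ex[OF this] show ?thesis
    using that unfolding verbose_barcode_def by blast
qed

text \<open>The quantifier over \<open>Z\<close> keeps the degrees apart: \<open>Y\<close> depends
  on the decomposition for \<open>k\<close> alone, while the cycles in degree \<open>k + 1\<close>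
  may carry any orthogonal basis. In the end \<open>Z\<close> is the \<open>X\<close> obtained for
  \<open>k + 1\<close>.\<close>

lemma barcode_generators:
  fixes a :: "(real set \<times> ereal) \<times> nat \<Rightarrow> real"
  assumes sub: "subgroup \<Gamma> real_group" and a: "\<And>b. b \<in> bars k \<Longrightarrow> a b \<in> fst (fst b)"
  shows "\<exists>X Y. orth_frame \<Gamma> (cycles C k) (lev C k) (bars k) X \<and>
    (\<forall>b\<in>bars k. lev C k (X b) = ereal (a b)) \<and>
    (\<forall>b\<in>finite_bars k. Y b \<in> carrier (chains C (k + 1)) \<and> bd C (k + 1) (Y b) = X b \<and>
       lev C (k + 1) (Y b) = ereal (a b) + snd (fst b)) \<and>
    (\<forall>Z. orth_frame \<Gamma> (cycles C (k + 1)) (lev C (k + 1)) (bars (k + 1)) Z \<longrightarrow>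
       orth_frame \<Gamma> (chains C (k + 1)) (lev C (k + 1)) (bars (k + 1) <+> finite_bars k) (case_sum Z Y))"
proof -
  interpret nonarch_linear_map \<Gamma> "chains C (k + 1)" "lev C (k + 1)" "cycles C k" "lev C k" "bd C (k + 1)"
    by (rule map_cycles)
  obtain ys xs where svd: "is_svd \<Gamma> (chains C (k + 1)) (lev C (k + 1)) (cycles C k) (lev C k) (bd C (k + 1)) ys xs"
    and B: "verbose_barcode \<Gamma> C k = svd_barcode \<Gamma> (lev C (k + 1)) (lev C k)
       (map_rank \<Gamma> (chains C (k + 1)) (cycles C k) (bd C (k + 1))) ys xs"
    by (rule barcode_svd)
  define r where "r = map_rank \<Gamma> (chains C (k + 1)) (cycles C k) (bd C (k + 1))"
  let ?n = "length xs"
  have frY: "orth_frame \<Gamma> (chains C (k + 1)) (lev C (k + 1)) {..<length ys} ((!) ys)"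
    and frX: "orth_frame \<Gamma> (cycles C k) (lev C k) {..<?n} ((!) xs)"
    and bd: "\<And>i. i < r \<Longrightarrow> bd C (k + 1) (ys ! i) = xs ! i"
    using svd V.orthogonal_basis_iff_orth_frame W.orthogonal_basis_iff_orth_frame
    by (auto simp: is_svd_def Let_def r_def)
  \<comment> \<open>An arbitrary frame of the cycles, from which \<open>svd_frame\<close> yields the
    bounds on the rank.\<close>
  obtain zs :: "'v list" where "orth_frame \<Gamma> (cycles C (k + 1)) (lev C (k + 1)) {..<length zs} ((!) zs)"
    using cycles_frame by blast
  then have r: "r \<le> length ys" "r \<le> ?n"
    using svd_frame(2,3)[OF svd] unfolding ker_bd_eq_cycles r_def by blast+
  define f where "f = (\<lambda>i. (\<Gamma> #>\<^bsub>real_group\<^esub> real_of_ereal (lev C k (xs ! i)),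
      if i < r then lev C (k + 1) (ys ! i) - lev C k (xs ! i) else \<infinity>))"
  have "verbose_barcode \<Gamma> C k = image_mset f (mset_set {..<?n})"
    by (simp add: B svd_barcode_def f_def r_def)
  then obtain \<sigma> where \<sigma>: "bij_betw \<sigma> {..<?n} (bars k)" and fst_\<sigma>: "\<And>i. i < ?n \<Longrightarrow> fst (\<sigma> i) = f i"
    using mset_index_image_bij[of "{..<?n}" f] by auto
  define \<tau> where "\<tau> = the_inv_into {..<?n} \<sigma>"
  have \<tau>: "bij_betw \<tau> (bars k) {..<?n}"
    unfolding \<tau>_def by (rule bij_betw_the_inv_into[OF \<sigma>])
  have \<tau>n: "\<tau> b < ?n" and fst_b: "fst b = f (\<tau> b)" if "b \<in> bars k" for b
  proof -
    show n: "\<tau> b < ?n"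
      using \<tau> that by (auto simp: bij_betw_def)
    have "\<sigma> (\<tau> b) = b"
      unfolding \<tau>_def by (rule f_the_inv_into_f_bij_betw[OF \<sigma>]) (rule that)
    then show "fst b = f (\<tau> b)"
      using fst_\<sigma>[OF n] by simp
  qed
  have x: "xs ! i \<in> carrier (cycles C k)" "\<bar>lev C k (xs ! i)\<bar> \<noteq> \<infinity>" if "i < ?n" for i
  proof -
    show *: "xs ! i \<in> carrier (cycles C k)"
      using that W.frame_carrier[OF frX] by auto
    show "\<bar>lev C k (xs ! i)\<bar> \<noteq> \<infinity>"
      using that by (intro W.l_finite[OF *] W.frame_nonzero[OF frX]) simp
  qed
  have y: "ys ! i \<in> carrier (chains C (k + 1))" "\<bar>lev C (k + 1) (ys ! i)\<bar> \<noteq> \<infinity>" if "i < r" for i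
  proof -
    show *: "ys ! i \<in> carrier (chains C (k + 1))"
      using that r V.frame_carrier[OF frY] by auto
    show "\<bar>lev C (k + 1) (ys ! i)\<bar> \<noteq> \<infinity>"
      using that r by (intro V.l_finite[OF *] V.frame_nonzero[OF frY]) simp
  qed
  \<comment> \<open>A bar is finite exactly when its position is below the rank: there it is a
    difference of two finite levels, and all other positions have length \<infinity>.\<close>
  have fin: "b \<in> finite_bars k \<longleftrightarrow> b \<in> bars k \<and> \<tau> b < r" for b
  proof -
    have "snd (f (\<tau> b)) \<noteq> \<infinity> \<longleftrightarrow> \<tau> b < r" if "b \<in> bars k"
      using x[OF \<tau>n[OF that]] y[of "\<tau> b"] 
      by (cases "lev C k (xs ! \<tau> b)"; cases "lev C (k + 1) (ys ! \<tau> b)") (auto simp: f_def)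
    then show ?thesis
      using fst_b[of b] by (cases "b \<in> bars k") simp_all
  qed
  \<comment> \<open>The excess of the level of the vector over the chosen representative, to be
    removed by \<open>T^g\<close>.\<close>
  define g where "g = (\<lambda>b. real_of_ereal (lev C k (xs ! \<tau> b)) - a b)"
  define s :: "(real set \<times> ereal) \<times> nat \<Rightarrow> real \<Rightarrow> 'k" where "s = (\<lambda>b. novikov_monom (g b))"
  have g: "g b \<in> \<Gamma>" if b: "b \<in> bars k" for b
  proof -
    have "a b \<in> \<Gamma> #>\<^bsub>real_group\<^esub> real_of_ereal (lev C k (xs ! \<tau> b))"
      using a[OF b] fst_b[OF b] by (simp add: f_def)
    then obtain h where h: "h \<in> \<Gamma>" "a b = h + real_of_ereal (lev C k (xs ! \<tau> b))"
      by (auto simp: r_coset_def real_group_def)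
    \<comment> \<open>The exponent \<open>g b\<close> is \<open>- h\<close>. Closure of \<Gamma>
      under the abstract inverse of \<open>real_group\<close> becomes closure under
      negation.\<close>
    have "group real_group"
      by (rule groupI) (auto simp: real_group_def intro: exI[of _ "- x" for x])
    moreover have "inv\<^bsub>real_group\<^esub> h = - h"
      by (rule group.inv_equality[OF \<open>group real_group\<close>]) (auto simp: real_group_def)
    ultimately have "- h \<in> \<Gamma>"
      using subgroup.m_inv_closed[OF sub h(1)] by simp
    then show ?thesis
      using h(2) by (simp add: g_def)
  qed
  have s: "s b \<in> carrier V.K" "s b \<noteq> \<zero>\<^bsub>V.K\<^esub>" "novikov_val (s b) = ereal (g b)" if "b \<in> bars k" for b
    using g[OF that] by (simp_all add: s_def novikov_monom_carrier novikov_monom_nonzero novikov_val_monom)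
  define X where "X = (\<lambda>b. s b \<odot>\<^bsub>cycles C k\<^esub> xs ! \<tau> b)"
  \<comment> \<open>The scalar is the one used for \<open>X\<close>: the boundary still takes
    \<open>Y b\<close> to \<open>X b\<close>, and both levels drop by \<open>g b\<close>, so the
    length of the bar is preserved.\<close>
  define Y where "Y = (\<lambda>b. s b \<odot>\<^bsub>chains C (k + 1)\<^esub> ys ! \<tau> b)"
  have frX': "orth_frame \<Gamma> (cycles C k) (lev C k) (bars k) X"
    unfolding X_def by (rule W.frame_scale[OF W.frame_reindex[OF frX \<tau>]]) (use s in auto)
  have levX: "lev C k (X b) = ereal (a b)" if b: "b \<in> bars k" for b
    using x[OF \<tau>n[OF b]] s[OF b] W.l_smult[of "s b" "xs ! \<tau> b"]
    by (cases "lev C k (xs ! \<tau> b)") (auto simp: X_def g_def)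
  have Yb: "Y b \<in> carrier (chains C (k + 1))" "bd C (k + 1) (Y b) = X b"
      "lev C (k + 1) (Y b) = ereal (a b) + snd (fst b)" if b: "b \<in> finite_bars k" for b
  proof -
    have b': "b \<in> bars k" "\<tau> b < r"
      using b fin by auto
    note y' = y[OF b'(2)] and x' = x[OF \<tau>n[OF b'(1)]] and s' = s[OF b'(1)]
    show "Y b \<in> carrier (chains C (k + 1))"
      unfolding Y_def using y' s' by simp
    show "bd C (k + 1) (Y b) = X b"
      unfolding Y_def X_def using y' s' bd[OF b'(2)] by simp
    have "lev C (k + 1) (Y b) = lev C (k + 1) (ys ! \<tau> b) - ereal (g b)"
      unfolding Y_def using y' s' by (simp add: V.l_smult)
    then show "lev C (k + 1) (Y b) = ereal (a b) + snd (fst b)"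
      using y' x' b'(2) unfolding fst_b[OF b'(1)]
      by (cases "lev C k (xs ! \<tau> b)"; cases "lev C (k + 1) (ys ! \<tau> b)") (auto simp: f_def g_def)
  qed
  have ext: "orth_frame \<Gamma> (chains C (k + 1)) (lev C (k + 1)) (bars (k + 1) <+> finite_bars k) (case_sum Z Y)"
    if Z: "orth_frame \<Gamma> (cycles C (k + 1)) (lev C (k + 1)) (bars (k + 1)) Z" for Z
  proof -
    have fr: "orth_frame \<Gamma> (chains C (k + 1)) (lev C (k + 1)) ({..<r} <+> bars (k + 1)) (case_sum ((!) ys) Z)"
      unfolding r_def by (rule svd_frame(1)[OF svd]) (unfold ker_bd_eq_cycles, rule Z)
    let ?\<rho> = "case_sum (\<lambda>b. Inr b) (\<lambda>b. Inl (\<tau> b)) :: _ \<Rightarrow> nat + _"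
    have "bij_betw ?\<rho> (bars (k + 1) <+> finite_bars k) ({..<r} <+> bars (k + 1))"
    proof (rule bij_betw_case_sum_swap)
      have "bij_betw \<tau> (finite_bars k) (\<tau> ` finite_bars k)"
        by (rule bij_betw_subset[OF \<tau>]) auto
      moreover have "\<tau> ` finite_bars k = {..<r}"
      proof
        show "\<tau> ` finite_bars k \<subseteq> {..<r}"
          using fin by blast
        show "{..<r} \<subseteq> \<tau> ` finite_bars k"
        proof
          fix i assume "i \<in> {..<r}"
          then have "i < r" "i \<in> \<tau> ` bars k"
            using r bij_betw_imp_surj_on[OF \<tau>] by auto
          then show "i \<in> \<tau> ` finite_bars k"
            using fin by blast
        qed
      qed
      ultimately show "bij_betw \<tau> (finite_bars k) {..<r}"
        by simp
    qed (simp add: bij_betw_def)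
    note fr' = V.frame_reindex[OF fr this]
    \<comment> \<open>The vectors of \<open>Z\<close> keep scalar 1; only the vectors of
      \<open>ys\<close> are rescaled, to become \<open>Y\<close>.\<close>
    have "case_sum (\<lambda>_. \<one>\<^bsub>V.K\<^esub>) s \<in> bars (k + 1) <+> finite_bars k \<rightarrow> carrier V.K - {\<zero>\<^bsub>V.K\<^esub>}"
    proof
      fix u assume "u \<in> bars (k + 1) <+> finite_bars k"
      then show "case_sum (\<lambda>_. \<one>\<^bsub>V.K\<^esub>) s u \<in> carrier V.K - {\<zero>\<^bsub>V.K\<^esub>}"
        by (elim PlusE) (simp_all add: s)
    qed
    from V.frame_scale[OF fr' this] show ?thesis
    proof (rule V.frame_cong)
      have Zc: "Z b \<in> carrier (chains C (k + 1))" if "b \<in> bars (k + 1)" for b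
        using nonarch_normed_space.frame_carrier[OF nonarch_cycles Z] that by (auto simp: carrier_cycles)
      fix u assume "u \<in> bars (k + 1) <+> finite_bars k"
      then show "case_sum Z Y u = case_sum (\<lambda>_. \<one>\<^bsub>V.K\<^esub>) s u \<odot>\<^bsub>chains C (k + 1)\<^esub> case_sum ((!) ys) Z (?\<rho> u)"
        by (elim PlusE) (simp_all add: Y_def Zc)
    qed
  qed
  show ?thesis
  proof (rule exI[of _ X], rule exI[of _ Y], intro conjI)
    show "orth_frame \<Gamma> (cycles C k) (lev C k) (bars k) X"
      by (rule frX')
    show "\<forall>b\<in>bars k. lev C k (X b) = ereal (a b)"
      by (rule ballI) (rule levX)
    show "\<forall>b\<in>finite_bars k. Y b \<in> carrier (chains C (k + 1)) \<and> bd C (k + 1) (Y b) = X b \<and>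
        lev C (k + 1) (Y b) = ereal (a b) + snd (fst b)"
      by (rule ballI) (intro conjI Yb)
    show "\<forall>Z. orth_frame \<Gamma> (cycles C (k + 1)) (lev C (k + 1)) (bars (k + 1)) Z \<longrightarrow>
        orth_frame \<Gamma> (chains C (k + 1)) (lev C (k + 1)) (bars (k + 1) <+> finite_bars k) (case_sum Z Y)"
      by (intro allI impI) (rule ext)
  qed
qed

end

section \<open>Direct sums and elementary complexes\<close>

text \<open>The laws hold componentwise. Only finiteness of supports needs an argument: the support
  of a sum lies in the union of the two supports.\<close>

lemma module_direct_sum_vectorspace:
  fixes M :: "'i \<Rightarrow> ('r, 'v) module"
  assumes K: "field (K :: ('r, 'd) ring_scheme)" and M: "\<And>i. i \<in> I \<Longrightarrow> vectorspace K (M i)"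
  shows "vectorspace K (module_direct_sum I M)"
proof -
  interpret K: field K by (rule K)
  have mod: "module K (M i)" and grp: "abelian_group (M i)" if "i \<in> I" for i
    using M[OF that] by (auto simp: vectorspace_def module_def)
  note simps[simp] = 
    module.smult_closed[OF mod] module.smult_l_distr[OF mod] module.smult_r_distr[OF mod]
    module.smult_assoc1[OF mod] module.smult_one[OF mod] module.smult_r_null[OF mod]
    abelian_monoid.a_closed[OF abelian_group.axioms(1)[OF grp]]
    abelian_monoid.zero_closed[OF abelian_group.axioms(1)[OF grp]]
    abelian_monoid.r_zero[OF abelian_group.axioms(1)[OF grp]]
    abelian_monoid.a_assoc[OF abelian_group.axioms(1)[OF grp]]
    abelian_group.a_inv_closed[OF grp] abelian_group.r_neg[OF grp]
  have comm: "x \<oplus>\<^bsub>M i\<^esub> y = y \<oplus>\<^bsub>M i\<^esub> x" if "i \<in> I" "x \<in> carrier (M i)" "y \<in> carrier (M i)" for i x y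
    using abelian_monoid.a_comm[OF abelian_group.axioms(1)[OF grp]] that by blast
  let ?D = "module_direct_sum I M"
  have carrier: "x \<in> carrier ?D \<longleftrightarrow> x \<in> extensional I \<and> (\<forall>i\<in>I. x i \<in> carrier (M i)) \<and> finite {i\<in>I. x i \<noteq> \<zero>\<^bsub>M i\<^esub>}" for x
    by (auto simp: module_direct_sum_def PiE_def)
  have ops: "\<zero>\<^bsub>?D\<^esub> = (\<lambda>i\<in>I. \<zero>\<^bsub>M i\<^esub>)" "x \<oplus>\<^bsub>?D\<^esub> y = (\<lambda>i\<in>I. x i \<oplus>\<^bsub>M i\<^esub> y i)"
    "c \<odot>\<^bsub>?D\<^esub> x = (\<lambda>i\<in>I. c \<odot>\<^bsub>M i\<^esub> x i)" for x y c
    by (simp_all add: module_direct_sum_def)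
  have fin: "finite {i \<in> I. (\<lambda>i\<in>I. f i) i \<noteq> \<zero>\<^bsub>M i\<^esub>}"
    if "finite A" "\<And>i. i \<in> I \<Longrightarrow> i \<notin> A \<Longrightarrow> f i = \<zero>\<^bsub>M i\<^esub>" for f A
    by (rule finite_subset[OF _ that(1)]) (use that(2) in auto)
  have ext: "x = y" if "x \<in> extensional I" "y \<in> extensional I" "\<And>i. i \<in> I \<Longrightarrow> x i = y i" for x y :: "'i \<Rightarrow> 'v"
    using that by (rule extensionalityI)
  show ?thesis
  proof (rule vs_criteria[OF K]; (intro allI ballI impI)?; (elim conjE)?)
    show "\<zero>\<^bsub>?D\<^esub> \<in> carrier ?D"
      unfolding carrier ops by (simp cong: conj_cong)
  next
    fix v w assume "v \<in> carrier ?D" "w \<in> carrier ?D"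
    then have vw: "v \<in> extensional I" "w \<in> extensional I" "\<forall>i\<in>I. v i \<in> carrier (M i)" "\<forall>i\<in>I. w i \<in> carrier (M i)"
      and f: "finite ({i \<in> I. v i \<noteq> \<zero>\<^bsub>M i\<^esub>} \<union> {i \<in> I. w i \<noteq> \<zero>\<^bsub>M i\<^esub>})"
      unfolding carrier by auto
    show "v \<oplus>\<^bsub>?D\<^esub> w \<in> carrier ?D"
      unfolding carrier ops using vw fin[OF f, of "\<lambda>i. v i \<oplus>\<^bsub>M i\<^esub> w i"] by auto
    show "v \<oplus>\<^bsub>?D\<^esub> w = w \<oplus>\<^bsub>?D\<^esub> v"
      unfolding ops by (rule ext) (use vw comm in auto)
    fix c assume "c \<in> carrier K"
    then show "c \<odot>\<^bsub>?D\<^esub> (v \<oplus>\<^bsub>?D\<^esub> w) = c \<odot>\<^bsub>?D\<^esub> v \<oplus>\<^bsub>?D\<^esub> c \<odot>\<^bsub>?D\<^esub> w"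
      unfolding ops by (intro ext) (use vw in auto)
  next
    fix v w z assume "v \<in> carrier ?D" "w \<in> carrier ?D" "z \<in> carrier ?D"
    then show "(v \<oplus>\<^bsub>?D\<^esub> w) \<oplus>\<^bsub>?D\<^esub> z = v \<oplus>\<^bsub>?D\<^esub> (w \<oplus>\<^bsub>?D\<^esub> z)"
      unfolding ops carrier by (intro ext) auto
  next
    fix v assume "v \<in> carrier ?D"
    then have v: "v \<in> extensional I" "\<forall>i\<in>I. v i \<in> carrier (M i)" 
      and f: "finite {i \<in> I. v i \<noteq> \<zero>\<^bsub>M i\<^esub>}"
      unfolding carrier by auto
    have inv0: "\<ominus>\<^bsub>M i\<^esub> \<zero>\<^bsub>M i\<^esub> = \<zero>\<^bsub>M i\<^esub>" if "i \<in> I" for i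
      using abelian_group.minus_equality[OF grp[OF that], of "\<zero>\<^bsub>M i\<^esub>" "\<zero>\<^bsub>M i\<^esub>"] that by simp
    show "\<exists>neg_v\<in>carrier ?D. v \<oplus>\<^bsub>?D\<^esub> neg_v = \<zero>\<^bsub>?D\<^esub>"
    proof (rule bexI[of _ "\<lambda>i\<in>I. \<ominus>\<^bsub>M i\<^esub> v i"])
      show "v \<oplus>\<^bsub>?D\<^esub> (\<lambda>i\<in>I. \<ominus>\<^bsub>M i\<^esub> v i) = \<zero>\<^bsub>?D\<^esub>"
        unfolding ops by (rule ext) (use v in auto)
      show "(\<lambda>i\<in>I. \<ominus>\<^bsub>M i\<^esub> v i) \<in> carrier ?D"
        unfolding carrier using v fin[OF f, of "\<lambda>i. \<ominus>\<^bsub>M i\<^esub> v i"] inv0 by auto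
    qed
    show "v \<oplus>\<^bsub>?D\<^esub> \<zero>\<^bsub>?D\<^esub> = v" "\<one>\<^bsub>K\<^esub> \<odot>\<^bsub>?D\<^esub> v = v"
      unfolding ops by (rule ext; use v in auto)+
    fix c assume c: "c \<in> carrier K"
    then show "c \<odot>\<^bsub>?D\<^esub> v \<in> carrier ?D"
      unfolding carrier ops using v fin[OF f, of "\<lambda>i. c \<odot>\<^bsub>M i\<^esub> v i"] by auto
    fix b assume "b \<in> carrier K"
    note bc = this c
    show "(b \<otimes>\<^bsub>K\<^esub> c) \<odot>\<^bsub>?D\<^esub> v = b \<odot>\<^bsub>?D\<^esub> (c \<odot>\<^bsub>?D\<^esub> v)"
      "(b \<oplus>\<^bsub>K\<^esub> c) \<odot>\<^bsub>?D\<^esub> v = b \<odot>\<^bsub>?D\<^esub> v \<oplus>\<^bsub>?D\<^esub> c \<odot>\<^bsub>?D\<^esub> v"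
      unfolding ops by (rule ext; use v bc in auto)+
  qed
qed

lemma elementary_complex_vectorspace:
  assumes "field (novikov_field \<Gamma> :: (real \<Rightarrow> 'k::field) ring)"
  shows "vectorspace (novikov_field \<Gamma> :: (real \<Rightarrow> 'k) ring) (chains (elementary_complex \<Gamma> a L k) m)"
proof -
  interpret K: field "novikov_field \<Gamma> :: (real \<Rightarrow> 'k) ring" by (rule assms)
  let ?E = "chains (elementary_complex \<Gamma> a L k) m :: (_, (real \<Rightarrow> 'k) \<times> _) module"
  show ?thesis
  proof (rule vs_criteria[OF assms])
    show "\<forall>v\<in>carrier ?E. \<exists>neg_v\<in>carrier ?E. v \<oplus>\<^bsub>?E\<^esub> neg_v = \<zero>\<^bsub>?E\<^esub>"
    proof
      fix v assume "v \<in> carrier ?E"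
      then show "\<exists>neg_v\<in>carrier ?E. v \<oplus>\<^bsub>?E\<^esub> neg_v = \<zero>\<^bsub>?E\<^esub>"
        by (intro bexI[of _ "(\<ominus>\<^bsub>novikov_field \<Gamma>\<^esub> fst v, \<ominus>\<^bsub>novikov_field \<Gamma>\<^esub> snd v)"])
           (auto simp: elementary_complex_def K.r_neg)
    qed
  qed (auto simp: elementary_complex_def K.a_ac K.m_assoc K.r_distr K.l_distr)
qed

text \<open>Lets the isomorphism be given from the barcode complex to \<open>C\<close>. The inverse
  undoes the map only on carriers, hence the assumption that \<open>bd D\<close> stays inside
  them.\<close>

lemma filtered_isomorphic_sym:
  assumes "filtered_isomorphic \<Gamma> D C"
    and bd: "\<And>k x. x \<in> carrier (chains D k) \<Longrightarrow> bd D k x \<in> carrier (chains D (k - 1))"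
  shows "filtered_isomorphic \<Gamma> C D"
proof -
  obtain \<Psi> where lin: "\<And>k. linear_map (novikov_field \<Gamma>) (chains D k) (chains C k) (\<Psi> k)"
    and bij: "\<And>k. bij_betw (\<Psi> k) (carrier (chains D k)) (carrier (chains C k))"
    and chain: "\<And>k x. x \<in> carrier (chains D k) \<Longrightarrow> \<Psi> (k - 1) (bd D k x) = bd C k (\<Psi> k x)"
    and lev: "\<And>k x. x \<in> carrier (chains D k) \<Longrightarrow> lev C k (\<Psi> k x) = lev D k x"
    using assms(1) unfolding filtered_isomorphic_def by metis
  define \<Phi> where "\<Phi> = (\<lambda>k. the_inv_into (carrier (chains D k)) (\<Psi> k))"
  have \<Phi>\<Psi>: "\<Phi> k (\<Psi> k x) = x" if "x \<in> carrier (chains D k)" for k x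
    using that bij[of k] by (simp add: \<Phi>_def the_inv_into_f_f bij_betw_def)
  have \<Phi>bij: "bij_betw (\<Phi> k) (carrier (chains C k)) (carrier (chains D k))" for k
    unfolding \<Phi>_def by (rule bij_betw_the_inv_into[OF bij])
  have obt: "\<exists>y\<in>carrier (chains D k). x = \<Psi> k y" if "x \<in> carrier (chains C k)" for k x
    using that bij[of k] by (auto simp: bij_betw_def)
  have "linear_map (novikov_field \<Gamma>) (chains C k) (chains D k) (\<Phi> k)" for k
  proof -
    interpret P: linear_map "novikov_field \<Gamma>" "chains D k" "chains C k" "\<Psi> k"
      by (rule lin)
    have "\<Phi> k \<in> module_hom (novikov_field \<Gamma>) (chains C k) (chains D k)"
      unfolding module_hom_def
    proof (intro CollectI conjI allI impI; (elim conjE)?)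
      show "\<Phi> k \<in> carrier (chains C k) \<rightarrow> carrier (chains D k)"
        using \<Phi>bij by (rule bij_betw_imp_funcset)
      fix x assume "x \<in> carrier (chains C k)"
      then obtain x' where x: "x' \<in> carrier (chains D k)" "x = \<Psi> k x'"
        using obt by blast
      show "\<Phi> k (c \<odot>\<^bsub>chains C k\<^esub> x) = c \<odot>\<^bsub>chains D k\<^esub> \<Phi> k x" if "c \<in> carrier (novikov_field \<Gamma>)" for c
        using x that \<Phi>\<Psi>[of "c \<odot>\<^bsub>chains D k\<^esub> x'" k] \<Phi>\<Psi>[of x' k] by simp
      fix y assume "y \<in> carrier (chains C k)"
      then obtain y' where y: "y' \<in> carrier (chains D k)" "y = \<Psi> k y'"
        using obt by blast
      show "\<Phi> k (x \<oplus>\<^bsub>chains C k\<^esub> y) = \<Phi> k x \<oplus>\<^bsub>chains D k\<^esub> \<Phi> k y"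
        using x y \<Phi>\<Psi>[of "x' \<oplus>\<^bsub>chains D k\<^esub> y'" k] \<Phi>\<Psi>[of x' k] \<Phi>\<Psi>[of y' k] by simp
    qed
    then show ?thesis
      using lin[of k] by (simp add: linear_map_def mod_hom_def mod_hom_axioms_def)
  qed
  moreover have "\<Phi> (k - 1) (bd C k x) = bd D k (\<Phi> k x) \<and> lev D k (\<Phi> k x) = lev C k x"
    if x: "x \<in> carrier (chains C k)" for k x
  proof -
    obtain y where y: "y \<in> carrier (chains D k)" "x = \<Psi> k y"
      using obt[OF x] by blast
    have "\<Phi> (k - 1) (bd C k x) = \<Phi> (k - 1) (\<Psi> (k - 1) (bd D k y))"
      using y chain by simp
    also have "\<dots> = bd D k y"
      by (rule \<Phi>\<Psi>[OF bd[OF y(1)]])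
    finally show ?thesis
      using y lev \<Phi>\<Psi>[OF y(1)] by simp
  qed
  ultimately show ?thesis
    unfolding filtered_isomorphic_def using \<Phi>bij by blast
qed

section \<open>The isomorphism with the barcode complex\<close>

lemma chains_complex_direct_sum:
  "chains (complex_direct_sum I C) k = module_direct_sum I (\<lambda>i. chains (C i) k)"
  by (simp add: complex_direct_sum_def)

lemma carrier_complex_direct_sum:
  "x \<in> carrier (chains (complex_direct_sum I C) m) \<longleftrightarrow>
    x \<in> extensional I \<and> (\<forall>i\<in>I. x i \<in> carrier (chains (C i) m)) \<and>
    finite {i \<in> I. x i \<noteq> \<zero>\<^bsub>chains (C i) m\<^esub>}"
  by (auto simp: chains_complex_direct_sum module_direct_sum_def PiE_def)

lemma carrier_elementary_complex:
  "u \<in> carrier (chains (elementary_complex \<Gamma> a L k) m) \<longleftrightarrow>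
     fst u \<in> carrier (novikov_field \<Gamma>) \<and> snd u \<in> carrier (novikov_field \<Gamma>) \<and>
     (m \<noteq> k \<longrightarrow> fst u = \<zero>\<^bsub>novikov_field \<Gamma>\<^esub>) \<and>
     (m \<noteq> k + 1 \<or> L = \<infinity> \<longrightarrow> snd u = \<zero>\<^bsub>novikov_field \<Gamma>\<^esub>)"
  by (auto simp: elementary_complex_def split: prod.splits)

text \<open>Generators chosen for all degrees at once. The frame mixes degrees: in degree
  \<open>k + 1\<close>, the \<open>X\<close> of the bars of degree \<open>k + 1\<close> stand beside
  the \<open>Y\<close> of the finite bars of degree \<open>k\<close>.\<close>

locale floer_generators = floer \<Gamma> C
  for \<Gamma> :: "real set" and C :: "(real \<Rightarrow> 'k::field, 'v) filtered_complex" +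
  fixes a :: "int \<Rightarrow> (real set \<times> ereal) \<times> nat \<Rightarrow> real"
    and X Y :: "int \<Rightarrow> (real set \<times> ereal) \<times> nat \<Rightarrow> 'v"
  assumes X: "b \<in> bars k \<Longrightarrow> X k b \<in> carrier (cycles C k)"
    and lev_X: "b \<in> bars k \<Longrightarrow> lev C k (X k b) = ereal (a k b)"
    and bd_Y: "b \<in> finite_bars k \<Longrightarrow> bd C (k + 1) (Y k b) = X k b"
    and lev_Y: "b \<in> finite_bars k \<Longrightarrow> lev C (k + 1) (Y k b) = ereal (a k b) + snd (fst b)"
    and frame: "orth_frame \<Gamma> (chains C (k + 1)) (lev C (k + 1)) (bars (k + 1) <+> finite_bars k)
                  (case_sum (X (k + 1)) (Y k))"
begin

abbreviation K :: "(real \<Rightarrow> 'k) ring" where "K \<equiv> novikov_field \<Gamma>"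

abbreviation bar_complex ::
    "int \<Rightarrow> (real set \<times> ereal) \<times> nat \<Rightarrow> (real \<Rightarrow> 'k, (real \<Rightarrow> 'k) \<times> (real \<Rightarrow> 'k)) filtered_complex" where
  "bar_complex k b \<equiv> elementary_complex \<Gamma> (a k b) (snd (fst b)) k"

abbreviation barcode_complex where
  "barcode_complex \<equiv> complex_direct_sum UNIV (\<lambda>k. complex_direct_sum (bars k) (bar_complex k))"

definition gen_index where "gen_index m = bars m <+> finite_bars (m - 1)"

definition gen where "gen m = case_sum (X m) (Y (m - 1))"

text \<open>In degree \<open>m\<close>, a summand coming from a bar of degree \<open>m\<close> has
  only its \<open>x\<close>-coefficient, one from a bar of degree \<open>m - 1\<close> only its
  \<open>y\<close>-coefficient. These are all the components that can be nonzero.\<close>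

definition coords :: "int \<Rightarrow> (int \<Rightarrow> (real set \<times> ereal) \<times> nat \<Rightarrow> (real \<Rightarrow> 'k) \<times> (real \<Rightarrow> 'k)) \<Rightarrow>
    ((real set \<times> ereal) \<times> nat) + ((real set \<times> ereal) \<times> nat) \<Rightarrow> real \<Rightarrow> 'k" where
  "coords m x = case_sum (\<lambda>b. fst (x m b)) (\<lambda>b. snd (x (m - 1) b))"

definition realize where
  "realize m x = (\<Oplus>\<^bsub>chains C m\<^esub>s\<in>gen_index m. coords m x s \<odot>\<^bsub>chains C m\<^esub> gen m s)"

lemma gen_frame: "orth_frame \<Gamma> (chains C m) (lev C m) (gen_index m) (gen m)"
  using frame[of "m - 1"] by (simp add: gen_index_def gen_def)

lemma field_K: "field K"
  using nonarch_chains[of 0] by (simp add: nonarch_normed_space_def vectorspace_def)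

lemma vectorspace_chains: "vectorspace K (chains C m)"
  using nonarch_chains by (simp add: nonarch_normed_space_def)

lemma vectorspace_barcode_complex: "vectorspace K (chains barcode_complex m)"
  unfolding chains_complex_direct_sum
  by (intro module_direct_sum_vectorspace elementary_complex_vectorspace field_K)

lemma gen_index_Inl: "Inl b \<in> gen_index m \<longleftrightarrow> b \<in> bars m"
  and gen_index_Inr: "Inr b \<in> gen_index m \<longleftrightarrow> b \<in> bars (m - 1) \<and> snd (fst b) \<noteq> \<infinity>"
  by (auto simp: gen_index_def)

lemma Y_carrier:
  assumes "b \<in> finite_bars k"
  shows "Y k b \<in> carrier (chains C (k + 1))"
proof -
  have "case_sum (X (k + 1)) (Y k) (Inr b) \<in> carrier (chains C (k + 1))"
    by (rule funcset_mem[OF nonarch_normed_space.frame_carrier[OF nonarch_chains frame]])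
       (rule InrI[OF assms])
  then show ?thesis
    by simp
qed

lemma gen_index_cases:
  assumes "s \<in> gen_index m"
  obtains b where "s = Inl b" "b \<in> bars m" 
  | b where "s = Inr b" "b \<in> bars (m - 1)" "snd (fst b) \<noteq> \<infinity>"
  using assms by (cases s) (simp_all add: gen_index_Inl gen_index_Inr)

text \<open>Finite support is automatic: in degree \<open>m\<close> only the summands for
  \<open>m\<close> and \<open>m - 1\<close> are nonzero, and every barcode is finite.\<close>

lemma carrier_barcode_complex:
  "x \<in> carrier (chains barcode_complex m) \<longleftrightarrow>
    (\<forall>k. x k \<in> extensional (bars k) \<and> (\<forall>b\<in>bars k. x k b \<in> carrier (chains (bar_complex k b) m)))"
  (is "_ \<longleftrightarrow> ?R")
proof
  assume "x \<in> carrier (chains barcode_complex m)"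
  then show ?R
    unfolding carrier_complex_direct_sum by blast
next
  assume R: ?R
  have "x k = \<zero>\<^bsub>chains (complex_direct_sum (bars k) (bar_complex k)) m\<^esub>" if "k \<notin> {m, m - 1}" for k
  proof -
    have "x k b = (\<zero>\<^bsub>K\<^esub>, \<zero>\<^bsub>K\<^esub>)" if "b \<in> bars k" for b
    proof -
      have "x k b \<in> carrier (chains (bar_complex k b) m)"
        using R that by blast
      then show ?thesis
        using \<open>k \<notin> {m, m - 1}\<close> by (intro prod_eqI) (auto simp: carrier_elementary_complex)
    qed
    moreover have "x k \<in> extensional (bars k)"
      using R by blast
    ultimately have "x k = (\<lambda>b\<in>bars k. (\<zero>\<^bsub>K\<^esub>, \<zero>\<^bsub>K\<^esub>))"
      by (intro extensionalityI[where A = "bars k"]) auto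
    then show ?thesis
      by (simp add: chains_complex_direct_sum module_direct_sum_def elementary_complex_def)
  qed
  then have "{k \<in> UNIV. x k \<noteq> \<zero>\<^bsub>chains (complex_direct_sum (bars k) (bar_complex k)) m\<^esub>} \<subseteq> {m, m - 1}"
    by blast
  then have 1: "finite {k \<in> UNIV. x k \<noteq> \<zero>\<^bsub>chains (complex_direct_sum (bars k) (bar_complex k)) m\<^esub>}"
    by (rule finite_subset) simp
  have 2: "x k \<in> carrier (chains (complex_direct_sum (bars k) (bar_complex k)) m)" for k
    unfolding carrier_complex_direct_sum
  proof (intro conjI ballI)
    show "finite {b \<in> bars k. x k b \<noteq> \<zero>\<^bsub>chains (bar_complex k b) m\<^esub>}"
      by (rule finite_subset[OF _ finite_mset_index]) blast
  qed (use R in blast)+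
  show "x \<in> carrier (chains barcode_complex m)"
    unfolding carrier_complex_direct_sum[of _ UNIV] by (intro conjI ballI 1 2) simp
qed

context
  fixes m x
  assumes x: "x \<in> carrier (chains barcode_complex m)"
begin

lemma barcode_complex_component:
  assumes "b \<in> bars k"
  shows "fst (x k b) \<in> carrier K" "snd (x k b) \<in> carrier K"
    and "k \<noteq> m \<Longrightarrow> fst (x k b) = \<zero>\<^bsub>K\<^esub>"
    and "k \<noteq> m - 1 \<or> snd (fst b) = \<infinity> \<Longrightarrow> snd (x k b) = \<zero>\<^bsub>K\<^esub>"
proof -
  have "x k b \<in> carrier (chains (bar_complex k b) m)"
    using x assms unfolding carrier_barcode_complex by blast
  then show "fst (x k b) \<in> carrier K" "snd (x k b) \<in> carrier K"
    and "k \<noteq> m \<Longrightarrow> fst (x k b) = \<zero>\<^bsub>K\<^esub>"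
    and "k \<noteq> m - 1 \<or> snd (fst b) = \<infinity> \<Longrightarrow> snd (x k b) = \<zero>\<^bsub>K\<^esub>"
    unfolding carrier_elementary_complex by auto
qed

lemma coords_carrier: "coords m x \<in> gen_index m \<rightarrow> carrier K"
proof
  fix s assume "s \<in> gen_index m"
  then show "coords m x s \<in> carrier K"
    by (cases rule: gen_index_cases) (simp_all add: coords_def barcode_complex_component)
qed

lemma realize_carrier: "realize m x \<in> carrier (chains C m)"
proof -
  interpret V: nonarch_normed_space \<Gamma> "chains C m" "lev C m"
    by (rule nonarch_chains)
  show ?thesis
    unfolding realize_def by (rule V.lc_closed[OF coords_carrier V.frame_carrier[OF gen_frame]])
qed

text \<open>By orthogonality the level of the realized vector is a maximum over generators, and its
  terms recur in the nested suprema of the direct sum. The other terms there belong to zero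
  coefficients and equal -\<infinity>.\<close>

lemma lev_realize: "lev C m (realize m x) = lev barcode_complex m x"
proof -
  interpret V: nonarch_normed_space \<Gamma> "chains C m" "lev C m"
    by (rule nonarch_chains)
  have gen: "s \<in> gen_index m \<Longrightarrow> gen m s \<in> carrier (chains C m)" for s
    using V.frame_carrier[OF gen_frame] by auto
  have lev_D: "lev barcode_complex m x = (SUP k. SUP b\<in>bars k. lev (bar_complex k b) m (x k b))"
    by (simp add: complex_direct_sum_def)
  have lev_E: "lev (bar_complex k b) m u = (if snd (fst b) = \<infinity> then ereal (a k b) - novikov_val (fst u)
      else max (ereal (a k b) - novikov_val (fst u)) (ereal (a k b) + snd (fst b) - novikov_val (snd u)))" for k b u
    by (simp add: elementary_complex_def split: prod.splits)
  have Inl: "lev C m (coords m x (Inl b) \<odot>\<^bsub>chains C m\<^esub> gen m (Inl b)) = ereal (a m b) - novikov_val (fst (x m b))"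
    if "b \<in> bars m" for b
    using that gen[of "Inl b"] barcode_complex_component(1)[OF that]
    by (simp add: coords_def gen_def gen_index_Inl V.l_smult lev_X)
  have Inr: "lev C m (coords m x (Inr b) \<odot>\<^bsub>chains C m\<^esub> gen m (Inr b)) =
      ereal (a (m - 1) b) + snd (fst b) - novikov_val (snd (x (m - 1) b))"
    if "b \<in> bars (m - 1)" "snd (fst b) \<noteq> \<infinity>" for b
    using that gen[of "Inr b"] barcode_complex_component(2)[OF that(1)] lev_Y[of b "m - 1"]
    by (simp add: coords_def gen_def gen_index_Inr V.l_smult)
  have "lev C m (realize m x) = (SUP s\<in>gen_index m. lev C m (coords m x s \<odot>\<^bsub>chains C m\<^esub> gen m s))"
    unfolding realize_def by (rule V.frame_level[OF gen_frame coords_carrier])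
  also have "\<dots> = (SUP k. SUP b\<in>bars k. lev (bar_complex k b) m (x k b))" (is "?l = ?r")
  proof (rule antisym)
    show "?l \<le> ?r"
    proof (rule SUP_least)
      fix s assume "s \<in> gen_index m"
      then show "lev C m (coords m x s \<odot>\<^bsub>chains C m\<^esub> gen m s) \<le> ?r"
      proof (cases rule: gen_index_cases)
        case (1 b)
        have "lev C m (coords m x s \<odot>\<^bsub>chains C m\<^esub> gen m s) \<le> lev (bar_complex m b) m (x m b)"
          unfolding 1(1) Inl[OF 1(2)] lev_E by simp
        also have "\<dots> \<le> (SUP b\<in>bars m. lev (bar_complex m b) m (x m b))"
          by (rule SUP_upper[OF 1(2)])
        also have "\<dots> \<le> ?r"
          by (rule SUP_upper[where i = m]) simp
        finally show ?thesis .
      next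
        case (2 b)
        have "lev C m (coords m x s \<odot>\<^bsub>chains C m\<^esub> gen m s) \<le> lev (bar_complex (m - 1) b) m (x (m - 1) b)"
          unfolding 2(1) Inr[OF 2(2,3)] lev_E using 2(3) by simp
        also have "\<dots> \<le> (SUP b\<in>bars (m - 1). lev (bar_complex (m - 1) b) m (x (m - 1) b))"
          by (rule SUP_upper[OF 2(2)])
        also have "\<dots> \<le> ?r"
          by (rule SUP_upper[where i = "m - 1"]) simp
        finally show ?thesis .
      qed
    qed
    show "?r \<le> ?l"
    proof (intro SUP_least)
      fix k b assume b: "b \<in> bars k"
      have 1: "ereal (a k b) - novikov_val (fst (x k b)) \<le> ?l"
      proof (cases "k = m")
        case True
        have "lev C m (coords m x (Inl b) \<odot>\<^bsub>chains C m\<^esub> gen m (Inl b)) \<le> ?l"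
          by (rule SUP_upper) (use b True in \<open>simp add: gen_index_Inl\<close>)
        then show ?thesis
          using Inl[of b] b True by simp
      next
        case False
        then show ?thesis
          using barcode_complex_component(3)[OF b] by (simp add: novikov_val_zero)
      qed
      \<comment> \<open>Finiteness of the bar matters: in \<open>ereal\<close>, \<infinity> -
        \<infinity> is \<infinity>, so the absent \<open>y\<close> of an infinite bar would
        contribute \<infinity> instead of -\<infinity>.\<close>
      have 2: "ereal (a k b) + snd (fst b) - novikov_val (snd (x k b)) \<le> ?l" if L: "snd (fst b) \<noteq> \<infinity>"
      proof (cases "k = m - 1")
        case True
        have "lev C m (coords m x (Inr b) \<odot>\<^bsub>chains C m\<^esub> gen m (Inr b)) \<le> ?l"
          by (rule SUP_upper) (use b True L in \<open>simp add: gen_index_Inr\<close>)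
        then show ?thesis
          using Inr[of b] b True L by simp
      next
        case False
        then have "novikov_val (snd (x k b)) = \<infinity>"
          using barcode_complex_component(4)[OF b] by (simp add: novikov_val_zero)
        then show ?thesis
          using L by (cases "snd (fst b)") simp_all
      qed
      show "lev (bar_complex k b) m (x k b) \<le> ?l"
        unfolding lev_E using 1 2 by simp
    qed
  qed
  finally show ?thesis
    by (simp add: lev_D)
qed

lemma bd_barcode_complex_carrier: "bd barcode_complex m x \<in> carrier (chains barcode_complex (m - 1))"
  unfolding carrier_barcode_complex
proof (intro allI conjI ballI)
  interpret K: field K by (rule field_K)
  fix k
  show "bd barcode_complex m x k \<in> extensional (bars k)"
    by (simp add: complex_direct_sum_def)
  fix b assume b: "b \<in> bars k"
  then have "bd barcode_complex m x k b = (snd (x k b), \<zero>\<^bsub>K\<^esub>)"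
    by (simp add: complex_direct_sum_def elementary_complex_def split: prod.splits)
  then show "bd barcode_complex m x k b \<in> carrier (chains (bar_complex k b) (m - 1))"
    using barcode_complex_component(2,4)[OF b] by (auto simp: carrier_elementary_complex)
qed

text \<open>Both sides equal the combination of \<open>X (m - 1)\<close> with the second components
  as coefficients: in \<open>C\<close> the boundary kills each \<open>X m b\<close> and takes
  \<open>Y (m - 1) b\<close> to \<open>X (m - 1) b\<close>, while in the barcode complex it moves
  the second component into the first.\<close>

lemma realize_bd: "realize (m - 1) (bd barcode_complex m x) = bd C m (realize m x)"
proof -
  interpret nonarch_linear_map \<Gamma> "chains C m" "lev C m" "chains C (m - 1)" "lev C (m - 1)" "bd C m"
    by (rule map_chains)
  have fin: "finite (bars k)" "finite (finite_bars k)" for k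
    by (simp_all add: finite_mset_index)
  let ?c = "\<lambda>b. fst (x m b)" and ?d = "\<lambda>b. snd (x (m - 1) b)"
  let ?b = "bars (m - 1)" and ?f = "finite_bars (m - 1)"
  have c: "?c \<in> bars m \<rightarrow> carrier V.K" and d: "?d \<in> ?b \<rightarrow> carrier V.K"
    by (simp_all add: Pi_iff barcode_complex_component)
  then have df: "?d \<in> ?f \<rightarrow> carrier V.K"
    by (simp add: Pi_iff)
  have Xm: "X m \<in> bars m \<rightarrow> carrier (chains C m)" and Xm1: "X (m - 1) \<in> ?b \<rightarrow> carrier (chains C (m - 1))"
    using X by (auto simp: carrier_cycles)
  have Ym: "Y (m - 1) \<in> ?f \<rightarrow> carrier (chains C m)"
    using Y_carrier[of _ "m - 1"] by (simp add: Pi_iff)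
  have cd: "coords m x \<in> bars m <+> ?f \<rightarrow> carrier V.K"
    using coords_carrier by (simp add: gen_index_def)
  have "realize m x = V.lc (bars m) ?c (X m) \<oplus>\<^bsub>chains C m\<^esub> V.lc ?f ?d (Y (m - 1))"
    unfolding realize_def gen_index_def gen_def
    using V.lc_Plus[OF fin(1) fin(2) cd Xm Ym] by (simp add: coords_def)
  then have "bd C m (realize m x) =
      W.lc (bars m) ?c (\<lambda>b. bd C m (X m b)) \<oplus>\<^bsub>chains C (m - 1)\<^esub> W.lc ?f ?d (\<lambda>b. bd C m (Y (m - 1) b))"
    using V.lc_closed[OF c Xm] V.lc_closed[OF df Ym] map_lc[OF c Xm] map_lc[OF df Ym] by simp
  also have "W.lc (bars m) ?c (\<lambda>b. bd C m (X m b)) = \<zero>\<^bsub>chains C (m - 1)\<^esub>"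
  proof (rule W.M.add.finprod_one_eqI)
    fix b assume b: "b \<in> bars m"
    then have "bd C m (X m b) = \<zero>\<^bsub>chains C (m - 1)\<^esub>"
      using X[OF b] by (simp add: carrier_cycles)
    then show "?c b \<odot>\<^bsub>chains C (m - 1)\<^esub> bd C m (X m b) = \<zero>\<^bsub>chains C (m - 1)\<^esub>"
      using barcode_complex_component(1)[OF b] by simp
  qed
  also have "W.lc ?f ?d (\<lambda>b. bd C m (Y (m - 1) b)) = W.lc ?f ?d (X (m - 1))"
  proof (rule W.lc_cong[OF refl refl _ df])
    show "bd C m (Y (m - 1) b) = X (m - 1) b" if "b \<in> ?f" for b
      using bd_Y[OF that] by simp
    show "X (m - 1) \<in> ?f \<rightarrow> carrier (chains C (m - 1))"
      using Xm1 by (simp add: Pi_iff)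
  qed
  \<comment> \<open>Infinite bars can join the sum, because their second component is zero.\<close>
  also have "\<dots> = W.lc ?b (\<lambda>b. if b \<in> ?f then ?d b else \<zero>\<^bsub>V.K\<^esub>) (X (m - 1))"
    by (rule W.lc_supset[symmetric, OF fin(1) _ df Xm1]) simp
  also have "\<dots> = W.lc ?b ?d (X (m - 1))"
  proof (rule W.lc_cong[OF refl _ refl d Xm1])
    show "(if b \<in> ?f then ?d b else \<zero>\<^bsub>V.K\<^esub>) = ?d b" if "b \<in> ?b" for b
      using barcode_complex_component(4)[OF that] that by simp
  qed
  also have "\<zero>\<^bsub>chains C (m - 1)\<^esub> \<oplus>\<^bsub>chains C (m - 1)\<^esub> W.lc ?b ?d (X (m - 1)) = W.lc ?b ?d (X (m - 1))"
    using W.lc_closed[OF d Xm1] by simp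
  finally have 1: "bd C m (realize m x) = W.lc ?b ?d (X (m - 1))" .
  let ?y = "bd barcode_complex m x"
  have y: "?y k b = (snd (x k b), \<zero>\<^bsub>K\<^esub>)" if "b \<in> bars k" for k b
    using that by (simp add: complex_direct_sum_def elementary_complex_def split: prod.splits)
  \<comment> \<open>The \<open>Y\<close>-generators in degree \<open>m - 1\<close> belong to bars of
    degree \<open>m - 2\<close>; boundaries in the barcode complex have zero coefficients along
    them.\<close>
  let ?f' = "finite_bars (m - 1 - 1)"
  have Ym1: "Y (m - 1 - 1) \<in> ?f' \<rightarrow> carrier (chains C (m - 1))"
    using Y_carrier[of _ "m - 1 - 1"] by (simp add: Pi_iff)
  have cd': "case_sum ?d (\<lambda>b. \<zero>\<^bsub>V.K\<^esub>) \<in> ?b <+> ?f' \<rightarrow> carrier V.K"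
  proof
    fix s assume "s \<in> ?b <+> ?f'"
    then show "case_sum ?d (\<lambda>b. \<zero>\<^bsub>V.K\<^esub>) s \<in> carrier V.K"
      by (elim PlusE) (simp_all add: barcode_complex_component)
  qed
  have "realize (m - 1) ?y = W.lc (?b <+> ?f') (case_sum ?d (\<lambda>b. \<zero>\<^bsub>V.K\<^esub>)) (gen (m - 1))"
    unfolding realize_def gen_index_def
  proof (rule W.lc_cong[OF refl _ refl cd'])
    show "gen (m - 1) \<in> ?b <+> ?f' \<rightarrow> carrier (chains C (m - 1))"
      using W.frame_carrier[OF gen_frame] by (simp add: gen_index_def)
    fix s assume "s \<in> ?b <+> ?f'"
    then show "coords (m - 1) ?y s = case_sum ?d (\<lambda>b. \<zero>\<^bsub>V.K\<^esub>) s"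
      by (elim PlusE) (simp_all add: coords_def y)
  qed
  also have "\<dots> = W.lc ?b ?d (X (m - 1)) \<oplus>\<^bsub>chains C (m - 1)\<^esub> W.lc ?f' (\<lambda>b. \<zero>\<^bsub>V.K\<^esub>) (Y (m - 1 - 1))"
    unfolding gen_def using W.lc_Plus[OF fin(1) fin(2) cd' Xm1 Ym1] by simp
  also have "W.lc ?f' (\<lambda>b. \<zero>\<^bsub>V.K\<^esub>) (Y (m - 1 - 1)) = \<zero>\<^bsub>chains C (m - 1)\<^esub>"
    by (rule W.lc_zero[OF refl Ym1])
  finally show ?thesis
    using 1 W.lc_closed[OF d Xm1] by simp
qed

end

lemma realize_linear: "linear_map K (chains barcode_complex m) (chains C m) (realize m)"
proof -
  interpret V: nonarch_normed_space \<Gamma> "chains C m" "lev C m"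
    by (rule nonarch_chains)
  interpret D: vectorspace K "chains barcode_complex m"
    by (rule vectorspace_barcode_complex)
  note gc = V.frame_carrier[OF gen_frame]
  have fin: "finite (gen_index m)"
    by (rule V.frame_finite[OF gen_frame])
  have "realize m \<in> module_hom K (chains barcode_complex m) (chains C m)"
    unfolding module_hom_def
  proof (intro CollectI conjI allI impI; (elim conjE)?)
    show "realize m \<in> carrier (chains barcode_complex m) \<rightarrow> carrier (chains C m)"
      using realize_carrier by blast
    fix x assume x: "x \<in> carrier (chains barcode_complex m)"
    note cx = coords_carrier[OF x]
    show "realize m (c \<odot>\<^bsub>chains barcode_complex m\<^esub> x) = c \<odot>\<^bsub>chains C m\<^esub> realize m x"
      if c: "c \<in> carrier K" for c
    proof -
      have "realize m (c \<odot>\<^bsub>chains barcode_complex m\<^esub> x) = V.lc (gen_index m) (\<lambda>s. c \<otimes>\<^bsub>K\<^esub> coords m x s) (gen m)"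
        unfolding realize_def
      proof (rule V.lc_cong[OF refl _ refl _ gc])
        show "(\<lambda>s. c \<otimes>\<^bsub>K\<^esub> coords m x s) \<in> gen_index m \<rightarrow> carrier K"
          using cx c by (simp add: Pi_iff)
        fix s assume "s \<in> gen_index m"
        then show "coords m (c \<odot>\<^bsub>chains barcode_complex m\<^esub> x) s = c \<otimes>\<^bsub>K\<^esub> coords m x s"
          by (cases rule: gen_index_cases)
             (simp_all add: coords_def chains_complex_direct_sum module_direct_sum_def
               elementary_complex_def split: prod.splits)
      qed
      then show ?thesis
        using V.lc_smult[OF fin c cx gc] by (simp add: realize_def)
    qed
    fix y assume y: "y \<in> carrier (chains barcode_complex m)"
    note cy = coords_carrier[OF y]
    have "realize m (x \<oplus>\<^bsub>chains barcode_complex m\<^esub> y) = V.lc (gen_index m) (\<lambda>s. coords m x s \<oplus>\<^bsub>K\<^esub> coords m y s) (gen m)"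
      unfolding realize_def
    proof (rule V.lc_cong[OF refl _ refl _ gc])
      show "(\<lambda>s. coords m x s \<oplus>\<^bsub>K\<^esub> coords m y s) \<in> gen_index m \<rightarrow> carrier K"
        using cx cy by (simp add: Pi_iff)
      fix s assume "s \<in> gen_index m"
      then show "coords m (x \<oplus>\<^bsub>chains barcode_complex m\<^esub> y) s = coords m x s \<oplus>\<^bsub>K\<^esub> coords m y s"
        by (cases rule: gen_index_cases)
           (simp_all add: coords_def chains_complex_direct_sum module_direct_sum_def
             elementary_complex_def split: prod.splits)
    qed
    then show "realize m (x \<oplus>\<^bsub>chains barcode_complex m\<^esub> y) = realize m x \<oplus>\<^bsub>chains C m\<^esub> realize m y"
      using V.lc_add[OF cx cy gc] by (simp add: realize_def)
  qed
  then show ?thesis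
    using vectorspace_barcode_complex vectorspace_chains
    by (simp add: linear_map_def mod_hom_def mod_hom_axioms_def vectorspace_def)
qed

text \<open>Independence of the generators makes all coordinates of a kernel element vanish, and
  with them every component, the rest being zero by degree. Spanning gives surjectivity.\<close>

lemma realize_bij: "bij_betw (realize m) (carrier (chains barcode_complex m)) (carrier (chains C m))"
proof -
  interpret V: nonarch_normed_space \<Gamma> "chains C m" "lev C m"
    by (rule nonarch_chains)
  interpret lin: linear_map K "chains barcode_complex m" "chains C m" "realize m"
    by (rule realize_linear)
  note gc = V.frame_carrier[OF gen_frame]
  let ?D = "chains barcode_complex m"
  have inj: "x = \<zero>\<^bsub>?D\<^esub>" if x: "x \<in> carrier ?D" and eq: "realize m x = \<zero>\<^bsub>chains C m\<^esub>" for x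
  proof -
    have 0: "coords m x s = \<zero>\<^bsub>K\<^esub>" if "s \<in> gen_index m" for s
      using V.frame_independent[OF gen_frame coords_carrier[OF x] _ that] eq by (simp add: realize_def)
    have "x k b = (\<zero>\<^bsub>K\<^esub>, \<zero>\<^bsub>K\<^esub>)" if b: "b \<in> bars k" for k b
    proof (rule prod_eqI)
      show "fst (x k b) = fst (\<zero>\<^bsub>K\<^esub>, \<zero>\<^bsub>K\<^esub>)"
        using 0[of "Inl b"] barcode_complex_component(3)[OF x b] b
        by (cases "k = m") (simp_all add: gen_index_Inl coords_def)
      show "snd (x k b) = snd (\<zero>\<^bsub>K\<^esub>, \<zero>\<^bsub>K\<^esub>)"
        using 0[of "Inr b"] barcode_complex_component(4)[OF x b] b
        by (cases "k = m - 1 \<and> snd (fst b) \<noteq> \<infinity>") (auto simp: gen_index_Inr coords_def)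
    qed
    moreover have "x k \<in> extensional (bars k)" for k
      using x unfolding carrier_barcode_complex by blast
    ultimately have "x k = (\<lambda>b\<in>bars k. (\<zero>\<^bsub>K\<^esub>, \<zero>\<^bsub>K\<^esub>))" for k
      by (intro extensionalityI[where A = "bars k"]) auto
    then show ?thesis
      by (intro ext) (simp add: chains_complex_direct_sum module_direct_sum_def elementary_complex_def)
  qed
  have "inj_on (realize m) (carrier ?D)"
  proof (rule inj_onI)
    fix x y assume xy: "x \<in> carrier ?D" "y \<in> carrier ?D" "realize m x = realize m y"
    then have "realize m (x \<ominus>\<^bsub>?D\<^esub> y) = \<zero>\<^bsub>chains C m\<^esub>"
      using realize_carrier by simp
    then have "x \<ominus>\<^bsub>?D\<^esub> y = \<zero>\<^bsub>?D\<^esub>"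
      using xy by (intro inj) (simp_all add: a_minus_def)
    then show "x = y"
      using xy by simp
  qed
  moreover have "realize m ` carrier ?D = carrier (chains C m)"
  proof
    show "realize m ` carrier ?D \<subseteq> carrier (chains C m)"
      using realize_carrier by blast
    show "carrier (chains C m) \<subseteq> realize m ` carrier ?D"
    proof
      fix v assume "v \<in> carrier (chains C m)"
      then obtain c where c: "c \<in> gen_index m \<rightarrow> carrier K" "v = V.lc (gen_index m) c (gen m)"
        using V.frame_span[OF gen_frame] by blast
      \<comment> \<open>Distributes the coefficients over the summands; the zeros are those dictated
        by the degrees and by the missing \<open>y\<close> of an infinite bar.\<close>
      define x where "x = (\<lambda>k. \<lambda>b\<in>bars k. (if k = m then c (Inl b) else \<zero>\<^bsub>K\<^esub>,
          if k = m - 1 \<and> snd (fst b) \<noteq> \<infinity> then c (Inr b) else \<zero>\<^bsub>K\<^esub>))"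
      have cK: "s \<in> gen_index m \<Longrightarrow> c s \<in> carrier K" for s
        using c(1) by auto
      have "x \<in> carrier ?D"
        unfolding carrier_barcode_complex
      proof (intro allI conjI ballI)
        show "x k \<in> extensional (bars k)" for k
          by (simp add: x_def)
        show "x k b \<in> carrier (chains (bar_complex k b) m)" if "b \<in> bars k" for k b
          using that cK[of "Inl b"] cK[of "Inr b"]
          by (auto simp: x_def carrier_elementary_complex gen_index_Inl gen_index_Inr)
      qed
      moreover have "realize m x = v"
        unfolding realize_def c(2)
      proof (rule V.lc_cong[OF refl _ refl c(1) gc])
        fix s assume "s \<in> gen_index m"
        then show "coords m x s = c s"
          by (cases rule: gen_index_cases) (simp_all add: coords_def x_def)
      qed
      ultimately show "v \<in> realize m ` carrier ?D"
        by blast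
    qed
  qed
  ultimately show ?thesis
    by (simp add: bij_betw_def)
qed

lemma isomorphic_barcode_complex: "filtered_isomorphic \<Gamma> C barcode_complex"
proof (rule filtered_isomorphic_sym[OF _ bd_barcode_complex_carrier])
  show "filtered_isomorphic \<Gamma> barcode_complex C"
    unfolding filtered_isomorphic_def
  proof (rule exI[of _ realize], intro allI conjI ballI)
    fix k x assume "x \<in> carrier (chains barcode_complex k)"
    then show "realize (k - 1) (bd barcode_complex k x) = bd C k (realize k x)"
      "lev C k (realize k x) = lev barcode_complex k x"
      by (rule realize_bd lev_realize)+
  qed (rule realize_linear realize_bij)+
qed

end

theorem proposition7p4:
  fixes \<Gamma> :: "real set"
    and C :: "(real \<Rightarrow> 'k::field, 'v) filtered_complex"
    and rep :: "int \<Rightarrow> (real set \<times> ereal) \<times> nat \<Rightarrow> real"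
  assumes "subgroup \<Gamma> real_group"
    and "floer_complex \<Gamma> C"
    and "\<And>k c L j. ((c, L), j) \<in> mset_index (verbose_barcode \<Gamma> C k) \<Longrightarrow> rep k ((c, L), j) \<in> c"
  shows "filtered_isomorphic \<Gamma> C
    (complex_direct_sum UNIV (\<lambda>k.
       complex_direct_sum (mset_index (verbose_barcode \<Gamma> C k)) (\<lambda>((c, L), j).
         elementary_complex \<Gamma> (rep k ((c, L), j)) L k)))"
proof -
  interpret floer \<Gamma> C
    by (rule floer.intro) (rule assms(2))
  have rep: "rep k b \<in> fst (fst b)" if "b \<in> bars k" for k b
    using assms(3)[of "fst (fst b)" "snd (fst b)" "snd b" k] that by simp
  let ?P = "\<lambda>k X Y. orth_frame \<Gamma> (cycles C k) (lev C k) (bars k) X \<and>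
    (\<forall>b\<in>bars k. lev C k (X b) = ereal (rep k b)) \<and>
    (\<forall>b\<in>finite_bars k. Y b \<in> carrier (chains C (k + 1)) \<and> bd C (k + 1) (Y b) = X b \<and>
       lev C (k + 1) (Y b) = ereal (rep k b) + snd (fst b)) \<and>
    (\<forall>Z. orth_frame \<Gamma> (cycles C (k + 1)) (lev C (k + 1)) (bars (k + 1)) Z \<longrightarrow>
       orth_frame \<Gamma> (chains C (k + 1)) (lev C (k + 1)) (bars (k + 1) <+> finite_bars k) (case_sum Z Y))"
  \<comment> \<open>\<open>X\<close> and \<open>Y\<close> are chosen as functions of the degree
    before any frame is formed, because the frame in degree \<open>k + 1\<close> combines
    \<open>X (k + 1)\<close> with \<open>Y k\<close>.\<close>
  have "\<forall>k. \<exists>X Y. ?P k X Y"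
    by (rule allI) (rule barcode_generators[OF assms(1) rep])
  then obtain X where "\<forall>k. \<exists>Y. ?P k (X k) Y"
    by (rule choice[THEN exE])
  then obtain Y where P: "\<forall>k. ?P k (X k) (Y k)"
    by (rule choice[THEN exE])
  interpret floer_generators \<Gamma> C rep X Y
  proof
    fix k b
    note Pk = P[THEN spec, of k, THEN conjunct1] P[THEN spec, of k, THEN conjunct2, THEN conjunct1]
      P[THEN spec, of k, THEN conjunct2, THEN conjunct2, THEN conjunct1]
    show "X k b \<in> carrier (cycles C k)" if "b \<in> bars k"
      using nonarch_normed_space.frame_carrier[OF nonarch_cycles Pk(1)] that by (rule funcset_mem)
    show "lev C k (X k b) = ereal (rep k b)" if "b \<in> bars k"
      using Pk(2) that by (rule bspec)
    show "bd C (k + 1) (Y k b) = X k b" "lev C (k + 1) (Y k b) = ereal (rep k b) + snd (fst b)"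
      if "b \<in> finite_bars k"
      using bspec[OF Pk(3) that] by blast+
    \<comment> \<open>The open slot \<open>Z\<close> is filled with \<open>X (k + 1)\<close>, a
      frame of the cycles by the choice made for \<open>k + 1\<close>.\<close>
    show "orth_frame \<Gamma> (chains C (k + 1)) (lev C (k + 1)) (bars (k + 1) <+> finite_bars k) (case_sum (X (k + 1)) (Y k))"
      by (rule P[THEN spec, of k, THEN conjunct2, THEN conjunct2, THEN conjunct2, rule_format])
         (rule P[THEN spec, of "k + 1", THEN conjunct1])
  qed
  have "(\<lambda>((c, L), j). elementary_complex \<Gamma> (rep k ((c, L), j)) L k) = bar_complex k" for k
    by (simp add: fun_eq_iff)
  then show ?thesis
    using isomorphic_barcode_complex by simp
qed

end
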